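(* Let $(\pi,E)$ be an isometric representation of the locally compact group $G$ on a reflexive Banach space $E$. The canonical identification of $L^1(G)'$ and $L^{\infty}(G)$ restricts to an isometric isomorphism between $F^*_{\pi}(G)'$ and the sum space $B_{\pi}(G)+B_{\pi'}(G)$.
   Context: $G$ is equipped with a (left) Haar measure $\mu_G$; $E'$ denotes the Banach space dual of $E$. An isometric representation $(\pi,E)$ of $G$ on a Banach space $E$ is a strongly continuous group homomorphism from $G$ to the group of surjective linear isometries of $E$; its integrated form is $\pi(f)=\int_G f(s)\pi(s)\,\mathrm{d}\mu_G(s)$, $f\in L^1(G)$. The dual representation $(\pi',E')$ is given by $[\pi'(t)\eta](\xi)=\eta(\pi(t^{-1})\xi)$ for $t\in G$, $\xi\in E$, $\eta\in E'$. The symmetrized $\pi$-pseudofunction algebra $F^*_\pi(G)$ is the completion of $L^1(G)/(\ker\pi\cap\ker\pi')$ with respect to the norm $\|f\|_{F^*_\pi}=\max\{\|\pi(f)\|,\|\pi'(f)\|\}$. For an isometric representation $\pi$, the $\pi$-Fourier–Stieltjes space is the linear subspace of $L^\infty(G)$ $$B_\pi(G)=\{\varphi:G\to\mathbb{C}\text{ measurable} : \exists C>0,\ |\varphi(f)|\le C\|\pi(f)\|\ \ \forall f\in L^1(G)\},\qquad \varphi(f)=\int_G f(s)\varphi(s)\,\mathrm{d}\mu_G(s),$$ with norm $\|\varphi\|_{B_\pi}=\inf\{C>0 : |\varphi(f)|\le C\|\pi(f)\|\ \forall f\in L^1(G)\}$. The sum space $B_\pi(G)+B_{\pi'}(G)\subset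 L^\infty(G)$ has the norm $$\|\varphi\|_{B_\pi+B_{\pi'}}=\inf\{\|\varphi_0\|_{B_\pi}+\|\varphi_1\|_{B_{\pi'}} : \varphi=\varphi_0+\varphi_1,\ \varphi_0\in B_\pi(G),\ \varphi_1\in B_{\pi'}(G)\}.$$ The canonical identification of $L^\infty(G)$ with $L^1(G)'$ is the isometric isomorphism $\varphi\mapsto\big(f\mapsto\int_G f\varphi\,\mathrm{d}\mu_G\big)$ (with $L^\infty(G)$ interpreted in the usual way, modulo locally null sets, if $G$ is not $\sigma$-compact). Since the canonical contraction $L^1(G)\to F^*_\pi(G)$ has dense range, $F^*_\pi(G)'$ is regarded as a subspace of $L^1(G)'$ (by composing functionals with this contraction). *)

theory Defs
  imports "HOL-Analysis.Analysis" "HOL-Library.FuncSet"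
begin

section \<open>Complex Banach spaces and their duals\<close>

class complex_normed_vector = real_normed_vector +
  fixes scaleC :: "complex \<Rightarrow> 'a \<Rightarrow> 'a"  (infixr "*\<^sub>C" 75)
  assumes scaleC_add_right: "c *\<^sub>C (x + y) = c *\<^sub>C x + c *\<^sub>C y"
    and scaleC_add_left: "(c + d) *\<^sub>C x = c *\<^sub>C x + d *\<^sub>C x"
    and scaleC_scaleC: "c *\<^sub>C (d *\<^sub>C x) = (c * d) *\<^sub>C x"
    and scaleR_scaleC: "r *\<^sub>R x = complex_of_real r *\<^sub>C x"
    and norm_scaleC: "norm (c *\<^sub>C x) = cmod c * norm x"

class cbanach = complex_normed_vector + banach

typedef (overloaded) ('a::complex_normed_vector) cdual =
  "{\<eta> :: 'a \<Rightarrow> complex. bounded_linear \<eta> \<and> (\<forall>c x. \<eta> (c *\<^sub>C x) = c * \<eta> x)}"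
  morphisms cdual_apply Cdual
  by (rule exI[of _ "\<lambda>_. 0"]) simp

lemma bounded_linear_cdual_apply: "bounded_linear (cdual_apply \<eta>)"
  using cdual_apply[of \<eta>] by simp

lemma cdual_apply_scaleC: "cdual_apply \<eta> (c *\<^sub>C x) = c * cdual_apply \<eta> x"
  using cdual_apply[of \<eta>] by simp

lemma cdual_eqI: "(\<And>x. cdual_apply \<eta> x = cdual_apply \<theta> x) \<Longrightarrow> \<eta> = \<theta>"
  by (metis cdual_apply_inject ext)

lemma cdual_apply_Cdual:
  assumes "bounded_linear \<eta>" and "\<And>c x. \<eta> (c *\<^sub>C x) = c * \<eta> x"
  shows "cdual_apply (Cdual \<eta>) = \<eta>"
  using assms by (simp add: Cdual_inverse)

instantiation cdual :: (complex_normed_vector) complex_normed_vector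
begin

definition zero_cdual :: "'a cdual" where "zero_cdual = Cdual (\<lambda>_. 0)"

definition plus_cdual :: "'a cdual \<Rightarrow> 'a cdual \<Rightarrow> 'a cdual"
  where "plus_cdual \<eta> \<theta> = Cdual (\<lambda>x. cdual_apply \<eta> x + cdual_apply \<theta> x)"

definition minus_cdual :: "'a cdual \<Rightarrow> 'a cdual \<Rightarrow> 'a cdual"
  where "minus_cdual \<eta> \<theta> = Cdual (\<lambda>x. cdual_apply \<eta> x - cdual_apply \<theta> x)"

definition uminus_cdual :: "'a cdual \<Rightarrow> 'a cdual"
  where "uminus_cdual \<eta> = Cdual (\<lambda>x. - cdual_apply \<eta> x)"

definition scaleR_cdual :: "real \<Rightarrow> 'a cdual \<Rightarrow> 'a cdual"
  where "scaleR_cdual r \<eta> = Cdual (\<lambda>x. r *\<^sub>R cdual_apply \<eta> x)"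

definition scaleC_cdual :: "complex \<Rightarrow> 'a cdual \<Rightarrow> 'a cdual"
  where "scaleC_cdual c \<eta> = Cdual (\<lambda>x. c * cdual_apply \<eta> x)"

definition norm_cdual :: "'a cdual \<Rightarrow> real"
  where "norm_cdual \<eta> = onorm (cdual_apply \<eta>)"

definition dist_cdual :: "'a cdual \<Rightarrow> 'a cdual \<Rightarrow> real"
  where "dist_cdual \<eta> \<theta> = norm (\<eta> - \<theta>)"

definition sgn_cdual :: "'a cdual \<Rightarrow> 'a cdual"
  where "sgn_cdual \<eta> = inverse (norm \<eta>) *\<^sub>R \<eta>"

definition uniformity_cdual :: "('a cdual \<times> 'a cdual) filter"
  where "uniformity_cdual = (INF e\<in>{0<..}. principal {(\<eta>, \<theta>). dist \<eta> \<theta> < e})"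

definition open_cdual :: "'a cdual set \<Rightarrow> bool"
  where "open_cdual S = (\<forall>\<eta>\<in>S. \<forall>\<^sub>F (\<eta>', \<theta>) in uniformity. \<eta>' = \<eta> \<longrightarrow> \<theta> \<in> S)"

lemma cdual_apply_zero [simp]: "cdual_apply 0 = (\<lambda>_. 0)"
  unfolding zero_cdual_def by (rule cdual_apply_Cdual) auto

lemma cdual_apply_add [simp]:
  "cdual_apply (\<eta> + \<theta>) = (\<lambda>x. cdual_apply \<eta> x + cdual_apply \<theta> x)"
  unfolding plus_cdual_def
  by (rule cdual_apply_Cdual)
    (auto intro!: bounded_linear_add bounded_linear_cdual_apply
      simp: cdual_apply_scaleC algebra_simps)

lemma cdual_apply_diff [simp]:
  "cdual_apply (\<eta> - \<theta>) = (\<lambda>x. cdual_apply \<eta> x - cdual_apply \<theta> x)"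
  unfolding minus_cdual_def
  by (rule cdual_apply_Cdual)
    (auto intro!: bounded_linear_sub bounded_linear_cdual_apply
      simp: cdual_apply_scaleC algebra_simps)

lemma cdual_apply_uminus [simp]: "cdual_apply (- \<eta>) = (\<lambda>x. - cdual_apply \<eta> x)"
  unfolding uminus_cdual_def
  by (rule cdual_apply_Cdual)
    (auto intro!: bounded_linear_minus bounded_linear_cdual_apply simp: cdual_apply_scaleC)

lemma cdual_apply_scaleR [simp]:
  "cdual_apply (r *\<^sub>R \<eta>) = (\<lambda>x. r *\<^sub>R cdual_apply \<eta> x)"
  unfolding scaleR_cdual_def
  by (rule cdual_apply_Cdual)
    (auto intro!: bounded_linear_const_scaleR bounded_linear_cdual_apply
      simp: cdual_apply_scaleC)

lemma cdual_apply_scaleC_left [simp]: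
  "cdual_apply (c *\<^sub>C \<eta>) = (\<lambda>x. c * cdual_apply \<eta> x)"
  unfolding scaleC_cdual_def
  by (rule cdual_apply_Cdual)
    (auto intro!: bounded_linear_const_mult bounded_linear_cdual_apply
      simp: cdual_apply_scaleC)

lemma onorm_mult_complex:
  assumes "bounded_linear (f :: 'b::real_normed_vector \<Rightarrow> complex)"
  shows "onorm (\<lambda>x. c * f x) = cmod c * onorm f"
proof (rule antisym)
  have le: "onorm (\<lambda>x. d * g x) \<le> cmod d * onorm g" if "bounded_linear g"
    for d and g :: "'b \<Rightarrow> complex"
    by (rule onorm_bound)
      (simp_all add: norm_mult mult.assoc mult_left_mono onorm onorm_pos_le that)
  show "onorm (\<lambda>x. c * f x) \<le> cmod c * onorm f"
    by (rule le[OF assms])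
  show "cmod c * onorm f \<le> onorm (\<lambda>x. c * f x)"
  proof (cases "c = 0")
    case True
    then show ?thesis by (simp add: onorm_zero)
  next
    case False
    have bl: "bounded_linear (\<lambda>x. c * f x)"
      by (rule bounded_linear_const_mult[OF assms])
    have "onorm f = onorm (\<lambda>x. inverse c * (c * f x))"
      using False by (simp add: mult.assoc[symmetric])
    also have "\<dots> \<le> cmod (inverse c) * onorm (\<lambda>x. c * f x)"
      by (rule le[OF bl])
    finally have "cmod c * onorm f \<le> cmod c * (cmod (inverse c) * onorm (\<lambda>x. c * f x))"
      by (rule mult_left_mono) simp
    also have "\<dots> = onorm (\<lambda>x. c * f x)"
      using False by (simp add: norm_inverse mult.assoc[symmetric])
    finally show ?thesis .
  qed
qed

instance
proof
  fix x y z :: "'a cdual" and a b :: real and c d :: complex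
  show "x + y + z = x + (y + z)" "x + y = y + x" "0 + x = x" "- x + x = 0" "x - y = x + - y"
    by (rule cdual_eqI; simp)+
  show "a *\<^sub>R (x + y) = a *\<^sub>R x + a *\<^sub>R y" "(a + b) *\<^sub>R x = a *\<^sub>R x + b *\<^sub>R x"
    "a *\<^sub>R b *\<^sub>R x = (a * b) *\<^sub>R x" "1 *\<^sub>R x = x"
    by (rule cdual_eqI; simp add: algebra_simps)+
  show "c *\<^sub>C (x + y) = c *\<^sub>C x + c *\<^sub>C y" "(c + d) *\<^sub>C x = c *\<^sub>C x + d *\<^sub>C x"
    "c *\<^sub>C d *\<^sub>C x = (c * d) *\<^sub>C x"
    by (rule cdual_eqI; simp add: algebra_simps)+
  show "a *\<^sub>R x = complex_of_real a *\<^sub>C x"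
    by (rule cdual_eqI) (simp add: scaleR_conv_of_real)
  show "dist x y = norm (x - y)"
    by (rule dist_cdual_def)
  show "sgn x = inverse (norm x) *\<^sub>R x"
    by (rule sgn_cdual_def)
  show "(uniformity :: ('a cdual \<times> 'a cdual) filter)
      = (INF e\<in>{0<..}. principal {(\<eta>, \<theta>). dist \<eta> \<theta> < e})"
    by (rule uniformity_cdual_def)
  show "open U = (\<forall>\<eta>\<in>U. \<forall>\<^sub>F (\<eta>', \<theta>) in uniformity. \<eta>' = \<eta> \<longrightarrow> \<theta> \<in> U)"
    for U :: "'a cdual set"
    by (rule open_cdual_def)
  have "norm x = 0 \<longleftrightarrow> (\<forall>\<xi>. cdual_apply x \<xi> = 0)"
    unfolding norm_cdual_def by (rule onorm_eq_0[OF bounded_linear_cdual_apply])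
  also have "\<dots> \<longleftrightarrow> x = 0"
    by (metis cdual_eqI cdual_apply_zero)
  finally show "norm x = 0 \<longleftrightarrow> x = 0" .
  show "norm (x + y) \<le> norm x + norm y"
    unfolding norm_cdual_def cdual_apply_add
    by (intro onorm_triangle bounded_linear_cdual_apply)
  show "norm (a *\<^sub>R x) = \<bar>a\<bar> * norm x"
    by (simp only: norm_cdual_def cdual_apply_scaleR onorm_scaleR[OF bounded_linear_cdual_apply])
  show "norm (c *\<^sub>C x) = cmod c * norm x"
    unfolding norm_cdual_def cdual_apply_scaleC_left
    by (intro onorm_mult_complex bounded_linear_cdual_apply)
qed

end

instance cdual :: (complex_normed_vector) cbanach
proof
  fix X :: "nat \<Rightarrow> 'a cdual"
  assume X: "Cauchy X"
  define B where "B \<eta> = Blinfun (cdual_apply \<eta>)" for \<eta> :: "'a cdual"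
  have B: "blinfun_apply (B \<eta>) = cdual_apply \<eta>" for \<eta>
    unfolding B_def by (rule bounded_linear_Blinfun_apply[OF bounded_linear_cdual_apply])
  have dist_B: "dist (B \<eta>) (B \<theta>) = dist \<eta> \<theta>" for \<eta> \<theta>
    by (simp only: dist_norm norm_blinfun.rep_eq norm_cdual_def B minus_blinfun.rep_eq
        cdual_apply_diff)
  have "Cauchy (\<lambda>n. B (X n))"
    using X by (simp add: Cauchy_def dist_B)
  then obtain L where L: "(\<lambda>n. B (X n)) \<longlonglongrightarrow> L"
    using Cauchy_convergent_iff convergent_def by blast
  have lim: "(\<lambda>n. cdual_apply (X n) x) \<longlonglongrightarrow> blinfun_apply L x" for x
    using bounded_linear.tendsto[OF blinfun.bounded_linear_left L, of x] by (simp add: B)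
  have "blinfun_apply L (c *\<^sub>C x) = c * blinfun_apply L x" for c x
    using LIMSEQ_unique[OF lim[of "c *\<^sub>C x"]] tendsto_mult_left[OF lim[of x], of c]
    by (simp add: cdual_apply_scaleC)
  then have "cdual_apply (Cdual (blinfun_apply L)) = blinfun_apply L"
    by (intro cdual_apply_Cdual blinfun.bounded_linear_right)
  then have BL: "B (Cdual (blinfun_apply L)) = L"
    by (intro blinfun_eqI) (simp add: B)
  have "dist (B (X n)) L = dist (X n) (Cdual (blinfun_apply L))" for n
    using dist_B[of "X n" "Cdual (blinfun_apply L)"] unfolding BL .
  with L have "X \<longlonglongrightarrow> Cdual (blinfun_apply L)"
    by (simp only: tendsto_iff)
  then show "convergent X"
    by (rule convergentI)
qed

definition reflexive_space :: "'e::complex_normed_vector itself \<Rightarrow> bool" where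
  "reflexive_space _ \<longleftrightarrow>
    (\<forall>\<Psi> :: 'e cdual cdual. \<exists>\<xi> :: 'e. \<forall>\<eta>. cdual_apply \<Psi> \<eta> = cdual_apply \<eta> \<xi>)"


section \<open>Haar measure and isometric representations\<close>

text \<open>
  The group law is written additively because \<^class>\<open>topological_group_add\<close> is the library's
  class of topological groups; it is not assumed commutative.
\<close>

definition left_haar_measure ::
    "'g::{t2_space, topological_group_add} measure \<Rightarrow> bool" where
  "left_haar_measure \<mu> \<longleftrightarrow>
    sets \<mu> = sets borel \<and>
    emeasure \<mu> UNIV \<noteq> 0 \<and>
    (\<forall>K. compact K \<longrightarrow> emeasure \<mu> K < \<infinity>) \<and>
    (\<forall>A\<in>sets borel. emeasure \<mu> A = (INF U\<in>{U. open U \<and> A \<subseteq> U}. emeasure \<mu> U)) \<and>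
    (\<forall>U. open U \<longrightarrow> emeasure \<mu> U = (SUP K\<in>{K. compact K \<and> K \<subseteq> U}. emeasure \<mu> K)) \<and>
    (\<forall>g. \<forall>A\<in>sets borel. emeasure \<mu> ((\<lambda>x. g + x) ` A) = emeasure \<mu> A)"

definition isometric_rep ::
    "('g::topological_group_add \<Rightarrow> 'e::complex_normed_vector \<Rightarrow> 'e) \<Rightarrow> bool" where
  "isometric_rep \<pi> \<longleftrightarrow>
    (\<forall>s. surj (\<pi> s) \<and>
      (\<forall>\<xi> \<zeta>. \<pi> s (\<xi> + \<zeta>) = \<pi> s \<xi> + \<pi> s \<zeta>) \<and>
      (\<forall>c \<xi>. \<pi> s (c *\<^sub>C \<xi>) = c *\<^sub>C \<pi> s \<xi>) \<and>
      (\<forall>\<xi>. norm (\<pi> s \<xi>) = norm \<xi>)) \<and>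
    (\<forall>s t. \<pi> (s + t) = \<pi> s \<circ> \<pi> t) \<and>
    (\<forall>\<xi>. continuous_on UNIV (\<lambda>s. \<pi> s \<xi>))"

definition dual_rep ::
    "('g::group_add \<Rightarrow> 'e::complex_normed_vector \<Rightarrow> 'e) \<Rightarrow> 'g \<Rightarrow> 'e cdual \<Rightarrow> 'e cdual" where
  "dual_rep \<pi> t \<eta> = Cdual (\<lambda>\<xi>. cdual_apply \<eta> (\<pi> (- t) \<xi>))"

text \<open>
  The integral of the vector-valued function \<open>s \<mapsto> f s \<cdot> \<pi> s \<xi>\<close> is taken weakly: the Bochner
  integral of the library is confined to second-countable target spaces, and \<open>'e\<close> need not be
  separable.
\<close>

definition integrated_form ::
    "'g measure \<Rightarrow> ('g \<Rightarrow> 'e::complex_normed_vector \<Rightarrow> 'e) \<Rightarrow> ('g \<Rightarrow> complex) \<Rightarrow> 'e \<Rightarrow> 'e" where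
  "integrated_form \<mu> \<pi> f \<xi> =
    (THE \<zeta>. \<forall>\<eta>. cdual_apply \<eta> \<zeta> = (\<integral>s. f s * cdual_apply \<eta> (\<pi> s \<xi>) \<partial>\<mu>))"


section \<open>Seminormed spaces with explicit carriers\<close>

text \<open>
  The function spaces below depend on a measure and on a representation, so they cannot be types;
  they are complex seminormed spaces given by a carrier and operations on it.
\<close>

record 'a cspace =
  vecs :: "'a set"
  vadd :: "'a \<Rightarrow> 'a \<Rightarrow> 'a"
  vscale :: "complex \<Rightarrow> 'a \<Rightarrow> 'a"
  vnorm :: "'a \<Rightarrow> real"

definition vdiff :: "'a cspace \<Rightarrow> 'a \<Rightarrow> 'a \<Rightarrow> 'a" where
  "vdiff X x y = vadd X x (vscale X (- 1) y)"

definition rep :: "'a set \<Rightarrow> 'a" where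
  "rep A = (SOME a. a \<in> A)"

definition coset_rel :: "'a cspace \<Rightarrow> 'a set \<Rightarrow> ('a \<times> 'a) set" where
  "coset_rel X N = {(x, y). x \<in> vecs X \<and> y \<in> vecs X \<and> vdiff X x y \<in> N}"

text \<open>
  The quotient by a linear subspace \<open>N\<close>. The norm is read off a representative, so this is
  meant for subspaces on which the seminorm vanishes; all quotients below are of this kind.
\<close>

definition quotient_space :: "'a cspace \<Rightarrow> 'a set \<Rightarrow> 'a set cspace" where
  "quotient_space X N =
    \<lparr>vecs = vecs X // coset_rel X N,
     vadd = (\<lambda>A B. coset_rel X N `` {vadd X (rep A) (rep B)}),
     vscale = (\<lambda>c A. coset_rel X N `` {vscale X c (rep A)}),
     vnorm = (\<lambda>A. vnorm X (rep A))\<rparr>"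

text \<open>The completion: Cauchy sequences modulo null sequences.\<close>

definition cauchy_seqs :: "'a cspace \<Rightarrow> (nat \<Rightarrow> 'a) set" where
  "cauchy_seqs X =
    {x. (\<forall>n. x n \<in> vecs X) \<and>
        (\<forall>e>0. \<exists>M. \<forall>m\<ge>M. \<forall>n\<ge>M. vnorm X (vdiff X (x m) (x n)) < e)}"

definition cauchy_rel :: "'a cspace \<Rightarrow> ((nat \<Rightarrow> 'a) \<times> (nat \<Rightarrow> 'a)) set" where
  "cauchy_rel X =
    {(x, y). x \<in> cauchy_seqs X \<and> y \<in> cauchy_seqs X \<and>
             (\<lambda>n. vnorm X (vdiff X (x n) (y n))) \<longlonglongrightarrow> 0}"

definition completion :: "'a cspace \<Rightarrow> (nat \<Rightarrow> 'a) set cspace" where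
  "completion X =
    \<lparr>vecs = cauchy_seqs X // cauchy_rel X,
     vadd = (\<lambda>A B. cauchy_rel X `` {\<lambda>n. vadd X (rep A n) (rep B n)}),
     vscale = (\<lambda>c A. cauchy_rel X `` {\<lambda>n. vscale X c (rep A n)}),
     vnorm = (\<lambda>A. lim (\<lambda>n. vnorm X (rep A n)))\<rparr>"

definition completion_embed :: "'a cspace \<Rightarrow> 'a \<Rightarrow> (nat \<Rightarrow> 'a) set" where
  "completion_embed X x = cauchy_rel X `` {\<lambda>_. x}"

text \<open>
  Functionals are \<^const>\<open>undefined\<close> off the carrier, so that equality of functionals is
  equality on the carrier.
\<close>

definition dual_space :: "'a cspace \<Rightarrow> ('a \<Rightarrow> complex) cspace" where
  "dual_space X =
    \<lparr>vecs = {\<Lambda> \<in> extensional (vecs X).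
       (\<forall>x\<in>vecs X. \<forall>y\<in>vecs X. \<Lambda> (vadd X x y) = \<Lambda> x + \<Lambda> y) \<and>
       (\<forall>c. \<forall>x\<in>vecs X. \<Lambda> (vscale X c x) = c * \<Lambda> x) \<and>
       (\<exists>C. \<forall>x\<in>vecs X. cmod (\<Lambda> x) \<le> C * vnorm X x)},
     vadd = (\<lambda>\<Lambda> M. \<lambda>x\<in>vecs X. \<Lambda> x + M x),
     vscale = (\<lambda>c \<Lambda>. \<lambda>x\<in>vecs X. c * \<Lambda> x),
     vnorm = (\<lambda>\<Lambda>. SUP x\<in>{x \<in> vecs X. vnorm X x \<le> 1}. cmod (\<Lambda> x))\<rparr>"

text \<open>The sum of two normed spaces \<open>Y\<close> and \<open>Z\<close> whose carriers are subspaces of \<open>X\<close>.\<close>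

definition sum_space :: "'a cspace \<Rightarrow> 'a cspace \<Rightarrow> 'a cspace \<Rightarrow> 'a cspace" where
  "sum_space X Y Z = X
    \<lparr>vecs := {vadd X y z |y z. y \<in> vecs Y \<and> z \<in> vecs Z},
     vnorm := (\<lambda>x. Inf {vnorm Y y + vnorm Z z |y z.
       y \<in> vecs Y \<and> z \<in> vecs Z \<and> x = vadd X y z})\<rparr>"

definition isometric_isomorphism :: "'a cspace \<Rightarrow> 'b cspace \<Rightarrow> ('a \<Rightarrow> 'b) \<Rightarrow> bool" where
  "isometric_isomorphism X Y T \<longleftrightarrow>
    bij_betw T (vecs X) (vecs Y) \<and>
    (\<forall>x\<in>vecs X. \<forall>y\<in>vecs X. T (vadd X x y) = vadd Y (T x) (T y)) \<and>
    (\<forall>c. \<forall>x\<in>vecs X. T (vscale X c x) = vscale Y c (T x)) \<and>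
    (\<forall>x\<in>vecs X. vnorm Y (T x) = vnorm X x)"


section \<open>The spaces of integrable and of locally essentially bounded functions\<close>

text \<open>
  Elements of \<open>L1 \<mu>\<close> are functions, not classes; null functions have seminorm zero, hence are
  annihilated by every element of \<open>dual_space (L1 \<mu>)\<close>.
\<close>

definition L1 :: "'g measure \<Rightarrow> ('g \<Rightarrow> complex) cspace" where
  "L1 \<mu> =
    \<lparr>vecs = {f. integrable \<mu> f},
     vadd = (\<lambda>f g x. f x + g x),
     vscale = (\<lambda>c f x. c * f x),
     vnorm = (\<lambda>f. \<integral>x. cmod (f x) \<partial>\<mu>)\<rparr>"

text \<open>
  For groups that are not \<open>\<sigma>\<close>-compact, measurability and null sets of bounded functions are
  understood locally, that is, on Borel sets of finite measure.
\<close>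

definition locally_measurable :: "'g measure \<Rightarrow> ('g \<Rightarrow> complex) \<Rightarrow> bool" where
  "locally_measurable \<mu> \<phi> \<longleftrightarrow>
    (\<forall>F\<in>sets \<mu>. emeasure \<mu> F < \<infinity> \<longrightarrow> \<phi> \<in> borel_measurable (restrict_space \<mu> F))"

definition locally_AE :: "'g measure \<Rightarrow> ('g \<Rightarrow> bool) \<Rightarrow> bool" where
  "locally_AE \<mu> P \<longleftrightarrow>
    (\<forall>F\<in>sets \<mu>. emeasure \<mu> F < \<infinity> \<longrightarrow> (AE x in \<mu>. x \<in> F \<longrightarrow> P x))"

definition Linf_functions :: "'g measure \<Rightarrow> ('g \<Rightarrow> complex) cspace" where
  "Linf_functions \<mu> =
    \<lparr>vecs = {\<phi>. locally_measurable \<mu> \<phi> \<and> (\<exists>C. locally_AE \<mu> (\<lambda>x. cmod (\<phi> x) \<le> C))},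
     vadd = (\<lambda>\<phi> \<psi> x. \<phi> x + \<psi> x),
     vscale = (\<lambda>c \<phi> x. c * \<phi> x),
     vnorm = (\<lambda>\<phi>. Inf {C. 0 \<le> C \<and> locally_AE \<mu> (\<lambda>x. cmod (\<phi> x) \<le> C)})\<rparr>"

definition Linf :: "'g measure \<Rightarrow> ('g \<Rightarrow> complex) set cspace" where
  "Linf \<mu> = quotient_space (Linf_functions \<mu>)
     {\<phi> \<in> vecs (Linf_functions \<mu>). locally_AE \<mu> (\<lambda>x. \<phi> x = 0)}"

definition Linf_functional ::
    "'g measure \<Rightarrow> ('g \<Rightarrow> complex) set \<Rightarrow> ('g \<Rightarrow> complex) \<Rightarrow> complex" where
  "Linf_functional \<mu> \<Phi> = (\<lambda>f\<in>vecs (L1 \<mu>). \<integral>x. f x * rep \<Phi> x \<partial>\<mu>)"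


section \<open>Fourier--Stieltjes spaces and symmetrized pseudofunctions\<close>

definition FS_bounds ::
    "'g measure \<Rightarrow> ('g \<Rightarrow> 'e::complex_normed_vector \<Rightarrow> 'e) \<Rightarrow> ('g \<Rightarrow> complex) set \<Rightarrow> real set" where
  "FS_bounds \<mu> \<pi> \<Phi> =
    {C. C > 0 \<and> (\<forall>f\<in>vecs (L1 \<mu>).
      cmod (Linf_functional \<mu> \<Phi> f) \<le> C * onorm (integrated_form \<mu> \<pi> f))}"

definition FS_space ::
    "'g measure \<Rightarrow> ('g \<Rightarrow> 'e::complex_normed_vector \<Rightarrow> 'e) \<Rightarrow> ('g \<Rightarrow> complex) set cspace" where
  "FS_space \<mu> \<pi> = (Linf \<mu>)
    \<lparr>vecs := {\<Phi> \<in> vecs (Linf \<mu>). FS_bounds \<mu> \<pi> \<Phi> \<noteq> {}},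
     vnorm := (\<lambda>\<Phi>. Inf (FS_bounds \<mu> \<pi> \<Phi>))\<rparr>"

definition FS_sum_space ::
    "'g::group_add measure \<Rightarrow> ('g \<Rightarrow> 'e::complex_normed_vector \<Rightarrow> 'e) \<Rightarrow>
     ('g \<Rightarrow> complex) set cspace" where
  "FS_sum_space \<mu> \<pi> =
    sum_space (Linf \<mu>) (FS_space \<mu> \<pi>) (FS_space \<mu> (dual_rep \<pi>))"

definition rep_kernel ::
    "'g measure \<Rightarrow> ('g \<Rightarrow> 'e::complex_normed_vector \<Rightarrow> 'e) \<Rightarrow> ('g \<Rightarrow> complex) set" where
  "rep_kernel \<mu> \<pi> = {f \<in> vecs (L1 \<mu>). integrated_form \<mu> \<pi> f = (\<lambda>_. 0)}"

definition pre_pseudofunctions ::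
    "'g::group_add measure \<Rightarrow> ('g \<Rightarrow> 'e::complex_normed_vector \<Rightarrow> 'e) \<Rightarrow>
     ('g \<Rightarrow> complex) set cspace" where
  "pre_pseudofunctions \<mu> \<pi> =
    quotient_space
      ((L1 \<mu>)\<lparr>vnorm := (\<lambda>f. max (onorm (integrated_form \<mu> \<pi> f))
                                 (onorm (integrated_form \<mu> (dual_rep \<pi>) f)))\<rparr>)
      (rep_kernel \<mu> \<pi> \<inter> rep_kernel \<mu> (dual_rep \<pi>))"

definition sym_pseudofunctions ::
    "'g::group_add measure \<Rightarrow> ('g \<Rightarrow> 'e::complex_normed_vector \<Rightarrow> 'e) \<Rightarrow>
     (nat \<Rightarrow> ('g \<Rightarrow> complex) set) set cspace" where
  "sym_pseudofunctions \<mu> \<pi> = completion (pre_pseudofunctions \<mu> \<pi>)"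

definition L1_to_pseudofunctions ::
    "'g::group_add measure \<Rightarrow> ('g \<Rightarrow> 'e::complex_normed_vector \<Rightarrow> 'e) \<Rightarrow>
     ('g \<Rightarrow> complex) \<Rightarrow> (nat \<Rightarrow> ('g \<Rightarrow> complex) set) set" where
  "L1_to_pseudofunctions \<mu> \<pi> f =
    completion_embed (pre_pseudofunctions \<mu> \<pi>)
      (coset_rel (L1 \<mu>) (rep_kernel \<mu> \<pi> \<inter> rep_kernel \<mu> (dual_rep \<pi>)) `` {f})"

definition restrict_to_L1 ::
    "'g::group_add measure \<Rightarrow> ('g \<Rightarrow> 'e::complex_normed_vector \<Rightarrow> 'e) \<Rightarrow>
     ((nat \<Rightarrow> ('g \<Rightarrow> complex) set) set \<Rightarrow> complex) \<Rightarrow> ('g \<Rightarrow> complex) \<Rightarrow> complex" where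
  "restrict_to_L1 \<mu> \<pi> \<Lambda> = (\<lambda>f\<in>vecs (L1 \<mu>). \<Lambda> (L1_to_pseudofunctions \<mu> \<pi> f))"

text \<open>
  The dual of the symmetrized pseudofunctions as a linear subspace of the dual of \<open>L1 \<mu>\<close>: the
  image under \<^const>\<open>restrict_to_L1\<close>, with the norm of the (unique) preimage.
\<close>

definition pseudofunction_dual ::
    "'g::group_add measure \<Rightarrow> ('g \<Rightarrow> 'e::complex_normed_vector \<Rightarrow> 'e) \<Rightarrow>
     (('g \<Rightarrow> complex) \<Rightarrow> complex) cspace" where
  "pseudofunction_dual \<mu> \<pi> =
    (let D = dual_space (sym_pseudofunctions \<mu> \<pi>) in
     (dual_space (L1 \<mu>))
       \<lparr>vecs := restrict_to_L1 \<mu> \<pi> ` vecs D,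
        vnorm := (\<lambda>\<psi>. vnorm D (inv_into (vecs D) (restrict_to_L1 \<mu> \<pi>) \<psi>))\<rparr>)"

end

theory Submission
  imports Defs
begin

text \<open>
  Write \<open>P\<^sub>0 f = \<parallel>\<pi>(f)\<parallel>\<close> and \<open>P\<^sub>1 f = \<parallel>\<pi>'(f)\<parallel>\<close>. A functional on the completion is determined by its
  values on the image of \<open>L\<^sup>1\<close>, so the dual of the symmetrized pseudofunctions is the space of linear
  functionals \<open>\<psi>\<close> on \<open>L\<^sup>1\<close> with \<open>\<bar>\<psi>\<bar> \<le> C max(P\<^sub>0, P\<^sub>1)\<close>, normed by the least \<open>C\<close>
  (\<open>inj_on_restrict_completion_functional\<close>, \<open>extend_to_completion\<close>, \<open>dual_norm_restrict_least\<close>).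

  Sums of functionals bounded by \<open>C\<^sub>0 P\<^sub>0\<close> and by \<open>C\<^sub>1 P\<^sub>1\<close> are of this kind with \<open>C = C\<^sub>0 + C\<^sub>1\<close>.
  Conversely, such a \<open>\<psi>\<close> lives on the diagonal \<open>{(\<pi>(f), \<pi>'(f))}\<close> of a product of two operator spaces with the
  maximum norm. By Hahn--Banach it extends to the product without increase of norm, and the extension
  is a sum of functionals of the two components whose norms add up to at most \<open>C\<close>
  (\<open>functional_on_sup_sum_splits\<close>). This gives both the equality of the two spaces and that of the
  norms.

  It remains to see that functionals dominated by \<open>P\<^sub>0\<close> or \<open>P\<^sub>1\<close> come from functions. Both seminorms
  are at most the \<open>L\<^sup>1\<close> norm, so what is needed is that the dual of \<open>L\<^sup>1\<close> is \<open>L\<^sup>\<infinity>\<close>. For a Haar measure that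
  is not \<open>\<sigma>\<close>-finite this rests on a partition of the group into pieces of finite measure such that
  every set of finite measure is covered by countably many of them: the cosets of an open
  \<open>\<sigma>\<close>-compact subgroup, cut along an exhaustion by compact sets (\<open>haar_decomposition\<close>). On each piece
  Radon--Nikodym supplies a density, and the densities are glued (\<open>Linf_functional_surj\<close>).

  Reflexivity makes the weakly defined integrals exist: \<open>\<eta> \<mapsto> \<integral> f(s) \<eta>(\<pi>(s)\<xi>)\<close> is an element of the
  bidual, hence evaluation at a vector, and the dual of a reflexive space is reflexive, so that
  the same argument serves \<open>\<pi>'\<close>.
\<close>

section \<open>The Hahn--Banach theorem\<close>

definition sublinear :: "('a::real_vector \<Rightarrow> real) \<Rightarrow> bool" where
  "sublinear p \<longleftrightarrow> (\<forall>x y. p (x + y) \<le> p x + p y) \<and> (\<forall>t x. 0 \<le> t \<longrightarrow> p (t *\<^sub>R x) = t * p x)"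

lemma sublinear_add: "sublinear p \<Longrightarrow> p (x + y) \<le> p x + p y"
  and sublinear_scale: "sublinear p \<Longrightarrow> 0 \<le> t \<Longrightarrow> p (t *\<^sub>R x) = t * p x"
  by (auto simp: sublinear_def)

lemma sublinear_0: "sublinear p \<Longrightarrow> p 0 = 0"
  using sublinear_scale[of p 0 0] by simp

lemma sublinear_lower: "sublinear p \<Longrightarrow> - p (- x) \<le> p x"
  using sublinear_add[of p x "- x"] by (simp add: sublinear_0)

lemma sublinearI:
  assumes add: "\<And>x y. p (x + y) \<le> p x + p y"
    and zero: "p 0 = 0"
    and scale: "\<And>t x. 0 < t \<Longrightarrow> p (t *\<^sub>R x) \<le> t * p x"
  shows "sublinear p"
  unfolding sublinear_def
proof (intro conjI allI impI)
  fix t :: real and x :: 'a assume "0 \<le> t"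
  show "p (t *\<^sub>R x) = t * p x"
  proof (cases "t = 0")
    case False
    with \<open>0 \<le> t\<close> have t: "0 < t" by simp
    have "p (inverse t *\<^sub>R t *\<^sub>R x) \<le> inverse t * p (t *\<^sub>R x)"
      using t by (intro scale) simp
    with t have "t * p x \<le> p (t *\<^sub>R x)"
      by (simp add: field_simps)
    with scale[OF t, of x] show ?thesis by simp
  qed (simp add: zero)
qed (rule add)

text \<open>
  Lowers a sublinear functional \<open>p\<close> to a sublinear \<open>q\<close> that lies below \<open>\<psi>\<close> on the convex cone \<open>M\<close>, by
  taking the infimum of \<open>p (x - m) + \<psi> m\<close> over \<open>m \<in> M\<close>; the bound \<open>- \<psi> m \<le> p (- m)\<close> keeps the infimum
  finite. Working with cones lets the same construction serve for the half line in
  \<open>sublinear_peak\<close> and for the subspace in \<open>hahn_banach\<close>.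
\<close>

lemma sublinear_inf_convolution:
  fixes p :: "'a::real_vector \<Rightarrow> real"
  assumes p: "sublinear p"
    and M0: "0 \<in> M" and Madd: "\<And>x y. x \<in> M \<Longrightarrow> y \<in> M \<Longrightarrow> x + y \<in> M"
    and Mscale: "\<And>t x. x \<in> M \<Longrightarrow> 0 \<le> t \<Longrightarrow> t *\<^sub>R x \<in> M"
    and add: "\<And>x y. x \<in> M \<Longrightarrow> y \<in> M \<Longrightarrow> \<psi> (x + y) = \<psi> x + \<psi> y"
    and scale: "\<And>t x. x \<in> M \<Longrightarrow> 0 \<le> t \<Longrightarrow> \<psi> (t *\<^sub>R x) = t * \<psi> x"
    and dom: "\<And>m. m \<in> M \<Longrightarrow> - \<psi> m \<le> p (- m)"
  obtains q where "sublinear q" "\<And>x. q x \<le> p x" "\<And>m. m \<in> M \<Longrightarrow> q m \<le> \<psi> m"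
proof -
  define q where "q x = (INF m\<in>M. p (x - m) + \<psi> m)" for x
  have \<psi>0: "\<psi> 0 = 0" using scale[OF M0, of 0] by simp
  have lower: "- p (- x) \<le> p (x - m) + \<psi> m" if "m \<in> M" for x m
    using sublinear_add[OF p, of "x - m" "- x"] dom[OF that] by simp
  have le: "q x \<le> p (x - m) + \<psi> m" if "m \<in> M" for x m
    unfolding q_def using lower that by (intro cINF_lower bdd_belowI2[where m = "- p (- x)"]) auto
  have ge: "c \<le> q x" if "\<And>m. m \<in> M \<Longrightarrow> c \<le> p (x - m) + \<psi> m" for c x
    unfolding q_def using M0 that by (intro cINF_greatest) auto
  have "sublinear q"
  proof (rule sublinearI)
    fix x y
    have "q (x + y) - (p (y - n) + \<psi> n) \<le> q x" if n: "n \<in> M" for n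
    proof (rule ge)
      fix m assume m: "m \<in> M"
      have "q (x + y) \<le> p ((x - m) + (y - n)) + \<psi> (m + n)"
        using le[OF Madd[OF m n], of "x + y"] by (simp add: algebra_simps)
      also have "\<dots> \<le> p (x - m) + p (y - n) + (\<psi> m + \<psi> n)"
        using sublinear_add[OF p] add[OF m n] by (simp add: add_mono)
      finally show "q (x + y) - (p (y - n) + \<psi> n) \<le> p (x - m) + \<psi> m" by simp
    qed
    then have "q (x + y) - q x \<le> q y"
      by (intro ge) (simp add: algebra_simps)
    then show "q (x + y) \<le> q x + q y" by simp
  next
    show "q 0 = 0"
    proof (rule antisym)
      show "q 0 \<le> 0" using le[OF M0, of 0] by (simp add: sublinear_0[OF p] \<psi>0)
      show "0 \<le> q 0" using lower[of _ 0] by (intro ge) (simp add: sublinear_0[OF p])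
    qed
  next
    fix t :: real and x assume t: "0 < t"
    have "inverse t * q (t *\<^sub>R x) \<le> q x"
    proof (rule ge)
      fix m assume m: "m \<in> M"
      have "q (t *\<^sub>R x) \<le> p (t *\<^sub>R (x - m)) + \<psi> (t *\<^sub>R m)"
        using le[OF Mscale[OF m], of t "t *\<^sub>R x"] t by (simp add: algebra_simps)
      also have "\<dots> = t * (p (x - m) + \<psi> m)"
        using t sublinear_scale[OF p, of t "x - m"] scale[OF m, of t] by (simp add: distrib_left)
      finally show "inverse t * q (t *\<^sub>R x) \<le> p (x - m) + \<psi> m"
        using t by (simp add: field_simps)
    qed
    then show "q (t *\<^sub>R x) \<le> t * q x"
      using t by (simp add: field_simps)
  qed
  moreover have "q x \<le> p x" for x
    using le[OF M0, of x] \<psi>0 by simp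
  moreover have "q m \<le> \<psi> m" if "m \<in> M" for m
    using le[OF that, of m] by (simp add: sublinear_0[OF p])
  ultimately show thesis using that by blast
qed

text \<open>
  The cone is the half line spanned by \<open>- y\<close>, with \<open>\<psi> (- t y) = - t q(y)\<close>. The conclusion forces a
  minimal sublinear functional to be odd, and it yields norming functionals.
\<close>

lemma sublinear_peak:
  fixes q :: "'a::real_vector \<Rightarrow> real"
  assumes q: "sublinear q"
  obtains r where "sublinear r" "\<And>x. r x \<le> q x" "r (- y) \<le> - q y"
proof -
  define M where "M = {t *\<^sub>R (- y) |t. 0 \<le> t}"
  define \<psi> where "\<psi> m = - q (- m)" for m
  have M: "\<exists>t\<ge>0. m = t *\<^sub>R (- y)" if "m \<in> M" for m
    using that by (auto simp: M_def)
  have \<psi>: "\<psi> (t *\<^sub>R (- y)) = - (t * q y)" if "0 \<le> t" for t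
    using sublinear_scale[OF q that, of y] by (simp add: \<psi>_def)
  obtain r where r: "sublinear r" "\<And>x. r x \<le> q x" "\<And>m. m \<in> M \<Longrightarrow> r m \<le> \<psi> m"
  proof (rule sublinear_inf_convolution[OF q, of M \<psi>])
    show "0 \<in> M" by (auto simp: M_def intro: exI[of _ 0])
    fix x assume x: "x \<in> M"
    obtain a where a: "0 \<le> a" "x = a *\<^sub>R (- y)" using M[OF x] by blast
    show "t *\<^sub>R x \<in> M" if "0 \<le> t" for t
      using a that by (auto simp: M_def intro!: exI[of _ "t * a"])
    show "\<psi> (t *\<^sub>R x) = t * \<psi> x" if "0 \<le> t" for t
      using \<psi>[of "t * a"] \<psi>[of a] a that by simp
    show "- \<psi> x \<le> q (- x)" by (simp add: \<psi>_def)
    fix z assume z: "z \<in> M"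
    obtain b where b: "0 \<le> b" "z = b *\<^sub>R (- y)" using M[OF z] by blast
    have s: "x + z = (a + b) *\<^sub>R (- y)" using a b by (simp add: algebra_simps)
    show "x + z \<in> M" using a b s unfolding M_def by (intro CollectI exI[of _ "a + b"]) simp
    show "\<psi> (x + z) = \<psi> x + \<psi> z"
      unfolding s using \<psi>[of "a + b"] \<psi>[of a] \<psi>[of b] a b by (simp add: algebra_simps)
  qed blast
  have "- y \<in> M" by (auto simp: M_def intro: exI[of _ 1])
  from r(3)[OF this] have "r (- y) \<le> - q y" using \<psi>[of 1] by simp
  then show thesis by (rule that[OF r(1,2)])
qed

text \<open>
  Zorn's lemma: the pointwise infimum of a chain of sublinear functionals below \<open>p\<close> is again
  sublinear. It is finite because each of them is at least \<open>- p (- x)\<close> at \<open>x\<close>.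
\<close>

lemma minimal_sublinear_exists:
  fixes p :: "'a::real_vector \<Rightarrow> real"
  assumes p: "sublinear p"
  obtains q where "sublinear q" "\<And>x. q x \<le> p x"
    "\<And>r. sublinear r \<Longrightarrow> (\<And>x. r x \<le> q x) \<Longrightarrow> r = q"
proof -
  define A where "A = {q. sublinear q \<and> q \<le> p}"
  define P :: "('a \<Rightarrow> real) \<Rightarrow> ('a \<Rightarrow> real) \<Rightarrow> bool" where "P q r \<longleftrightarrow> r \<le> q" for q r
  have po: "partial_order_on A (relation_of P A)"
    by (rule partial_order_on_relation_ofI) (auto simp: P_def)
  have chain: "\<exists>u\<in>A. \<forall>a\<in>C. P a u" if C: "C \<in> Chains (relation_of P A)" for C
  proof (cases "C = {}")
    case True
    then show ?thesis using p by (auto simp: A_def)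
  next
    case False
    have CA: "a \<in> A" if "a \<in> C" for a
      using C that by (auto simp: Chains_def relation_of_def)
    have tot: "a \<le> b \<or> b \<le> a" if "a \<in> C" "b \<in> C" for a b
      using C that by (auto simp: Chains_def relation_of_def P_def)
    define u where "u x = (INF a\<in>C. a x)" for x
    have lower: "- p (- x) \<le> a x" if "a \<in> C" for a x
    proof -
      have "sublinear a" "a (- x) \<le> p (- x)"
        using CA[OF that] by (auto simp: A_def le_fun_def)
      with sublinear_lower[of a x] show ?thesis by linarith
    qed
    have le: "u x \<le> a x" if "a \<in> C" for x a
      unfolding u_def using that lower
      by (intro cINF_lower bdd_belowI2[where m = "- p (- x)"]) auto
    have ge: "c \<le> u x" if "\<And>a. a \<in> C \<Longrightarrow> c \<le> a x" for c x
      unfolding u_def using False that by (intro cINF_greatest) auto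
    have sl: "sublinear a" if "a \<in> C" for a
      using CA[OF that] by (simp add: A_def)
    have "sublinear u"
    proof (rule sublinearI)
      fix x y
      have "u (x + y) - b y \<le> u x" if b: "b \<in> C" for b
      proof (rule ge)
        fix a assume a: "a \<in> C"
        show "u (x + y) - b y \<le> a x"
          using tot[OF a b]
        proof
          assume "a \<le> b"
          then show ?thesis
            using le[OF a, of "x + y"] sublinear_add[OF sl[OF a], of x y] le_funD[of a b y] by linarith
        next
          assume "b \<le> a"
          then show ?thesis
            using le[OF b, of "x + y"] sublinear_add[OF sl[OF b], of x y] le_funD[of b a x] by linarith
        qed
      qed
      then have "u (x + y) - u x \<le> u y"
        by (intro ge) (simp add: algebra_simps)
      then show "u (x + y) \<le> u x + u y" by simp
    next
      have zero: "a 0 = 0" if "a \<in> C" for a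
        using sublinear_0 sl that by blast
      obtain a where a: "a \<in> C" using False by blast
      have "u 0 \<le> 0" using le[OF a, of 0] zero[OF a] by simp
      moreover have "0 \<le> u 0" by (rule ge) (simp add: zero)
      ultimately show "u 0 = 0" by simp
    next
      fix t :: real and x assume t: "0 < t"
      have "inverse t * u (t *\<^sub>R x) \<le> u x"
      proof (rule ge)
        fix a assume a: "a \<in> C"
        show "inverse t * u (t *\<^sub>R x) \<le> a x"
          using le[OF a, of "t *\<^sub>R x"] t sublinear_scale[OF sl[OF a], of t x] by (simp add: field_simps)
      qed
      then show "u (t *\<^sub>R x) \<le> t * u x"
        using t by (simp add: field_simps)
    qed
    moreover obtain a where "a \<in> C" using False by blast
    then have "u \<le> p"
      using le[of a] CA[of a] by (force simp: A_def le_fun_def intro: order_trans)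
    ultimately have "u \<in> A" by (simp add: A_def)
    then show ?thesis
      using le by (auto simp: P_def le_fun_def)
  qed
  from predicate_Zorn[OF po chain] obtain q
    where q: "q \<in> A" "\<And>a. a \<in> A \<Longrightarrow> P q a \<Longrightarrow> a = q" by blast
  show thesis
  proof (rule that)
    show "sublinear q" "\<And>x. q x \<le> p x"
      using q(1) by (auto simp: A_def le_fun_def)
    fix r assume r: "sublinear r" "\<And>x. r x \<le> q x"
    then have "r \<le> q" by (simp add: le_fun_def)
    moreover have "q \<le> p" using q(1) by (simp add: A_def)
    ultimately have "r \<in> A" "P q r" using r(1) by (auto simp: A_def P_def)
    then show "r = q" by (rule q(2))
  qed
qed

text \<open>
  By \<open>sublinear_peak\<close> a minimal functional satisfies \<open>q (- y) \<le> - q y\<close>; so it is odd, and an odd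
  subadditive functional is additive.
\<close>

lemma minimal_sublinear_linear:
  fixes q :: "'a::real_vector \<Rightarrow> real"
  assumes q: "sublinear q"
    and min: "\<And>r. sublinear r \<Longrightarrow> (\<And>x. r x \<le> q x) \<Longrightarrow> r = q"
  shows "linear q"
proof -
  have neg: "q (- y) = - q y" for y
  proof -
    obtain r where r: "sublinear r" "\<And>x. r x \<le> q x" "r (- y) \<le> - q y"
      using sublinear_peak[OF q] by blast
    then have "q (- y) \<le> - q y" using min[of r] by simp
    then show ?thesis using sublinear_lower[OF q, of "- y"] by simp
  qed
  show ?thesis
  proof (rule linearI)
    fix x y
    have "q (- x + - y) \<le> q (- x) + q (- y)" by (rule sublinear_add[OF q])
    moreover have "q (- x + - y) = - q (x + y)" using neg[of "x + y"] by (simp add: algebra_simps)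
    ultimately show "q (x + y) = q x + q y"
      using sublinear_add[OF q, of x y] neg[of x] neg[of y] by linarith
  next
    fix t :: real and x
    show "q (t *\<^sub>R x) = t *\<^sub>R q x"
    proof (cases "0 \<le> t")
      case False
      then have "q ((- t) *\<^sub>R x) = - t * q x" by (intro sublinear_scale[OF q]) simp
      then show ?thesis using neg[of "t *\<^sub>R x"] by simp
    qed (simp add: sublinear_scale[OF q])
  qed
qed

text \<open>
  Push \<open>p\<close> below \<open>\<psi>\<close> on \<open>M\<close> and take a minimal sublinear functional below the result. It is linear
  and at most \<open>\<psi>\<close> on \<open>M\<close>; since \<open>M = - M\<close>, it equals \<open>\<psi>\<close> there.
\<close>

theorem hahn_banach:
  fixes p :: "'a::real_vector \<Rightarrow> real"
  assumes p: "sublinear p" and M: "subspace M"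
    and add: "\<And>x y. x \<in> M \<Longrightarrow> y \<in> M \<Longrightarrow> \<psi> (x + y) = \<psi> x + \<psi> y"
    and scale: "\<And>t x. x \<in> M \<Longrightarrow> \<psi> (t *\<^sub>R x) = t * \<psi> x"
    and dom: "\<And>m. m \<in> M \<Longrightarrow> \<psi> m \<le> p m"
  obtains \<Psi> where "linear \<Psi>" "\<And>x. \<Psi> x \<le> p x" "\<And>m. m \<in> M \<Longrightarrow> \<Psi> m = \<psi> m"
proof -
  have neg: "\<psi> (- m) = - \<psi> m" "- m \<in> M" if "m \<in> M" for m
    using scale[OF that, of "- 1"] subspace_neg[OF M that] by auto
  obtain r where r: "sublinear r" "\<And>x. r x \<le> p x" "\<And>m. m \<in> M \<Longrightarrow> r m \<le> \<psi> m"
  proof (rule sublinear_inf_convolution[OF p, of M \<psi>])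
    show "- \<psi> m \<le> p (- m)" if "m \<in> M" for m
      using dom[of "- m"] neg[OF that] by simp
  qed (use M add scale in \<open>auto intro: subspace_0 subspace_add subspace_scale\<close>)
  obtain q where q: "sublinear q" "\<And>x. q x \<le> r x"
    "\<And>s. sublinear s \<Longrightarrow> (\<And>x. s x \<le> q x) \<Longrightarrow> s = q"
    using minimal_sublinear_exists[OF r(1)] by blast
  have lin: "linear q" using minimal_sublinear_linear q by blast
  show thesis
  proof (rule that[OF lin])
    show "q x \<le> p x" for x using q(2) r(2) order_trans by blast
    fix m assume m: "m \<in> M"
    have "q m \<le> \<psi> m" using q(2)[of m] r(3)[OF m] by simp
    moreover have "q (- m) \<le> \<psi> (- m)" using q(2)[of "- m"] r(3)[OF neg(2)[OF m]] by simp
    ultimately show "q m = \<psi> m" using linear_neg[OF lin, of m] neg(1)[OF m] by simp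
  qed
qed

lemma sublinear_max_norm:
  assumes "0 \<le> C"
  shows "sublinear (\<lambda>z::'a::real_normed_vector \<times> 'b::real_normed_vector. C * max (norm (fst z)) (norm (snd z)))"
proof (rule sublinearI)
  fix x y :: "'a \<times> 'b"
  have "max (norm (fst (x + y))) (norm (snd (x + y)))
      \<le> max (norm (fst x)) (norm (snd x)) + max (norm (fst y)) (norm (snd y))"
    using norm_triangle_ineq[of "fst x" "fst y"] norm_triangle_ineq[of "snd x" "snd y"]
    by auto
  then show "C * max (norm (fst (x + y))) (norm (snd (x + y)))
      \<le> C * max (norm (fst x)) (norm (snd x)) + C * max (norm (fst y)) (norm (snd y))"
    using mult_left_mono[OF _ assms] by (metis distrib_left)
next
  fix t :: real and x :: "'a \<times> 'b" assume "0 < t"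
  then show "C * max (norm (fst (t *\<^sub>R x))) (norm (snd (t *\<^sub>R x)))
      \<le> t * (C * max (norm (fst x)) (norm (snd x)))"
    by (simp add: max_def mult.left_commute)
qed simp

text \<open>
  The dual of a sum of two spaces with the maximum norm is the sum of the duals with the sum of the
  norms: extend \<open>\<psi>\<close> to the whole product and restrict the extension to the two factors.
\<close>

lemma functional_on_sup_sum_splits:
  fixes \<psi> :: "'a::real_normed_vector \<times> 'b::real_normed_vector \<Rightarrow> real"
  assumes M: "subspace M"
    and add: "\<And>x y. x \<in> M \<Longrightarrow> y \<in> M \<Longrightarrow> \<psi> (x + y) = \<psi> x + \<psi> y"
    and scale: "\<And>t x. x \<in> M \<Longrightarrow> \<psi> (t *\<^sub>R x) = t * \<psi> x"
    and C: "0 \<le> C" and dom: "\<And>a b. (a, b) \<in> M \<Longrightarrow> \<bar>\<psi> (a, b)\<bar> \<le> C * max (norm a) (norm b)"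
  obtains \<psi>0 \<psi>1 C0 C1 where "linear \<psi>0" "linear \<psi>1" "0 \<le> C0" "0 \<le> C1" "C0 + C1 \<le> C"
    "\<And>a. \<bar>\<psi>0 a\<bar> \<le> C0 * norm a" "\<And>b. \<bar>\<psi>1 b\<bar> \<le> C1 * norm b"
    "\<And>a b. (a, b) \<in> M \<Longrightarrow> \<psi> (a, b) = \<psi>0 a + \<psi>1 b"
proof -
  define p where "p z = C * max (norm (fst z)) (norm (snd z))" for z :: "'a \<times> 'b"
  have p: "sublinear p"
    unfolding p_def by (rule sublinear_max_norm[OF C])
  obtain \<Psi> where \<Psi>: "linear \<Psi>" "\<And>x. \<Psi> x \<le> p x" "\<And>m. m \<in> M \<Longrightarrow> \<Psi> m = \<psi> m"
  proof (rule hahn_banach[OF p M, of \<psi>])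
    show "\<psi> m \<le> p m" if "m \<in> M" for m
      using dom[of "fst m" "snd m"] that by (simp add: p_def abs_le_iff)
  qed (auto intro: add scale)
  define \<psi>0 where "\<psi>0 a = \<Psi> (a, 0)" for a
  define \<psi>1 where "\<psi>1 b = \<Psi> (0, b)" for b
  have lin0: "linear \<psi>0"
    unfolding \<psi>0_def
    by (rule linear_compose[of "\<lambda>a. (a, 0)" \<Psi>, unfolded o_def]) (auto intro: linearI \<Psi>(1))
  have lin1: "linear \<psi>1"
    unfolding \<psi>1_def
    by (rule linear_compose[of "\<lambda>b. (0, b)" \<Psi>, unfolded o_def]) (auto intro: linearI \<Psi>(1))
  have sum: "\<Psi> (a, b) = \<psi>0 a + \<psi>1 b" for a b
    using linear_add[OF \<Psi>(1), of "(a, 0)" "(0, b)"] by (simp add: \<psi>0_def \<psi>1_def)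
  have 0: "\<psi>0 0 = 0" "\<psi>1 0 = 0" using lin0 lin1 by (auto intro: linear_0)
  have both: "\<psi>0 a + \<psi>1 b \<le> C * max (norm a) (norm b)" for a b
    using \<Psi>(2)[of "(a, b)"] by (simp add: p_def sum)
  have b0: "\<bar>\<psi>0 a\<bar> \<le> C * norm a" for a
    using both[of a 0] both[of "- a" 0] linear_neg[OF lin0, of a] by (simp add: 0)
  have b1: "\<bar>\<psi>1 b\<bar> \<le> C * norm b" for b
    using both[of 0 b] both[of 0 "- b"] linear_neg[OF lin1, of b] by (simp add: 0)
  have bl0: "bounded_linear \<psi>0"
    using lin0 b0 by (auto simp: bounded_linear_def bounded_linear_axioms_def mult.commute
        intro!: exI[of _ C])
  have bl1: "bounded_linear \<psi>1"
    using lin1 b1 by (auto simp: bounded_linear_def bounded_linear_axioms_def mult.commute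
        intro!: exI[of _ C])
  \<comment> \<open>Test \<open>\<Psi>\<close> on pairs of vectors of norm at most one, each with the sign that makes
    its own functional nonnegative.\<close>
  have unit: "\<bar>\<psi>0 a\<bar> + \<bar>\<psi>1 b\<bar> \<le> C" if "norm a \<le> 1" "norm b \<le> 1" for a b
  proof -
    have "\<bar>\<psi>0 a\<bar> = \<psi>0 (sgn (\<psi>0 a) *\<^sub>R a)" "\<bar>\<psi>1 b\<bar> = \<psi>1 (sgn (\<psi>1 b) *\<^sub>R b)"
      by (simp_all add: linear_scale[OF lin0] linear_scale[OF lin1] abs_sgn)
    then have "\<bar>\<psi>0 a\<bar> + \<bar>\<psi>1 b\<bar> \<le> C * max (norm (sgn (\<psi>0 a) *\<^sub>R a)) (norm (sgn (\<psi>1 b) *\<^sub>R b))"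
      using both by metis
    also have "\<dots> \<le> C * 1"
      using that C by (intro mult_left_mono) (auto simp: sgn_if)
    finally show ?thesis by simp
  qed
  have on: "onorm \<psi>0 + onorm \<psi>1 \<le> C"
  proof -
    have "onorm \<psi>1 \<le> C - \<bar>\<psi>0 a\<bar>" if a: "norm a \<le> 1" for a
    proof (rule onorm_bound)
      show "0 \<le> C - \<bar>\<psi>0 a\<bar>" using unit[OF a, of 0] by (simp add: 0)
      fix b
      show "norm (\<psi>1 b) \<le> (C - \<bar>\<psi>0 a\<bar>) * norm b"
      proof (cases "b = 0")
        case False
        have "\<bar>\<psi>1 (inverse (norm b) *\<^sub>R b)\<bar> \<le> C - \<bar>\<psi>0 a\<bar>"
          using unit[OF a, of "inverse (norm b) *\<^sub>R b"] False by simp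
        then show ?thesis
          using False by (simp add: linear_scale[OF lin1] abs_mult field_simps)
      qed (simp add: 0)
    qed
    then have le: "\<bar>\<psi>0 a\<bar> \<le> C - onorm \<psi>1" if "norm a \<le> 1" for a
      using that by fastforce
    have "onorm \<psi>0 \<le> C - onorm \<psi>1"
    proof (rule onorm_bound)
      show "0 \<le> C - onorm \<psi>1" using le[of 0] by (simp add: 0)
      fix a
      show "norm (\<psi>0 a) \<le> (C - onorm \<psi>1) * norm a"
      proof (cases "a = 0")
        case False
        have "\<bar>\<psi>0 (inverse (norm a) *\<^sub>R a)\<bar> \<le> C - onorm \<psi>1"
          using le[of "inverse (norm a) *\<^sub>R a"] False by simp
        then show ?thesis
          using False by (simp add: linear_scale[OF lin0] abs_mult field_simps)
      qed (simp add: 0)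
    qed
    then show ?thesis by simp
  qed
  show thesis
  proof (rule that[OF lin0 lin1 _ _ on])
    show "0 \<le> onorm \<psi>0" "0 \<le> onorm \<psi>1" using onorm_pos_le bl0 bl1 by auto
    show "\<bar>\<psi>0 a\<bar> \<le> onorm \<psi>0 * norm a" for a using onorm[OF bl0, of a] by simp
    show "\<bar>\<psi>1 b\<bar> \<le> onorm \<psi>1 * norm b" for b using onorm[OF bl1, of b] by simp
    show "\<psi> (a, b) = \<psi>0 a + \<psi>1 b" if "(a, b) \<in> M" for a b using \<Psi>(3)[OF that] sum by simp
  qed
qed

section \<open>Complex vector spaces with explicit carriers\<close>

text \<open>
  The carriers name no zero vector, so \<open>vscale X 0 y\<close> plays its role.
\<close>

locale cvector_space =
  fixes X :: "'a cspace"
  assumes nonempty: "vecs X \<noteq> {}"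
    and add_closed [simp]: "x \<in> vecs X \<Longrightarrow> y \<in> vecs X \<Longrightarrow> vadd X x y \<in> vecs X"
    and scale_closed [simp]: "x \<in> vecs X \<Longrightarrow> vscale X c x \<in> vecs X"
    and add_commute: "x \<in> vecs X \<Longrightarrow> y \<in> vecs X \<Longrightarrow> vadd X x y = vadd X y x"
    and add_assoc: "x \<in> vecs X \<Longrightarrow> y \<in> vecs X \<Longrightarrow> z \<in> vecs X \<Longrightarrow>
      vadd X (vadd X x y) z = vadd X x (vadd X y z)"
    and add_zero: "x \<in> vecs X \<Longrightarrow> y \<in> vecs X \<Longrightarrow> vadd X x (vscale X 0 y) = x"
    and scale_one: "x \<in> vecs X \<Longrightarrow> vscale X 1 x = x"
    and scale_scale: "x \<in> vecs X \<Longrightarrow> vscale X c (vscale X d x) = vscale X (c * d) x"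
    and scale_add_right: "x \<in> vecs X \<Longrightarrow> y \<in> vecs X \<Longrightarrow>
      vscale X c (vadd X x y) = vadd X (vscale X c x) (vscale X c y)"
    and scale_add_left: "x \<in> vecs X \<Longrightarrow>
      vscale X (c + d) x = vadd X (vscale X c x) (vscale X d x)"

definition linear_functional :: "'a cspace \<Rightarrow> ('a \<Rightarrow> complex) \<Rightarrow> bool" where
  "linear_functional X \<psi> \<longleftrightarrow>
    (\<forall>x\<in>vecs X. \<forall>y\<in>vecs X. \<psi> (vadd X x y) = \<psi> x + \<psi> y) \<and>
    (\<forall>c. \<forall>x\<in>vecs X. \<psi> (vscale X c x) = c * \<psi> x)"

lemma linear_functional_add:
    "linear_functional X \<psi> \<Longrightarrow> x \<in> vecs X \<Longrightarrow> y \<in> vecs X \<Longrightarrow> \<psi> (vadd X x y) = \<psi> x + \<psi> y"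
  and linear_functional_scale:
    "linear_functional X \<psi> \<Longrightarrow> x \<in> vecs X \<Longrightarrow> \<psi> (vscale X c x) = c * \<psi> x"
  by (auto simp: linear_functional_def)

lemma rep_mem: "a \<in> A \<Longrightarrow> rep A \<in> A"
  unfolding rep_def by (rule someI[of "\<lambda>a. a \<in> A"])

lemma in_dual_space_iff:
  "\<psi> \<in> vecs (dual_space X) \<longleftrightarrow> \<psi> \<in> extensional (vecs X) \<and> linear_functional X \<psi> \<and>
    (\<exists>C. \<forall>x\<in>vecs X. cmod (\<psi> x) \<le> C * vnorm X x)"
  by (auto simp: dual_space_def linear_functional_def)

context cvector_space
begin

lemma diff_closed [simp]: "x \<in> vecs X \<Longrightarrow> y \<in> vecs X \<Longrightarrow> vdiff X x y \<in> vecs X"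
  by (simp add: vdiff_def)

lemma scale_zero_eq: "x \<in> vecs X \<Longrightarrow> y \<in> vecs X \<Longrightarrow> vscale X 0 x = vscale X 0 y"
  by (metis add_commute add_zero scale_closed)

lemma zero_add: "x \<in> vecs X \<Longrightarrow> y \<in> vecs X \<Longrightarrow> vadd X (vscale X 0 y) x = x"
  by (simp add: add_commute add_zero)

lemma diff_self: "x \<in> vecs X \<Longrightarrow> vdiff X x x = vscale X 0 x"
  using scale_add_left[of x 1 "-1"] by (simp add: vdiff_def scale_one)

lemma add_left_commute:
  "x \<in> vecs X \<Longrightarrow> y \<in> vecs X \<Longrightarrow> z \<in> vecs X \<Longrightarrow> vadd X x (vadd X y z) = vadd X y (vadd X x z)"
  by (metis add_assoc add_commute)

lemmas add_ac = add_assoc add_commute add_left_commute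

lemma diff_swap: "x \<in> vecs X \<Longrightarrow> y \<in> vecs X \<Longrightarrow> vdiff X y x = vscale X (- 1) (vdiff X x y)"
  by (simp add: vdiff_def scale_add_right scale_scale scale_one add_commute)

lemma diff_add_diff:
  assumes "x \<in> vecs X" "y \<in> vecs X" "z \<in> vecs X"
  shows "vdiff X x z = vadd X (vdiff X x y) (vdiff X y z)"
proof -
  have "vadd X (vdiff X x y) (vdiff X y z) =
      vadd X x (vadd X (vdiff X y y) (vscale X (- 1) z))"
    using assms by (simp add: vdiff_def add_ac)
  also have "\<dots> = vdiff X x z"
    using assms by (simp add: diff_self zero_add) (simp add: vdiff_def)
  finally show ?thesis by simp
qed

lemma add_diff_cancel: "x \<in> vecs X \<Longrightarrow> y \<in> vecs X \<Longrightarrow> vadd X y (vdiff X x y) = x"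
  using diff_self[of y] by (simp add: vdiff_def add_left_commute add_zero)

lemma diff_add_add:
  assumes "x \<in> vecs X" "y \<in> vecs X" "x' \<in> vecs X" "y' \<in> vecs X"
  shows "vdiff X (vadd X x y) (vadd X x' y') = vadd X (vdiff X x x') (vdiff X y y')"
  using assms by (simp add: vdiff_def scale_add_right add_ac)

lemma diff_scale_scale:
  assumes "x \<in> vecs X" "y \<in> vecs X"
  shows "vdiff X (vscale X c x) (vscale X c y) = vscale X c (vdiff X x y)"
  using assms by (simp add: vdiff_def scale_add_right scale_scale)

lemma linear_functional_diff:
  "linear_functional X \<psi> \<Longrightarrow> x \<in> vecs X \<Longrightarrow> y \<in> vecs X \<Longrightarrow> \<psi> (vdiff X x y) = \<psi> x - \<psi> y"
  by (simp add: vdiff_def linear_functional_add linear_functional_scale)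

end

text \<open>
  The complex-linear functional whose real part is the given real-linear one.
\<close>

definition complexify :: "'a cspace \<Rightarrow> ('a \<Rightarrow> real) \<Rightarrow> 'a \<Rightarrow> complex" where
  "complexify X R x = Complex (R x) (- R (vscale X \<i> x))"

context cvector_space
begin

lemma linear_functional_complexify:
  assumes add: "\<And>x y. x \<in> vecs X \<Longrightarrow> y \<in> vecs X \<Longrightarrow> R (vadd X x y) = R x + R y"
    and scale: "\<And>t x. x \<in> vecs X \<Longrightarrow> R (vscale X (complex_of_real t) x) = t * R x"
  shows "linear_functional X (complexify X R)"
  unfolding linear_functional_def
proof (intro conjI ballI allI)
  fix x y assume "x \<in> vecs X" "y \<in> vecs X"
  then show "complexify X R (vadd X x y) = complexify X R x + complexify X R y"
    by (simp add: complexify_def add scale_add_right complex_eq_iff)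
next
  fix c x assume x: "x \<in> vecs X"
  have lin: "R (vscale X (complex_of_real a + complex_of_real b * \<i>) x)
      = a * R x + b * R (vscale X \<i> x)" for a b
    using x by (simp add: scale_add_left add scale scale_scale[symmetric])
  have "R (vscale X c x) = Re c * R x + Im c * R (vscale X \<i> x)"
    using lin[of "Re c" "Im c"] by (simp add: mult.commute complex_eq[symmetric])
  moreover have "vscale X \<i> (vscale X c x)
      = vscale X (complex_of_real (- Im c) + complex_of_real (Re c) * \<i>) x"
    using x by (auto simp: scale_scale complex_eq_iff intro!: arg_cong[where f = "\<lambda>c. vscale X c x"])
  then have "R (vscale X \<i> (vscale X c x)) = - Im c * R x + Re c * R (vscale X \<i> x)"
    by (simp only: lin)
  ultimately show "complexify X R (vscale X c x) = c * complexify X R x"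
    by (simp add: complexify_def complex_eq_iff algebra_simps)
qed

lemma cmod_complexify_le:
  assumes add: "\<And>x y. x \<in> vecs X \<Longrightarrow> y \<in> vecs X \<Longrightarrow> R (vadd X x y) = R x + R y"
    and scale: "\<And>t x. x \<in> vecs X \<Longrightarrow> R (vscale X (complex_of_real t) x) = t * R x"
    and bound: "\<And>x. x \<in> vecs X \<Longrightarrow> \<bar>R x\<bar> \<le> P x"
    and P: "\<And>c x. x \<in> vecs X \<Longrightarrow> P (vscale X c x) = cmod c * P x"
    and x: "x \<in> vecs X"
  shows "cmod (complexify X R x) \<le> P x"
proof -
  \<comment> \<open>Rotate \<open>x\<close> until the value is a nonnegative real, which is then a value of \<open>R\<close>.\<close>
  define z where "z = complexify X R x"
  obtain u where u: "cmod u = 1" "u * z = complex_of_real (cmod z)"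
  proof (cases "z = 0")
    case True
    then show ?thesis using that[of 1] by simp
  next
    case False
    then have "cnj z / cmod z * z = complex_of_real (cmod z)"
      using complex_norm_square[of z] by (simp add: field_simps power2_eq_square)
    moreover have "cmod (cnj z / cmod z) = 1" using False by (simp add: norm_divide)
    ultimately show ?thesis using that by blast
  qed
  have "complexify X R (vscale X u x) = u * z"
    using linear_functional_scale[OF linear_functional_complexify[OF add scale] x]
    by (simp add: z_def)
  then have "R (vscale X u x) = cmod z"
    using u(2) by (simp add: complexify_def complex_eq_iff)
  then show ?thesis
    using bound[of "vscale X u x"] P[OF x, of u] u(1) x by (simp add: z_def)
qed

end

locale cseminormed_space = cvector_space +
  assumes norm_triangle: "x \<in> vecs X \<Longrightarrow> y \<in> vecs X \<Longrightarrow> vnorm X (vadd X x y) \<le> vnorm X x + vnorm X y"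
    and norm_scale: "x \<in> vecs X \<Longrightarrow> vnorm X (vscale X c x) = cmod c * vnorm X x"
begin

lemma norm_nonneg: "x \<in> vecs X \<Longrightarrow> 0 \<le> vnorm X x"
  using norm_triangle[of x "vscale X (- 1) x"] norm_scale[of x "-1"] norm_scale[of x 0]
    diff_self[of x] by (simp add: vdiff_def)

lemma dist_self: "x \<in> vecs X \<Longrightarrow> vnorm X (vdiff X x x) = 0"
  by (simp add: diff_self norm_scale)

lemma dist_commute: "x \<in> vecs X \<Longrightarrow> y \<in> vecs X \<Longrightarrow> vnorm X (vdiff X y x) = vnorm X (vdiff X x y)"
  by (subst diff_swap) (simp_all add: norm_scale)

lemma dist_triangle: "x \<in> vecs X \<Longrightarrow> y \<in> vecs X \<Longrightarrow> z \<in> vecs X \<Longrightarrow>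
    vnorm X (vdiff X x z) \<le> vnorm X (vdiff X x y) + vnorm X (vdiff X y z)"
  by (simp add: diff_add_diff[of x y z] norm_triangle)

lemma dist_add_add: "x \<in> vecs X \<Longrightarrow> y \<in> vecs X \<Longrightarrow> x' \<in> vecs X \<Longrightarrow> y' \<in> vecs X \<Longrightarrow>
    vnorm X (vdiff X (vadd X x y) (vadd X x' y')) \<le> vnorm X (vdiff X x x') + vnorm X (vdiff X y y')"
  by (simp add: diff_add_add norm_triangle)

lemma dist_scale_scale: "x \<in> vecs X \<Longrightarrow> y \<in> vecs X \<Longrightarrow>
    vnorm X (vdiff X (vscale X c x) (vscale X c y)) = cmod c * vnorm X (vdiff X x y)"
  by (simp add: diff_scale_scale norm_scale)

lemma norm_diff_ineq: "x \<in> vecs X \<Longrightarrow> y \<in> vecs X \<Longrightarrow> \<bar>vnorm X x - vnorm X y\<bar> \<le> vnorm X (vdiff X x y)"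
  using norm_triangle[of y "vdiff X x y"] norm_triangle[of x "vdiff X y x"]
  by (simp add: add_diff_cancel dist_commute abs_le_iff)

text \<open>
  The norm of a functional is a supremum over the unit ball; scaling turns it into the least bound.
  The case \<open>vnorm X x = 0\<close> is not reached by scaling and uses boundedness itself.
\<close>

lemma dual_norm:
  assumes "\<psi> \<in> vecs (dual_space X)"
  shows dual_norm_bound: "x \<in> vecs X \<Longrightarrow> cmod (\<psi> x) \<le> vnorm (dual_space X) \<psi> * vnorm X x"
    and dual_norm_nonneg: "0 \<le> vnorm (dual_space X) \<psi>"
    and dual_norm_least: "0 \<le> C \<Longrightarrow> (\<And>x. x \<in> vecs X \<Longrightarrow> cmod (\<psi> x) \<le> C * vnorm X x) \<Longrightarrow>
      vnorm (dual_space X) \<psi> \<le> C"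
proof -
  let ?B = "{x \<in> vecs X. vnorm X x \<le> 1}"
  have lin: "linear_functional X \<psi>" using assms by (simp add: in_dual_space_iff)
  obtain K where K: "\<And>x. x \<in> vecs X \<Longrightarrow> cmod (\<psi> x) \<le> K * vnorm X x"
    using assms by (auto simp: in_dual_space_iff)
  have K': "cmod (\<psi> x) \<le> \<bar>K\<bar> * vnorm X x" if "x \<in> vecs X" for x
    using K[OF that] norm_nonneg[OF that] by (smt (verit) mult_right_mono)
  have N: "vnorm (dual_space X) \<psi> = (SUP x\<in>?B. cmod (\<psi> x))"
    by (simp add: dual_space_def)
  have bdd: "bdd_above ((\<lambda>x. cmod (\<psi> x)) ` ?B)"
  proof (rule bdd_aboveI2)
    fix x assume "x \<in> ?B"
    then show "cmod (\<psi> x) \<le> \<bar>K\<bar>"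
      using K'[of x] mult_left_mono[of "vnorm X x" 1 "\<bar>K\<bar>"] by simp
  qed
  obtain x0 where x0: "x0 \<in> vecs X" using nonempty by blast
  then have z: "vscale X 0 x0 \<in> ?B" by (simp add: norm_scale)
  have up: "cmod (\<psi> x) \<le> vnorm (dual_space X) \<psi>" if "x \<in> ?B" for x
    unfolding N by (rule cSUP_upper[OF that bdd])
  show "0 \<le> vnorm (dual_space X) \<psi>"
    using up[OF z] norm_ge_zero order_trans by blast
  show "cmod (\<psi> x) \<le> vnorm (dual_space X) \<psi> * vnorm X x" if x: "x \<in> vecs X"
  proof (cases "vnorm X x = 0")
    case True
    then show ?thesis using K'[OF x] by simp
  next
    case False
    then have pos: "0 < vnorm X x" using norm_nonneg[OF x] by simp
    have "cmod (\<psi> (vscale X (complex_of_real (inverse (vnorm X x))) x)) \<le> vnorm (dual_space X) \<psi>"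
      using x pos by (intro up) (simp add: norm_scale norm_inverse)
    then show ?thesis
      using pos
      by (simp add: linear_functional_scale[OF lin x] norm_mult norm_divide divide_inverse[symmetric]
          pos_divide_le_eq mult.commute)
  qed
  show "vnorm (dual_space X) \<psi> \<le> C" if "0 \<le> C" "\<And>x. x \<in> vecs X \<Longrightarrow> cmod (\<psi> x) \<le> C * vnorm X x"
    unfolding N
  proof (rule cSUP_least)
    show "?B \<noteq> {}" using z by blast
    fix x assume "x \<in> ?B"
    then show "cmod (\<psi> x) \<le> C"
      using that(2)[of x] mult_left_mono[of "vnorm X x" 1 C] that(1) by simp
  qed
qed

end

section \<open>Quotients\<close>

text \<open>
  Operations on a quotient are defined through chosen representatives. The lemmas below say that the
  choice does not matter, after which every identity of \<open>X\<close> passes to the quotient.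
\<close>

locale csubspace = cvector_space +
  fixes N
  assumes sub: "N \<subseteq> vecs X" and sub_nonempty: "N \<noteq> {}"
    and sub_add: "x \<in> N \<Longrightarrow> y \<in> N \<Longrightarrow> vadd X x y \<in> N"
    and sub_scale: "x \<in> N \<Longrightarrow> vscale X c x \<in> N"
begin

abbreviation coset where "coset x \<equiv> coset_rel X N `` {x}"

lemma sub_zero: "x \<in> vecs X \<Longrightarrow> vscale X 0 x \<in> N"
proof -
  assume x: "x \<in> vecs X"
  obtain n where "n \<in> N" using sub_nonempty by blast
  then show ?thesis using sub_scale[of n 0] scale_zero_eq[OF x, of n] sub by auto
qed

lemma equiv_coset_rel: "equiv (vecs X) (coset_rel X N)"
proof (rule equivI)
  show "coset_rel X N \<subseteq> vecs X \<times> vecs X"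
    by (auto simp: coset_rel_def)
  show "refl_on (vecs X) (coset_rel X N)"
    by (auto simp: refl_on_def coset_rel_def diff_self sub_zero)
  show "sym (coset_rel X N)"
    by (auto simp: sym_def coset_rel_def) (metis diff_swap sub_scale)
  show "trans (coset_rel X N)"
    by (auto simp: trans_def coset_rel_def) (metis diff_add_diff sub_add)
qed

lemma coset_eq_iff: "x \<in> vecs X \<Longrightarrow> y \<in> vecs X \<Longrightarrow> coset x = coset y \<longleftrightarrow> vdiff X x y \<in> N"
  using eq_equiv_class_iff[OF equiv_coset_rel, of x y] by (auto simp: coset_rel_def)

lemma vecs_quotient: "vecs (quotient_space X N) = coset ` vecs X"
  by (auto simp: quotient_space_def quotient_def)

lemma rep_coset:
  assumes x: "x \<in> vecs X"
  shows rep_coset_in: "rep (coset x) \<in> vecs X" and rep_coset_diff: "vdiff X (rep (coset x)) x \<in> N"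
proof -
  have "x \<in> coset x"
    using x by (simp add: coset_rel_def diff_self sub_zero)
  then have "rep (coset x) \<in> coset x"
    by (rule rep_mem)
  then have "(x, rep (coset x)) \<in> coset_rel X N" by simp
  then have "(rep (coset x), x) \<in> coset_rel X N"
    using equiv_coset_rel by (meson equivE symD)
  then show "rep (coset x) \<in> vecs X" "vdiff X (rep (coset x)) x \<in> N"
    by (auto simp: coset_rel_def)
qed

lemma quotient_add:
  assumes "x \<in> vecs X" "y \<in> vecs X"
  shows "vadd (quotient_space X N) (coset x) (coset y) = coset (vadd X x y)"
  using assms
  by (simp add: quotient_space_def coset_eq_iff rep_coset_in diff_add_add sub_add rep_coset_diff)

lemma quotient_scale:
  assumes "x \<in> vecs X"
  shows "vscale (quotient_space X N) c (coset x) = coset (vscale X c x)"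
  using assms
  by (simp add: quotient_space_def coset_eq_iff rep_coset_in diff_scale_scale sub_scale rep_coset_diff)

lemma cvector_space_quotient: "cvector_space (quotient_space X N)"
  using nonempty
  by unfold_locales
    (auto simp: vecs_quotient quotient_add quotient_scale add_assoc add_zero scale_one scale_scale
      scale_add_right scale_add_left simp del: Image_singleton_iff, simp_all add: add_commute)

end

locale null_subspace = cseminormed_space + csubspace +
  assumes null: "x \<in> N \<Longrightarrow> vnorm X x = 0"
begin

lemma quotient_norm: "x \<in> vecs X \<Longrightarrow> vnorm (quotient_space X N) (coset x) = vnorm X x"
  using norm_diff_ineq[of "rep (coset x)" x] null[OF rep_coset_diff[of x]] rep_coset_in[of x]
  by (simp add: quotient_space_def)

lemma cseminormed_space_quotient: "cseminormed_space (quotient_space X N)"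
  using cvector_space_quotient
  by (auto simp: cseminormed_space_def cseminormed_space_axioms_def vecs_quotient quotient_add
      quotient_scale quotient_norm norm_triangle norm_scale)

end

section \<open>Completions\<close>

context cseminormed_space
begin

abbreviation (input) Xc where "Xc \<equiv> completion X"

abbreviation limit_class where "limit_class x \<equiv> cauchy_rel X `` {x}"

lemma cauchy_seqs_vecs: "x \<in> cauchy_seqs X \<Longrightarrow> x n \<in> vecs X"
  by (simp add: cauchy_seqs_def)

lemma cauchy_seqs_const [simp]: "x \<in> vecs X \<Longrightarrow> (\<lambda>_. x) \<in> cauchy_seqs X"
  by (auto simp: cauchy_seqs_def dist_self)

lemma cauchy_seqsD:
  assumes "x \<in> cauchy_seqs X" "0 < e"
  obtains M where "\<And>m n. M \<le> m \<Longrightarrow> M \<le> n \<Longrightarrow> vnorm X (vdiff X (x m) (x n)) < e"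
  using assms unfolding cauchy_seqs_def by blast

lemma cauchy_seqs_add [simp]:
  assumes "x \<in> cauchy_seqs X" "y \<in> cauchy_seqs X"
  shows "(\<lambda>n. vadd X (x n) (y n)) \<in> cauchy_seqs X"
proof -
  note [simp] = assms[THEN cauchy_seqs_vecs]
  have "\<exists>M. \<forall>m\<ge>M. \<forall>n\<ge>M. vnorm X (vdiff X (vadd X (x m) (y m)) (vadd X (x n) (y n))) < e"
    if "0 < e" for e
  proof -
    obtain M1 where M1: "\<And>m n. M1 \<le> m \<Longrightarrow> M1 \<le> n \<Longrightarrow> vnorm X (vdiff X (x m) (x n)) < e / 2"
      using cauchy_seqsD[OF assms(1), of "e / 2"] \<open>0 < e\<close> by auto
    obtain M2 where M2: "\<And>m n. M2 \<le> m \<Longrightarrow> M2 \<le> n \<Longrightarrow> vnorm X (vdiff X (y m) (y n)) < e / 2"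
      using cauchy_seqsD[OF assms(2), of "e / 2"] \<open>0 < e\<close> by auto
    show ?thesis
    proof (intro exI[of _ "max M1 M2"] allI impI)
      fix m n assume "max M1 M2 \<le> m" "max M1 M2 \<le> n"
      then show "vnorm X (vdiff X (vadd X (x m) (y m)) (vadd X (x n) (y n))) < e"
        using dist_add_add[of "x m" "y m" "x n" "y n"] M1[of m n] M2[of m n] assms by simp
    qed
  qed
  then show ?thesis using assms by (simp add: cauchy_seqs_def)
qed

lemma cauchy_seqs_scale [simp]:
  assumes "x \<in> cauchy_seqs X"
  shows "(\<lambda>n. vscale X c (x n)) \<in> cauchy_seqs X"
proof -
  note [simp] = assms[THEN cauchy_seqs_vecs]
  have "\<exists>M. \<forall>m\<ge>M. \<forall>n\<ge>M. vnorm X (vdiff X (vscale X c (x m)) (vscale X c (x n))) < e"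
    if e: "0 < e" for e
  proof -
    have pos: "0 < cmod c + 1" by (simp add: add_nonneg_pos)
    obtain M where M: "\<And>m n. M \<le> m \<Longrightarrow> M \<le> n \<Longrightarrow> vnorm X (vdiff X (x m) (x n)) < e / (cmod c + 1)"
      using cauchy_seqsD[OF assms, of "e / (cmod c + 1)"] e pos by (metis divide_pos_pos)
    show ?thesis
    proof (intro exI[of _ M] allI impI)
      fix m n assume "M \<le> m" "M \<le> n"
      then have "vnorm X (vdiff X (x m) (x n)) * (cmod c + 1) < e"
        using M pos by (simp add: pos_less_divide_eq)
      moreover have "0 \<le> vnorm X (vdiff X (x m) (x n))"
        using assms by (simp add: norm_nonneg)
      ultimately show "vnorm X (vdiff X (vscale X c (x m)) (vscale X c (x n))) < e"
        using assms by (simp add: dist_scale_scale algebra_simps)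
    qed
  qed
  then show ?thesis using assms by (simp add: cauchy_seqs_def)
qed

lemma equiv_cauchy_rel: "equiv (cauchy_seqs X) (cauchy_rel X)"
proof (rule equivI)
  show "cauchy_rel X \<subseteq> cauchy_seqs X \<times> cauchy_seqs X"
    by (auto simp: cauchy_rel_def)
  show "refl_on (cauchy_seqs X) (cauchy_rel X)"
    by (auto simp: refl_on_def cauchy_rel_def dist_self cauchy_seqs_def)
  show "sym (cauchy_rel X)"
    by (auto simp: sym_def cauchy_rel_def cauchy_seqs_def dist_commute)
  show "trans (cauchy_rel X)"
  proof (rule transI)
    fix x y z assume xy: "(x, y) \<in> cauchy_rel X" and yz: "(y, z) \<in> cauchy_rel X"
    then have c: "x \<in> cauchy_seqs X" "y \<in> cauchy_seqs X" "z \<in> cauchy_seqs X"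
      by (auto simp: cauchy_rel_def)
    note [simp] = c[THEN cauchy_seqs_vecs]
    have "(\<lambda>n. vnorm X (vdiff X (x n) (y n)) + vnorm X (vdiff X (y n) (z n))) \<longlonglongrightarrow> 0"
      using xy yz by (intro tendsto_add_zero) (auto simp: cauchy_rel_def)
    then have "(\<lambda>n. vnorm X (vdiff X (x n) (z n))) \<longlonglongrightarrow> 0"
      by (rule Lim_null_comparison[OF always_eventually, rotated])
        (simp add: norm_nonneg dist_triangle)
    then show "(x, z) \<in> cauchy_rel X" using c by (simp add: cauchy_rel_def)
  qed
qed

lemma limit_class_eq_iff:
  "x \<in> cauchy_seqs X \<Longrightarrow> y \<in> cauchy_seqs X \<Longrightarrow>
    limit_class x = limit_class y \<longleftrightarrow> (\<lambda>n. vnorm X (vdiff X (x n) (y n))) \<longlonglongrightarrow> 0"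
  using eq_equiv_class_iff[OF equiv_cauchy_rel, of x y] by (auto simp: cauchy_rel_def)

lemma vecs_completion: "vecs Xc = limit_class ` cauchy_seqs X"
  by (auto simp: completion_def quotient_def)

lemma rep_limit_class:
  assumes "x \<in> cauchy_seqs X"
  shows rep_limit_class_in: "rep (limit_class x) \<in> cauchy_seqs X"
    and rep_limit_class_lim: "(\<lambda>n. vnorm X (vdiff X (rep (limit_class x) n) (x n))) \<longlonglongrightarrow> 0"
proof -
  have "x \<in> limit_class x"
    using equiv_class_self[OF equiv_cauchy_rel assms] .
  then have "rep (limit_class x) \<in> limit_class x"
    by (rule rep_mem)
  then have "(x, rep (limit_class x)) \<in> cauchy_rel X" by simp
  then have "(rep (limit_class x), x) \<in> cauchy_rel X"
    using equiv_cauchy_rel by (meson equivE symD)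
  then show "rep (limit_class x) \<in> cauchy_seqs X"
    "(\<lambda>n. vnorm X (vdiff X (rep (limit_class x) n) (x n))) \<longlonglongrightarrow> 0"
    by (auto simp: cauchy_rel_def)
qed

text \<open>
  As for quotients, the operations act on chosen representing sequences and do not depend on the choice.
\<close>

lemma completion_add:
  assumes "x \<in> cauchy_seqs X" "y \<in> cauchy_seqs X"
  shows "vadd Xc (limit_class x) (limit_class y) = limit_class (\<lambda>n. vadd X (x n) (y n))"
proof -
  let ?x = "rep (limit_class x)" and ?y = "rep (limit_class y)"
  note [simp] = assms[THEN cauchy_seqs_vecs] assms[THEN rep_limit_class_in, THEN cauchy_seqs_vecs]
  have "(\<lambda>n. vnorm X (vdiff X (?x n) (x n)) + vnorm X (vdiff X (?y n) (y n))) \<longlonglongrightarrow> 0"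
    using assms by (intro tendsto_add_zero rep_limit_class_lim)
  then have "(\<lambda>n. vnorm X (vdiff X (vadd X (?x n) (?y n)) (vadd X (x n) (y n)))) \<longlonglongrightarrow> 0"
    by (rule Lim_null_comparison[OF always_eventually, rotated])
      (simp add: norm_nonneg dist_add_add)
  then show ?thesis
    using assms by (simp add: completion_def limit_class_eq_iff rep_limit_class_in)
qed

lemma completion_scale:
  assumes "x \<in> cauchy_seqs X"
  shows "vscale Xc c (limit_class x) = limit_class (\<lambda>n. vscale X c (x n))"
proof -
  let ?x = "rep (limit_class x)"
  note [simp] = assms[THEN cauchy_seqs_vecs] assms[THEN rep_limit_class_in, THEN cauchy_seqs_vecs]
  have "(\<lambda>n. cmod c * vnorm X (vdiff X (?x n) (x n))) \<longlonglongrightarrow> cmod c * 0"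
    using assms by (intro tendsto_intros rep_limit_class_lim)
  then show ?thesis
    using assms by (simp add: completion_def limit_class_eq_iff rep_limit_class_in dist_scale_scale)
qed

lemma completion_norm:
  assumes x: "x \<in> cauchy_seqs X"
  shows "(\<lambda>n. vnorm X (x n)) \<longlonglongrightarrow> vnorm Xc (limit_class x)"
proof -
  let ?x = "rep (limit_class x)"
  note [simp] = x[THEN cauchy_seqs_vecs] x[THEN rep_limit_class_in, THEN cauchy_seqs_vecs]
  have "Cauchy (\<lambda>n. vnorm X (x n))"
  proof (rule metric_CauchyI)
    fix e :: real assume "0 < e"
    then obtain M where M: "\<And>m n. M \<le> m \<Longrightarrow> M \<le> n \<Longrightarrow> vnorm X (vdiff X (x m) (x n)) < e"
      using cauchy_seqsD[OF x] by blast
    have "dist (vnorm X (x m)) (vnorm X (x n)) < e" if "M \<le> m" "M \<le> n" for m n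
      using norm_diff_ineq[of "x m" "x n"] M[OF that] x by (simp add: dist_real_def)
    then show "\<exists>M. \<forall>m\<ge>M. \<forall>n\<ge>M. dist (vnorm X (x m)) (vnorm X (x n)) < e" by blast
  qed
  then obtain L where L: "(\<lambda>n. vnorm X (x n)) \<longlonglongrightarrow> L"
    using Cauchy_convergent_iff convergent_def by blast
  have "(\<lambda>n. vnorm X (?x n) - vnorm X (x n)) \<longlonglongrightarrow> 0"
    by (rule Lim_null_comparison[OF always_eventually rep_limit_class_lim[OF x]])
      (simp add: norm_diff_ineq)
  from tendsto_add[OF this L] have "(\<lambda>n. vnorm X (?x n)) \<longlonglongrightarrow> L" by simp
  then have "lim (\<lambda>n. vnorm X (?x n)) = L" by (rule limI)
  then show ?thesis using L by (simp add: completion_def)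
qed

lemma cvector_space_completion: "cvector_space Xc"
proof -
  let ?C = Xc
  have ne: "vecs ?C \<noteq> {}"
    using nonempty cauchy_seqs_const unfolding vecs_completion by blast
  have ax: "vadd ?C A B \<in> vecs ?C" "vscale ?C c A \<in> vecs ?C" "vadd ?C A B = vadd ?C B A"
      "vadd ?C (vadd ?C A B) D = vadd ?C A (vadd ?C B D)" "vadd ?C A (vscale ?C 0 B) = A"
      "vscale ?C 1 A = A" "vscale ?C c (vscale ?C d A) = vscale ?C (c * d) A"
      "vscale ?C c (vadd ?C A B) = vadd ?C (vscale ?C c A) (vscale ?C c B)"
      "vscale ?C (c + d) A = vadd ?C (vscale ?C c A) (vscale ?C d A)"
    if ABD: "A \<in> vecs ?C" "B \<in> vecs ?C" "D \<in> vecs ?C" for A B D c d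
  proof -
    obtain x y z where xyz [simp]: "x \<in> cauchy_seqs X" "y \<in> cauchy_seqs X" "z \<in> cauchy_seqs X"
      and [simp]: "A = limit_class x" "B = limit_class y" "D = limit_class z"
      using ABD by (auto simp: vecs_completion)
    note [simp] = xyz[THEN cauchy_seqs_vecs]
    show "vadd ?C A B \<in> vecs ?C" "vscale ?C c A \<in> vecs ?C"
      by (simp_all add: completion_add completion_scale) (auto simp: vecs_completion)
    show "vadd ?C A B = vadd ?C B A" "vadd ?C (vadd ?C A B) D = vadd ?C A (vadd ?C B D)"
      "vadd ?C A (vscale ?C 0 B) = A" "vscale ?C 1 A = A"
      "vscale ?C c (vscale ?C d A) = vscale ?C (c * d) A"
      "vscale ?C c (vadd ?C A B) = vadd ?C (vscale ?C c A) (vscale ?C c B)"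
      "vscale ?C (c + d) A = vadd ?C (vscale ?C c A) (vscale ?C d A)"
      by (simp_all add: completion_add completion_scale add_ac add_zero scale_one
          scale_scale scale_add_right scale_add_left)
  qed
  show ?thesis
    by (rule cvector_space.intro) (rule ne | (rule ax; assumption))+
qed

lemma cseminormed_space_completion: "cseminormed_space Xc"
proof -
  interpret C: cvector_space Xc by (rule cvector_space_completion)
  show ?thesis
  proof
    fix A B assume "A \<in> vecs Xc" "B \<in> vecs Xc"
    then obtain x y where [simp]: "A = limit_class x" "B = limit_class y"
      and xy [simp]: "x \<in> cauchy_seqs X" "y \<in> cauchy_seqs X"
      by (auto simp: vecs_completion)
    note [simp] = xy[THEN cauchy_seqs_vecs]
    have "vnorm Xc (limit_class (\<lambda>n. vadd X (x n) (y n)))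
        \<le> vnorm Xc (limit_class x) + vnorm Xc (limit_class y)"
      by (rule LIMSEQ_le[OF completion_norm tendsto_add[OF completion_norm[OF xy(1)] completion_norm[OF xy(2)]]])
        (simp_all add: norm_triangle)
    then show "vnorm Xc (vadd Xc A B) \<le> vnorm Xc A + vnorm Xc B"
      by (simp add: completion_add)
    fix c
    show "vnorm Xc (vscale Xc c A) = cmod c * vnorm Xc A"
      using completion_norm[of "\<lambda>n. vscale X c (x n)"] tendsto_mult_left[OF completion_norm[of x], of "cmod c"]
      by (simp add: completion_scale norm_scale LIMSEQ_unique)
  qed
qed

lemma embed_in: "x \<in> vecs X \<Longrightarrow> completion_embed X x \<in> vecs Xc"
  by (auto simp: completion_embed_def vecs_completion)

lemma embed_add: "x \<in> vecs X \<Longrightarrow> y \<in> vecs X \<Longrightarrow>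
    completion_embed X (vadd X x y) = vadd Xc (completion_embed X x) (completion_embed X y)"
  by (simp add: completion_embed_def completion_add)

lemma embed_scale: "x \<in> vecs X \<Longrightarrow>
    completion_embed X (vscale X c x) = vscale Xc c (completion_embed X x)"
  by (simp add: completion_embed_def completion_scale)

lemma embed_norm: "x \<in> vecs X \<Longrightarrow> vnorm Xc (completion_embed X x) = vnorm X x"
  using LIMSEQ_unique[OF completion_norm[OF cauchy_seqs_const] tendsto_const] by (simp add: completion_embed_def)

text \<open>
  The image of \<open>X\<close> is dense, so bounded functionals on the completion and their norms are
  determined by it.
\<close>

lemma embed_tendsto:
  assumes x: "x \<in> cauchy_seqs X"
  shows "(\<lambda>n. vnorm Xc (vdiff Xc (limit_class x) (completion_embed X (x n)))) \<longlonglongrightarrow> 0"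
proof (rule metric_LIMSEQ_I)
  note [simp] = x[THEN cauchy_seqs_vecs]
  fix e :: real assume "0 < e"
  then obtain M where M: "\<And>m n. M \<le> m \<Longrightarrow> M \<le> n \<Longrightarrow> vnorm X (vdiff X (x m) (x n)) < e / 2"
    using cauchy_seqsD[OF x, of "e / 2"] by auto
  have "dist (vnorm Xc (vdiff Xc (limit_class x) (completion_embed X (x n)))) 0 < e"
    if n: "M \<le> n" for n
  proof -
    have "vdiff Xc (limit_class x) (completion_embed X (x n))
        = limit_class (\<lambda>m. vdiff X (x m) (x n))"
      using x by (simp add: vdiff_def completion_embed_def completion_scale completion_add)
    moreover have c: "(\<lambda>m. vdiff X (x m) (x n)) \<in> cauchy_seqs X"
      using x unfolding vdiff_def by simp
    moreover have "vnorm Xc (limit_class (\<lambda>m. vdiff X (x m) (x n))) \<le> e / 2"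
      by (rule LIMSEQ_le_const2[OF completion_norm[OF c]]) (use M n in \<open>force intro: less_imp_le\<close>)
    moreover have "0 \<le> vnorm Xc (limit_class (\<lambda>m. vdiff X (x m) (x n)))"
      by (rule LIMSEQ_le_const[OF completion_norm[OF c]]) (simp add: norm_nonneg)
    ultimately show ?thesis using \<open>0 < e\<close> by (simp add: dist_real_def)
  qed
  then show "\<exists>M. \<forall>n\<ge>M. dist (vnorm Xc (vdiff Xc (limit_class x)
      (completion_embed X (x n)))) 0 < e" by blast
qed

lemma completion_functional_tendsto:
  assumes \<Lambda>: "\<Lambda> \<in> vecs (dual_space Xc)" and x: "x \<in> cauchy_seqs X"
  shows "(\<lambda>n. \<Lambda> (completion_embed X (x n))) \<longlonglongrightarrow> \<Lambda> (limit_class x)"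
proof -
  interpret C: cseminormed_space Xc by (rule cseminormed_space_completion)
  have lin: "linear_functional Xc \<Lambda>" using \<Lambda> by (simp add: in_dual_space_iff)
  have mem: "limit_class x \<in> vecs Xc" using x by (auto simp: vecs_completion)
  note [simp] = x[THEN cauchy_seqs_vecs]
  let ?d = "\<lambda>n. vdiff Xc (limit_class x) (completion_embed X (x n))"
  have "(\<lambda>n. \<Lambda> (limit_class x) - \<Lambda> (completion_embed X (x n))) \<longlonglongrightarrow> 0"
  proof (rule Lim_null_comparison[OF always_eventually])
    show "\<forall>n. norm (\<Lambda> (limit_class x) - \<Lambda> (completion_embed X (x n)))
        \<le> vnorm (dual_space Xc) \<Lambda> * vnorm Xc (?d n)"
      using C.dual_norm_bound[OF \<Lambda>] x mem
      by (simp add: C.linear_functional_diff[OF lin, symmetric] embed_in)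
    show "(\<lambda>n. vnorm (dual_space Xc) \<Lambda> * vnorm Xc (?d n)) \<longlonglongrightarrow> 0"
      using tendsto_mult_left[OF embed_tendsto[OF x]] by simp
  qed
  from tendsto_diff[OF tendsto_const[of "\<Lambda> (limit_class x)"] this] show ?thesis by simp
qed

lemma completion_dual_eqI:
  assumes "\<Lambda> \<in> vecs (dual_space Xc)" "\<Lambda>' \<in> vecs (dual_space Xc)"
    and eq: "\<And>x. x \<in> vecs X \<Longrightarrow> \<Lambda> (completion_embed X x) = \<Lambda>' (completion_embed X x)"
  shows "\<Lambda> = \<Lambda>'"
proof (rule extensionalityI)
  show "\<Lambda> \<in> extensional (vecs Xc)" "\<Lambda>' \<in> extensional (vecs Xc)"
    using assms by (auto simp: in_dual_space_iff)
  fix A assume "A \<in> vecs Xc"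
  then obtain x where x: "x \<in> cauchy_seqs X" and A: "A = limit_class x"
    by (auto simp: vecs_completion)
  show "\<Lambda> A = \<Lambda>' A"
    using completion_functional_tendsto[OF assms(1) x] completion_functional_tendsto[OF assms(2) x]
    by (simp add: A eq x[THEN cauchy_seqs_vecs] LIMSEQ_unique)
qed

lemma completion_dual_norm_least:
  assumes \<Lambda>: "\<Lambda> \<in> vecs (dual_space Xc)" and C: "0 \<le> C"
    and bound: "\<And>x. x \<in> vecs X \<Longrightarrow> cmod (\<Lambda> (completion_embed X x)) \<le> C * vnorm X x"
  shows "vnorm (dual_space Xc) \<Lambda> \<le> C"
proof (rule cseminormed_space.dual_norm_least[OF cseminormed_space_completion \<Lambda> C])
  fix A assume "A \<in> vecs Xc"
  then obtain x where x: "x \<in> cauchy_seqs X" and A: "A = limit_class x"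
    by (auto simp: vecs_completion)
  show "cmod (\<Lambda> A) \<le> C * vnorm Xc A"
    unfolding A
    by (rule LIMSEQ_le[OF tendsto_norm[OF completion_functional_tendsto[OF \<Lambda> x]]
          tendsto_mult_left[OF completion_norm[OF x], of C]]) (use bound x[THEN cauchy_seqs_vecs] in auto)
qed

text \<open>
  A bounded functional maps Cauchy sequences to Cauchy sequences, and its values along a sequence
  converge to the value of the extension.
\<close>

lemma completion_dual_extend:
  assumes lin: "linear_functional X \<psi>"
    and bound: "\<And>x. x \<in> vecs X \<Longrightarrow> cmod (\<psi> x) \<le> C * vnorm X x"
  obtains \<Lambda> where "\<Lambda> \<in> vecs (dual_space Xc)"
    "\<And>x. x \<in> vecs X \<Longrightarrow> \<Lambda> (completion_embed X x) = \<psi> x"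
proof -
  interpret C: cvector_space Xc by (rule cvector_space_completion)
  have diff: "cmod (\<psi> x - \<psi> y) \<le> \<bar>C\<bar> * vnorm X (vdiff X x y)" if "x \<in> vecs X" "y \<in> vecs X" for x y
    using bound[of "vdiff X x y"] that norm_nonneg[of "vdiff X x y"]
    by (simp add: linear_functional_diff[OF lin])
      (smt (verit) mult_right_mono)
  define \<Lambda> where "\<Lambda> = (\<lambda>A\<in>vecs Xc. lim (\<lambda>n. \<psi> (rep A n)))"
  have lim: "(\<lambda>n. \<psi> (x n)) \<longlonglongrightarrow> \<Lambda> (limit_class x)" if x: "x \<in> cauchy_seqs X" for x
  proof -
    let ?x = "rep (limit_class x)"
    note [simp] = x[THEN cauchy_seqs_vecs] x[THEN rep_limit_class_in, THEN cauchy_seqs_vecs]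
    have "Cauchy (\<lambda>n. \<psi> (x n))"
    proof (rule metric_CauchyI)
      fix e :: real assume e: "0 < e"
      have pos: "0 < \<bar>C\<bar> + 1" by simp
      obtain M where M: "\<And>m n. M \<le> m \<Longrightarrow> M \<le> n \<Longrightarrow> vnorm X (vdiff X (x m) (x n)) < e / (\<bar>C\<bar> + 1)"
        using cauchy_seqsD[OF x, of "e / (\<bar>C\<bar> + 1)"] e pos by (metis divide_pos_pos)
      have "dist (\<psi> (x m)) (\<psi> (x n)) < e" if "M \<le> m" "M \<le> n" for m n
      proof -
        have "vnorm X (vdiff X (x m) (x n)) * (\<bar>C\<bar> + 1) < e"
          using M[OF that] pos by (simp add: pos_less_divide_eq)
        moreover have "0 \<le> vnorm X (vdiff X (x m) (x n))" using x by (simp add: norm_nonneg)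
        ultimately show ?thesis
          using diff[of "x m" "x n"] x by (simp add: dist_norm algebra_simps)
      qed
      then show "\<exists>M. \<forall>m\<ge>M. \<forall>n\<ge>M. dist (\<psi> (x m)) (\<psi> (x n)) < e" by blast
    qed
    then obtain L where L: "(\<lambda>n. \<psi> (x n)) \<longlonglongrightarrow> L"
      using Cauchy_convergent_iff convergent_def by blast
    have "(\<lambda>n. \<psi> (?x n) - \<psi> (x n)) \<longlonglongrightarrow> 0"
    proof (rule Lim_null_comparison[OF always_eventually])
      show "\<forall>n. norm (\<psi> (?x n) - \<psi> (x n)) \<le> \<bar>C\<bar> * vnorm X (vdiff X (?x n) (x n))"
        using diff x rep_limit_class_in[OF x] by simp
      show "(\<lambda>n. \<bar>C\<bar> * vnorm X (vdiff X (?x n) (x n))) \<longlonglongrightarrow> 0"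
        using tendsto_mult_left[OF rep_limit_class_lim[OF x]] by simp
    qed
    from tendsto_add[OF this L] have "(\<lambda>n. \<psi> (?x n)) \<longlonglongrightarrow> L" by simp
    then have "lim (\<lambda>n. \<psi> (?x n)) = L" by (rule limI)
    then show ?thesis using L x by (simp add: \<Lambda>_def vecs_completion)
  qed
  show thesis
  proof (rule that)
    show emb: "\<Lambda> (completion_embed X x) = \<psi> x" if "x \<in> vecs X" for x
      using LIMSEQ_unique[OF lim[OF cauchy_seqs_const[OF that]] tendsto_const] by (simp add: completion_embed_def)
    have "linear_functional Xc \<Lambda>"
      unfolding linear_functional_def
    proof (intro conjI ballI allI)
      fix A B assume "A \<in> vecs Xc" "B \<in> vecs Xc"
      then obtain x y where [simp]: "A = limit_class x" "B = limit_class y"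
        and xy [simp]: "x \<in> cauchy_seqs X" "y \<in> cauchy_seqs X"
        by (auto simp: vecs_completion)
      note [simp] = xy[THEN cauchy_seqs_vecs]
      show "\<Lambda> (vadd Xc A B) = \<Lambda> A + \<Lambda> B"
        using lim[of "\<lambda>n. vadd X (x n) (y n)"] tendsto_add[OF lim[of x] lim[of y]]
        by (simp add: completion_add linear_functional_add[OF lin] LIMSEQ_unique)
    next
      fix c A assume "A \<in> vecs Xc"
      then obtain x where [simp]: "A = limit_class x" and x [simp]: "x \<in> cauchy_seqs X"
        by (auto simp: vecs_completion)
      note [simp] = x[THEN cauchy_seqs_vecs]
      show "\<Lambda> (vscale Xc c A) = c * \<Lambda> A"
        using lim[of "\<lambda>n. vscale X c (x n)"] tendsto_mult_left[OF lim[of x], of c]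
        by (simp add: completion_scale linear_functional_scale[OF lin] LIMSEQ_unique)
    qed
    moreover have "cmod (\<Lambda> A) \<le> C * vnorm Xc A" if A_in: "A \<in> vecs Xc" for A
    proof -
      obtain x where x: "x \<in> cauchy_seqs X" and A: "A = limit_class x"
        using A_in by (auto simp: vecs_completion)
      show ?thesis
        unfolding A
        by (rule LIMSEQ_le[OF tendsto_norm[OF lim[OF x]]
              tendsto_mult_left[OF completion_norm[OF x], of C]]) (use bound x[THEN cauchy_seqs_vecs] in auto)
    qed
    moreover have "\<Lambda> \<in> extensional (vecs Xc)" by (simp add: \<Lambda>_def)
    ultimately show "\<Lambda> \<in> vecs (dual_space Xc)"
      by (auto simp: in_dual_space_iff)
  qed
qed

end

section \<open>Norming functionals and reflexivity\<close>

definition type_cspace :: "'a::complex_normed_vector cspace" where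
  "type_cspace = \<lparr>vecs = UNIV, vadd = (+), vscale = scaleC, vnorm = norm\<rparr>"

lemma scaleC_one: "1 *\<^sub>C x = (x::'a::complex_normed_vector)"
  using scaleR_scaleC[of 1 x] by simp

lemma scaleC_zero_left: "0 *\<^sub>C x = (0::'a::complex_normed_vector)"
  using scaleR_scaleC[of 0 x] by simp

lemma cvector_space_type: "cvector_space (type_cspace :: 'a::complex_normed_vector cspace)"
  by unfold_locales
    (auto simp: type_cspace_def scaleC_one scaleC_zero_left scaleC_scaleC scaleC_add_right
      scaleC_add_left)

lemma cdual_apply_linear:
  shows cdual_apply_add_right: "cdual_apply \<eta> (x + y) = cdual_apply \<eta> x + cdual_apply \<eta> y"
    and cdual_apply_diff_right: "cdual_apply \<eta> (x - y) = cdual_apply \<eta> x - cdual_apply \<eta> y"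
  using bounded_linear_cdual_apply[of \<eta>]
  by (auto simp: linear_simps)

lemma cdual_apply_bound: "cmod (cdual_apply \<eta> x) \<le> norm \<eta> * norm x"
  unfolding norm_cdual_def by (rule onorm[OF bounded_linear_cdual_apply])

lemma Cdual_bounded:
  assumes "\<And>x y. f (x + y) = f x + f y" "\<And>c x. f (c *\<^sub>C x) = c * f x"
    and bound: "\<And>x. cmod (f x) \<le> K * norm x" and K: "0 \<le> K"
  shows "cdual_apply (Cdual f) = f" and "norm (Cdual f) \<le> K"
proof -
  have "bounded_linear f"
    using assms
    by (intro bounded_linear_intro[where K = K])
      (auto simp: scaleR_scaleC scaleR_conv_of_real mult.commute)
  then show eq: "cdual_apply (Cdual f) = f"
    using assms(2) by (intro cdual_apply_Cdual)
  show "norm (Cdual f) \<le> K"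
    unfolding norm_cdual_def eq by (rule onorm_bound[OF K bound])
qed

text \<open>
  A real-linear functional below the norm that peaks at \<open>\<xi>\<close> is turned into a complex-linear one,
  with the same bound and at least the same modulus at \<open>\<xi>\<close>.
\<close>

lemma norming_functional_exists:
  fixes \<xi> :: "'a::complex_normed_vector"
  obtains \<eta> where "norm \<eta> \<le> 1" "norm \<xi> \<le> cmod (cdual_apply \<eta> \<xi>)"
proof -
  have p: "sublinear (norm :: 'a \<Rightarrow> real)"
    by (simp add: sublinear_def norm_triangle_ineq)
  obtain q where q: "sublinear q" "\<And>x::'a. q x \<le> norm x" "q (- \<xi>) \<le> - norm \<xi>"
    using sublinear_peak[OF p] by blast
  obtain R where R: "linear R" "\<And>x. R x \<le> q x"
    by (rule hahn_banach[OF q(1), of "{0}" "\<lambda>_. 0"]) (auto simp: sublinear_0[OF q(1)])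
  have bound: "\<bar>R x\<bar> \<le> norm x" for x
    using R(2)[of x] R(2)[of "- x"] q(2)[of x] q(2)[of "- x"] linear_neg[OF R(1), of x] by simp
  have peak: "norm \<xi> \<le> R \<xi>"
    using R(2)[of "- \<xi>"] q(3) linear_neg[OF R(1), of \<xi>] by simp
  let ?X = "type_cspace :: 'a cspace" and ?f = "complexify (type_cspace :: 'a cspace) R"
  interpret cvector_space ?X by (rule cvector_space_type)
  have add: "R (vadd ?X x y) = R x + R y" for x y
    by (simp add: type_cspace_def linear_add[OF R(1)])
  have scale: "R (vscale ?X (complex_of_real t) x) = t * R x" for t x
    by (simp add: type_cspace_def scaleR_scaleC[symmetric] linear_scale[OF R(1)])
  have lin: "linear_functional ?X ?f"
    by (rule linear_functional_complexify[OF add scale])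
  have f_bound: "cmod (?f x) \<le> 1 * norm x" for x
    using cmod_complexify_le[of R norm x] add scale bound by (simp add: type_cspace_def norm_scaleC)
  have f_add: "?f (x + y) = ?f x + ?f y" and f_scale: "?f (c *\<^sub>C x) = c * ?f x" for x y c
    using lin by (auto simp: linear_functional_def type_cspace_def)
  note dual = Cdual_bounded[OF f_add f_scale f_bound]
  have "R \<xi> \<le> cmod (?f \<xi>)"
    using complex_Re_le_cmod[of "?f \<xi>"] by (simp add: complexify_def)
  with peak show thesis
    by (intro that[of "Cdual ?f"]) (simp_all add: dual)
qed

lemma cdual_separates:
  fixes x y :: "'a::complex_normed_vector"
  assumes "\<And>\<eta>. cdual_apply \<eta> x = cdual_apply \<eta> y"
  shows "x = y"
proof -
  obtain \<eta> where "norm (x - y) \<le> cmod (cdual_apply \<eta> (x - y))"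
    using norming_functional_exists by blast
  then show ?thesis using assms[of \<eta>] by (simp add: cdual_apply_diff_right)
qed

lemma norm_le_by_duality:
  fixes x :: "'a::complex_normed_vector"
  assumes "\<And>\<eta>. cmod (cdual_apply \<eta> x) \<le> norm \<eta> * K" and K: "0 \<le> K"
  shows "norm x \<le> K"
proof -
  obtain \<eta> where \<eta>: "norm \<eta> \<le> 1" "norm x \<le> cmod (cdual_apply \<eta> x)"
    using norming_functional_exists by blast
  have "norm \<eta> * K \<le> 1 * K" by (rule mult_right_mono[OF \<eta>(1) K])
  with \<eta>(2) assms(1)[of \<eta>] show ?thesis by simp
qed

definition evaluation :: "'a::complex_normed_vector \<Rightarrow> 'a cdual cdual" where
  "evaluation \<xi> = Cdual (\<lambda>\<eta>. cdual_apply \<eta> \<xi>)"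

lemma evaluation:
  shows cdual_apply_evaluation: "cdual_apply (evaluation \<xi>) \<eta> = cdual_apply \<eta> \<xi>"
    and norm_evaluation_le: "norm (evaluation \<xi>) \<le> norm \<xi>"
proof -
  have b: "cmod (cdual_apply \<eta> \<xi>) \<le> norm \<xi> * norm \<eta>" for \<eta>
    using cdual_apply_bound[of \<eta> \<xi>] by (simp add: mult.commute)
  note e = Cdual_bounded[of "\<lambda>\<eta>. cdual_apply \<eta> \<xi>" "norm \<xi>", OF _ _ b]
  show "cdual_apply (evaluation \<xi>) \<eta> = cdual_apply \<eta> \<xi>" "norm (evaluation \<xi>) \<le> norm \<xi>"
    unfolding evaluation_def by (simp_all add: e)
qed

text \<open>
  A functional \<open>\<Theta>\<close> on the bidual restricts, along evaluation, to a functional on the space itself. As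
  evaluation is onto, \<open>\<Theta>\<close> is evaluation at this restriction.
\<close>

lemma reflexive_space_cdual:
  assumes "reflexive_space TYPE('e::complex_normed_vector)"
  shows "reflexive_space TYPE('e cdual)"
  unfolding reflexive_space_def
proof
  fix \<Theta> :: "'e cdual cdual cdual"
  let ?f = "\<lambda>\<xi>. cdual_apply \<Theta> (evaluation \<xi>)"
  have add: "evaluation (x + y) = evaluation x + evaluation y" for x y :: 'e
    by (rule cdual_eqI) (simp add: cdual_apply_evaluation cdual_apply_add_right)
  have scale: "evaluation (c *\<^sub>C x) = c *\<^sub>C evaluation x" for c and x :: 'e
    by (rule cdual_eqI) (simp add: cdual_apply_evaluation cdual_apply_scaleC)
  have "cdual_apply (Cdual ?f) = ?f"
  proof (rule Cdual_bounded(1)[where K = "norm \<Theta>"])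
    show "cmod (?f x) \<le> norm \<Theta> * norm x" for x
      using cdual_apply_bound[of \<Theta> "evaluation x"] mult_left_mono[OF norm_evaluation_le, of "norm \<Theta>" x]
      by simp
  qed (simp_all add: add scale cdual_apply_add_right cdual_apply_scaleC)
  moreover have "\<exists>\<xi>. \<Psi> = evaluation \<xi>" for \<Psi> :: "'e cdual cdual"
    using assms unfolding reflexive_space_def by (metis cdual_apply_evaluation cdual_eqI)
  ultimately show "\<exists>\<eta>. \<forall>\<Psi>. cdual_apply \<Theta> \<Psi> = cdual_apply \<Psi> \<eta>"
    by (metis cdual_apply_evaluation)
qed

section \<open>Integrated forms on reflexive spaces\<close>

lemma norm_integral_le_AE:
  fixes f :: "'a \<Rightarrow> 'b::{banach, second_countable_topology}"
  assumes "integrable M f" "integrable M g" "AE x in M. norm (f x) \<le> g x"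
  shows "norm (\<integral>x. f x \<partial>M) \<le> (\<integral>x. g x \<partial>M)"
  by (rule order_trans[OF integral_norm_bound integral_mono_AE]) (use assms in auto)

text \<open>
  The setting common to \<open>\<pi>\<close> and \<open>\<pi>'\<close>: measurable coefficients, for the weak integrals, and
  reflexivity, to represent these integrals by vectors.
\<close>

locale weak_rep =
  fixes \<mu> :: "'g measure" and \<sigma> :: "'g \<Rightarrow> 'x::complex_normed_vector \<Rightarrow> 'x"
  assumes reflexive: "reflexive_space TYPE('x)"
    and \<sigma>_add: "\<sigma> s (x + y) = \<sigma> s x + \<sigma> s y"
    and \<sigma>_scale: "\<sigma> s (c *\<^sub>C x) = c *\<^sub>C \<sigma> s x"
    and \<sigma>_norm: "norm (\<sigma> s x) \<le> norm x"
    and \<sigma>_measurable [measurable]: "(\<lambda>s. cdual_apply \<eta> (\<sigma> s x)) \<in> borel_measurable \<mu>"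
begin

lemma coefficient_bound: "cmod (f s * cdual_apply \<eta> (\<sigma> s x)) \<le> (norm \<eta> * norm x) * cmod (f s)"
proof -
  have "cmod (cdual_apply \<eta> (\<sigma> s x)) \<le> norm \<eta> * norm x"
    using cdual_apply_bound[of \<eta> "\<sigma> s x"] mult_left_mono[OF \<sigma>_norm[of s x], of "norm \<eta>"] by simp
  then have "cmod (cdual_apply \<eta> (\<sigma> s x)) * cmod (f s) \<le> (norm \<eta> * norm x) * cmod (f s)"
    by (rule mult_right_mono) simp
  then show ?thesis by (simp add: norm_mult mult.commute)
qed

lemma integrable_coefficient:
  assumes [measurable]: "integrable \<mu> f"
  shows "integrable \<mu> (\<lambda>s. f s * cdual_apply \<eta> (\<sigma> s x))"
proof (rule Bochner_Integration.integrable_bound)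
  show "integrable \<mu> (\<lambda>s. (norm \<eta> * norm x) * cmod (f s))" using assms by simp
  show "(\<lambda>s. f s * cdual_apply \<eta> (\<sigma> s x)) \<in> borel_measurable \<mu>" by measurable
  show "AE s in \<mu>. norm (f s * cdual_apply \<eta> (\<sigma> s x)) \<le> norm ((norm \<eta> * norm x) * cmod (f s))"
    using coefficient_bound[of f _ \<eta> x] by (intro AE_I2) simp
qed

lemma coefficient_integral_bound:
  assumes "integrable \<mu> f"
  shows "cmod (\<integral>s. f s * cdual_apply \<eta> (\<sigma> s x) \<partial>\<mu>) \<le> (norm \<eta> * norm x) * (\<integral>s. cmod (f s) \<partial>\<mu>)"
proof -
  have "cmod (\<integral>s. f s * cdual_apply \<eta> (\<sigma> s x) \<partial>\<mu>) \<le> (\<integral>s. (norm \<eta> * norm x) * cmod (f s) \<partial>\<mu>)"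
    by (rule norm_integral_le_AE[OF integrable_coefficient[OF assms]])
      (use assms coefficient_bound in auto)
  then show ?thesis by simp
qed

text \<open>
  The right-hand side is a bounded functional of \<open>\<eta>\<close>, hence by reflexivity evaluation at some vector,
  and this vector is unique because functionals separate points.
\<close>

lemma integrated_form_apply:
  assumes f: "integrable \<mu> f"
  shows "cdual_apply \<eta> (integrated_form \<mu> \<sigma> f x) = (\<integral>s. f s * cdual_apply \<eta> (\<sigma> s x) \<partial>\<mu>)"
proof -
  let ?I = "\<lambda>\<eta>. \<integral>s. f s * cdual_apply \<eta> (\<sigma> s x) \<partial>\<mu>"
  have "cdual_apply (Cdual ?I) = ?I"
  proof (rule Cdual_bounded(1))
    show "cmod (?I \<eta>) \<le> (norm x * (\<integral>s. cmod (f s) \<partial>\<mu>)) * norm \<eta>" for \<eta>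
      using coefficient_integral_bound[OF f, of \<eta> x] by (simp add: mult_ac)
    show "?I (\<eta> + \<theta>) = ?I \<eta> + ?I \<theta>" for \<eta> \<theta>
      by (simp add: distrib_left integrable_coefficient[OF f])
    show "?I (c *\<^sub>C \<eta>) = c * ?I \<eta>" for c \<eta>
      by (simp add: mult.left_commute[of _ c])
  qed simp
  moreover obtain \<zeta> where "\<forall>\<eta>. cdual_apply (Cdual ?I) \<eta> = cdual_apply \<eta> \<zeta>"
    using reflexive unfolding reflexive_space_def by blast
  ultimately have \<zeta>: "\<forall>\<eta>. cdual_apply \<eta> \<zeta> = ?I \<eta>" by simp
  have "\<forall>\<eta>. cdual_apply \<eta> (integrated_form \<mu> \<sigma> f x) = ?I \<eta>"
    unfolding integrated_form_def
    by (rule theI[where a = \<zeta>]) (use \<zeta> in \<open>auto intro: cdual_separates\<close>)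
  then show ?thesis by blast
qed

lemma norm_integrated_form_le:
  assumes "integrable \<mu> f"
  shows "norm (integrated_form \<mu> \<sigma> f x) \<le> (\<integral>s. cmod (f s) \<partial>\<mu>) * norm x"
  using coefficient_integral_bound[OF assms, of _ x]
  by (intro norm_le_by_duality) (simp_all add: integrated_form_apply[OF assms] mult_ac)

lemma bounded_linear_integrated_form:
  assumes f: "integrable \<mu> f"
  shows "bounded_linear (integrated_form \<mu> \<sigma> f)"
proof (rule bounded_linear_intro)
  show "norm (integrated_form \<mu> \<sigma> f x) \<le> norm x * (\<integral>s. cmod (f s) \<partial>\<mu>)" for x
    using norm_integrated_form_le[OF f] by (simp add: mult.commute)
  show "integrated_form \<mu> \<sigma> f (x + y) = integrated_form \<mu> \<sigma> f x + integrated_form \<mu> \<sigma> f y" for x y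
    by (rule cdual_separates)
      (simp add: integrated_form_apply[OF f] cdual_apply_add_right \<sigma>_add distrib_left
        integrable_coefficient[OF f])
  show "integrated_form \<mu> \<sigma> f (r *\<^sub>R x) = r *\<^sub>R integrated_form \<mu> \<sigma> f x" for r x
    by (rule cdual_separates)
      (simp add: integrated_form_apply[OF f] scaleR_scaleC cdual_apply_scaleC \<sigma>_scale
        mult.left_commute[of _ "complex_of_real r"])
qed

lemma integrated_form_add:
  assumes "integrable \<mu> f" "integrable \<mu> g"
  shows "integrated_form \<mu> \<sigma> (\<lambda>s. f s + g s) x = integrated_form \<mu> \<sigma> f x + integrated_form \<mu> \<sigma> g x"
  by (rule cdual_separates)
    (simp add: integrated_form_apply assms cdual_apply_add_right distrib_right integrable_coefficient)

lemma integrated_form_scale: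
  assumes "integrable \<mu> f"
  shows "integrated_form \<mu> \<sigma> (\<lambda>s. c * f s) x = c *\<^sub>C integrated_form \<mu> \<sigma> f x"
  by (rule cdual_separates)
    (simp add: integrated_form_apply assms cdual_apply_scaleC mult.assoc)

lemma operator_norm_triangle:
  assumes "integrable \<mu> f" "integrable \<mu> g"
  shows "onorm (integrated_form \<mu> \<sigma> (\<lambda>s. f s + g s))
    \<le> onorm (integrated_form \<mu> \<sigma> f) + onorm (integrated_form \<mu> \<sigma> g)"
  unfolding integrated_form_add[OF assms]
  using assms by (intro onorm_triangle bounded_linear_integrated_form)

lemma operator_norm_scale:
  assumes "integrable \<mu> f"
  shows "onorm (integrated_form \<mu> \<sigma> (\<lambda>s. c * f s)) = cmod c * onorm (integrated_form \<mu> \<sigma> f)"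
proof -
  have "onorm (integrated_form \<mu> \<sigma> (\<lambda>s. c * f s)) = onorm (\<lambda>x. cmod c *\<^sub>R integrated_form \<mu> \<sigma> f x)"
    by (simp add: onorm_def integrated_form_scale[OF assms] norm_scaleC)
  then show ?thesis
    by (simp add: onorm_scaleR[OF bounded_linear_integrated_form[OF assms]])
qed

lemma operator_norm_le:
  assumes "integrable \<mu> f"
  shows "onorm (integrated_form \<mu> \<sigma> f) \<le> (\<integral>s. cmod (f s) \<partial>\<mu>)"
  using norm_integrated_form_le[OF assms] by (intro onorm_bound) auto

lemma operator_norm_eq_0_iff:
  assumes "integrable \<mu> f"
  shows "onorm (integrated_form \<mu> \<sigma> f) = 0 \<longleftrightarrow> integrated_form \<mu> \<sigma> f = (\<lambda>_. 0)"
  using onorm_eq_0[OF bounded_linear_integrated_form[OF assms]] by auto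

end

lemma weak_rep_isometric:
  fixes \<mu> :: "'g::{t2_space, topological_group_add} measure"
    and \<pi> :: "'g \<Rightarrow> 'e::complex_normed_vector \<Rightarrow> 'e"
  assumes "sets \<mu> = sets borel" "isometric_rep \<pi>" "reflexive_space TYPE('e)"
  shows "weak_rep \<mu> \<pi>"
proof
  fix \<eta> and x :: 'e
  have "continuous_on UNIV (\<lambda>s. \<pi> s x)" using assms(2) by (simp add: isometric_rep_def)
  then have "continuous_on UNIV (\<lambda>s. cdual_apply \<eta> (\<pi> s x))"
    by (rule bounded_linear.continuous_on[OF bounded_linear_cdual_apply])
  then show "(\<lambda>s. cdual_apply \<eta> (\<pi> s x)) \<in> borel_measurable \<mu>"
    using assms(1) by (simp add: borel_measurable_continuous_onI cong: measurable_cong_sets)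
qed (use assms in \<open>auto simp: isometric_rep_def\<close>)

text \<open>
  By reflexivity every functional on the dual is evaluation at some \<open>\<xi>\<close>, so the coefficients are
  \<open>s \<mapsto> \<eta> (\<pi> (- s) \<xi>)\<close>, which are continuous because \<open>\<pi>\<close> is strongly continuous.
\<close>

lemma weak_rep_dual:
  fixes \<mu> :: "'g::{t2_space, topological_group_add} measure"
    and \<pi> :: "'g \<Rightarrow> 'e::complex_normed_vector \<Rightarrow> 'e"
  assumes "sets \<mu> = sets borel" "isometric_rep \<pi>" "reflexive_space TYPE('e)"
  shows "weak_rep \<mu> (dual_rep \<pi>)"
proof -
  have \<pi>: "\<pi> s (x + y) = \<pi> s x + \<pi> s y" "\<pi> s (c *\<^sub>C x) = c *\<^sub>C \<pi> s x" "norm (\<pi> s x) = norm x"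
    for s x y c using assms(2) by (auto simp: isometric_rep_def)
  have bound: "cmod (cdual_apply \<eta> (\<pi> (- s) x)) \<le> norm \<eta> * norm x" for \<eta> s x
    using cdual_apply_bound[of \<eta> "\<pi> (- s) x"] by (simp add: \<pi>)
  note d = Cdual_bounded[of "\<lambda>x. cdual_apply \<eta> (\<pi> (- s) x)" "norm \<eta>" for \<eta> s, OF _ _ bound]
  have app: "cdual_apply (dual_rep \<pi> s \<eta>) x = cdual_apply \<eta> (\<pi> (- s) x)"
    and nrm: "norm (dual_rep \<pi> s \<eta>) \<le> norm \<eta>" for s \<eta> x
    unfolding dual_rep_def
    by (simp_all add: d \<pi> cdual_apply_add_right cdual_apply_scaleC)
  show ?thesis
  proof
    fix \<Psi> :: "'e cdual cdual" and \<eta> :: "'e cdual"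
    obtain \<xi> where \<xi>: "\<And>\<eta>. cdual_apply \<Psi> \<eta> = cdual_apply \<eta> \<xi>"
      using assms(3) unfolding reflexive_space_def by blast
    have "continuous_on UNIV (\<lambda>s. \<pi> s \<xi>)" using assms(2) by (simp add: isometric_rep_def)
    moreover have "continuous_on UNIV (\<lambda>s::'g. - s)"
      by (simp add: continuous_on_def tendsto_minus)
    ultimately have "continuous_on UNIV (\<lambda>s. \<pi> (- s) \<xi>)"
      using continuous_on_compose2[of UNIV "\<lambda>s. \<pi> s \<xi>" UNIV uminus] by simp
    then have "continuous_on UNIV (\<lambda>s. cdual_apply \<eta> (\<pi> (- s) \<xi>))"
      by (rule bounded_linear.continuous_on[OF bounded_linear_cdual_apply])
    then show "(\<lambda>s. cdual_apply \<Psi> (dual_rep \<pi> s \<eta>)) \<in> borel_measurable \<mu>"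
      using assms(1) by (simp add: \<xi> app borel_measurable_continuous_onI cong: measurable_cong_sets)
  next
    show "reflexive_space TYPE('e cdual)" by (rule reflexive_space_cdual[OF assms(3)])
    show "norm (dual_rep \<pi> s \<eta>) \<le> norm \<eta>" for s \<eta> by (rule nrm)
  qed (auto intro!: cdual_eqI simp: app)
qed

section \<open>Duality between integrable and locally bounded functions\<close>

lemma L1_simps [simp]:
  "f \<in> vecs (L1 \<mu>) \<longleftrightarrow> integrable \<mu> f"
  "vadd (L1 \<mu>) f g = (\<lambda>x. f x + g x)"
  "vscale (L1 \<mu>) c f = (\<lambda>x. c * f x)"
  "vnorm (L1 \<mu>) f = (\<integral>x. cmod (f x) \<partial>\<mu>)"
  by (simp_all add: L1_def)

lemma integrable_complex_indicator:
  assumes "A \<in> sets M" "emeasure M A < \<infinity>"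
  shows "integrable M (indicator A :: 'a \<Rightarrow> complex)"
proof -
  have "integrable M (\<lambda>x. complex_of_real (indicator A x))"
    using assms by (intro integrable_of_real integrable_real_indicator)
  moreover have "(\<lambda>x. complex_of_real (indicator A x)) = indicator A"
    by (auto simp: indicator_def fun_eq_iff)
  ultimately show ?thesis by simp
qed

lemma cvector_space_L1: "cvector_space (L1 \<mu>)"
proof
  show "vecs (L1 \<mu>) \<noteq> {}"
    using integrable_zero[of \<mu>] by (metis L1_simps(1) empty_iff)
qed (auto simp: algebra_simps)

lemma cseminormed_space_L1: "cseminormed_space (L1 \<mu>)"
proof -
  interpret cvector_space "L1 \<mu>" by (rule cvector_space_L1)
  show ?thesis
  proof
    fix f g assume fg: "f \<in> vecs (L1 \<mu>)" "g \<in> vecs (L1 \<mu>)"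
    then have "(\<integral>x. cmod (f x + g x) \<partial>\<mu>) \<le> (\<integral>x. cmod (f x) + cmod (g x) \<partial>\<mu>)"
      by (intro integral_mono) (auto intro: norm_triangle_ineq)
    with fg show "vnorm (L1 \<mu>) (vadd (L1 \<mu>) f g) \<le> vnorm (L1 \<mu>) f + vnorm (L1 \<mu>) g"
      by simp
  qed (simp add: norm_mult)
qed

text \<open>
  Dominated convergence is convergence in \<open>L\<^sup>1\<close>, so bounded functionals respect it.
\<close>

lemma L1_functional_tendsto:
  assumes \<Lambda>: "\<Lambda> \<in> vecs (dual_space (L1 \<mu>))"
    and f: "\<And>i. integrable \<mu> (s i)" "integrable \<mu> f" "integrable \<mu> w"
    and lim: "\<And>x. x \<in> space \<mu> \<Longrightarrow> (\<lambda>i. s i x) \<longlonglongrightarrow> f x"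
    and dom: "\<And>i x. x \<in> space \<mu> \<Longrightarrow> norm (s i x) \<le> w x"
  shows "(\<lambda>i. \<Lambda> (s i)) \<longlonglongrightarrow> \<Lambda> f"
proof -
  interpret cseminormed_space "L1 \<mu>" by (rule cseminormed_space_L1)
  have [measurable]: "f \<in> borel_measurable \<mu>" "s i \<in> borel_measurable \<mu>" for i
    using f by auto
  have lin: "linear_functional (L1 \<mu>) \<Lambda>" using \<Lambda> by (simp add: in_dual_space_iff)
  let ?K = "vnorm (dual_space (L1 \<mu>)) \<Lambda>"
  have bound: "norm (\<Lambda> (s i) - \<Lambda> f) \<le> ?K * (\<integral>x. cmod (s i x - f x) \<partial>\<mu>)" for i
    using dual_norm_bound[OF \<Lambda>, of "vdiff (L1 \<mu>) (s i) f"] f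
    by (simp add: linear_functional_diff[OF lin]) (simp add: vdiff_def)
  have "(\<lambda>i. \<integral>x. cmod (s i x - f x) \<partial>\<mu>) \<longlonglongrightarrow> (\<integral>x. 0 \<partial>\<mu>)"
  proof (rule integral_dominated_convergence)
    show "integrable \<mu> (\<lambda>x. w x + cmod (f x))" using f by simp
    show "AE x in \<mu>. (\<lambda>i. cmod (s i x - f x)) \<longlonglongrightarrow> 0"
      using lim by (intro AE_I2 tendsto_norm_zero) (simp add: LIM_zero)
    show "AE x in \<mu>. norm (cmod (s i x - f x)) \<le> w x + cmod (f x)" for i
    proof (rule AE_I2)
      fix x assume "x \<in> space \<mu>"
      from dom[OF this, of i] show "norm (cmod (s i x - f x)) \<le> w x + cmod (f x)"
        using norm_triangle_ineq4[of "s i x" "f x"] by simp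
    qed
  qed measurable
  from tendsto_mult_left[OF this, of ?K]
  have "(\<lambda>i. ?K * (\<integral>x. cmod (s i x - f x) \<partial>\<mu>)) \<longlonglongrightarrow> 0" by simp
  then have "(\<lambda>i. \<Lambda> (s i) - \<Lambda> f) \<longlonglongrightarrow> 0"
    by (rule Lim_null_comparison[OF always_eventually, rotated]) (use bound in blast)
  then show ?thesis by (simp add: LIM_zero_iff)
qed

lemma L1_functional_eqI:
  assumes \<Lambda>: "\<Lambda> \<in> vecs (dual_space (L1 \<mu>))" and \<Lambda>': "\<Lambda>' \<in> vecs (dual_space (L1 \<mu>))"
    and eq: "\<And>B. B \<in> sets \<mu> \<Longrightarrow> emeasure \<mu> B < \<infinity> \<Longrightarrow> \<Lambda> (indicator B) = \<Lambda>' (indicator B)"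
  shows "\<Lambda> = \<Lambda>'"
proof (rule extensionalityI)
  show "\<Lambda> \<in> extensional (vecs (L1 \<mu>))" "\<Lambda>' \<in> extensional (vecs (L1 \<mu>))"
    using assms by (auto simp: in_dual_space_iff)
  have lin: "linear_functional (L1 \<mu>) \<Lambda>" "linear_functional (L1 \<mu>) \<Lambda>'"
    using assms by (auto simp: in_dual_space_iff)
  fix f assume "f \<in> vecs (L1 \<mu>)"
  then have "integrable \<mu> f" by simp
  then show "\<Lambda> f = \<Lambda>' f"
  proof (induction rule: integrable_induct)
    case (base A c)
    then have int: "integrable \<mu> (indicator A :: _ \<Rightarrow> complex)"
      by (rule integrable_complex_indicator)
    have "(\<lambda>x. indicator A x *\<^sub>R c) = vscale (L1 \<mu>) c (indicator A)"
      by (auto simp: indicator_def)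
    then show ?case
      using eq[OF base] int linear_functional_scale[OF lin(1), of "indicator A" c]
        linear_functional_scale[OF lin(2), of "indicator A" c] by simp
  next
    case (add f g)
    then show ?case
      using linear_functional_add[OF lin(1), of f g] linear_functional_add[OF lin(2), of f g] by simp
  next
    case (lim f s)
    have "(\<lambda>i. M (s i)) \<longlonglongrightarrow> M f" if "M \<in> vecs (dual_space (L1 \<mu>))" for M
      by (rule L1_functional_tendsto[OF that, where w = "\<lambda>x. 2 * norm (f x)"])
        (use lim.hyps in auto)
    from this[OF \<Lambda>] this[OF \<Lambda>'] show ?case
      unfolding lim.IH by (rule LIMSEQ_unique)
  qed
qed

text \<open>
  Adding \<open>K\<close> times the measure makes the set function nonnegative, and domination makes it
  countably additive, so Radon--Nikodym applies. Subtracting \<open>K\<close> from the density undoes the shift.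
\<close>

lemma dominated_set_function_density:
  fixes \<rho> :: "'a set \<Rightarrow> real"
  assumes "finite_measure M"
    and add: "\<And>A B. A \<in> sets M \<Longrightarrow> B \<in> sets M \<Longrightarrow> A \<inter> B = {} \<Longrightarrow> \<rho> (A \<union> B) = \<rho> A + \<rho> B"
    and dom: "\<And>A. A \<in> sets M \<Longrightarrow> \<bar>\<rho> A\<bar> \<le> K * measure M A" and K: "0 \<le> K"
  obtains h where "h \<in> borel_measurable M" "\<And>x. \<bar>h x\<bar> \<le> K"
    "\<And>A. A \<in> sets M \<Longrightarrow> \<rho> A = (\<integral>x. indicator A x * h x \<partial>M)"
proof -
  interpret finite_measure M by fact
  define \<nu> where "\<nu> A = ennreal (\<rho> A + K * measure M A)" for A
  have nonneg: "0 \<le> \<rho> A + K * measure M A" if "A \<in> sets M" for A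
    using dom[OF that] by linarith
  have le: "\<nu> A \<le> ennreal (2 * K * measure M A)" if "A \<in> sets M" for A
    unfolding \<nu>_def using dom[OF that] by (intro ennreal_leI) linarith
  have empty: "\<rho> {} = 0" using dom[of "{}"] by simp
  have "countably_additive (sets M) \<nu>"
  proof (rule sets.empty_continuous_imp_countably_additive)
    show "positive (sets M) \<nu>" by (simp add: positive_def \<nu>_def empty)
    show "Measure_Space.additive (sets M) \<nu>"
      using nonneg by (auto simp: Measure_Space.additive_def \<nu>_def add finite_measure_Union algebra_simps
          ennreal_plus[symmetric] simp del: ennreal_plus)
    show "\<forall>A\<in>sets M. \<nu> A \<noteq> \<infinity>" by (simp add: \<nu>_def)
    fix A :: "nat \<Rightarrow> 'a set" assume A: "range A \<subseteq> sets M" "decseq A" "(\<Inter>i. A i) = {}"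
    have "(\<lambda>i. 2 * K * measure M (A i)) \<longlonglongrightarrow> 2 * K * measure M (\<Inter>i. A i)"
      by (intro tendsto_mult tendsto_const finite_Lim_measure_decseq A)
    then have "(\<lambda>i. ennreal (2 * K * measure M (A i))) \<longlonglongrightarrow> ennreal 0"
      using A(3) by (intro tendsto_ennrealI) simp
    then have lim: "(\<lambda>i. ennreal (2 * K * measure M (A i))) \<longlonglongrightarrow> 0" by simp
    show "(\<lambda>i. \<nu> (A i)) \<longlonglongrightarrow> 0"
      by (rule tendsto_sandwich[OF _ _ tendsto_const lim])
        (use le A(1) in \<open>auto intro!: always_eventually\<close>)
  qed
  then have meas: "measure_space (space M) (sets M) \<nu>"
    by (simp add: measure_space_def positive_def \<nu>_def empty sets.sigma_algebra_axioms)
  define N where "N = measure_of (space M) (sets M) \<nu>"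
  have sN: "sets N = sets M" by (simp add: N_def)
  have eN: "emeasure N A = \<nu> A" if "A \<in> sets M" for A
    unfolding N_def using meas that
    by (intro emeasure_measure_of_sigma) (auto simp: measure_space_def)
  have "absolutely_continuous M N"
    unfolding absolutely_continuous_def
  proof
    fix A assume "A \<in> null_sets M"
    then have A: "A \<in> sets M" "measure M A = 0" by (auto simp: null_sets_def measure_def)
    then have "\<nu> A = 0" using le[OF A(1)] by simp
    with A show "A \<in> null_sets N" by (simp add: null_sets_def eN sN)
  qed
  from Radon_Nikodym[OF this sN] obtain g where g [measurable]: "g \<in> borel_measurable M"
    and gN: "density M g = N" by blast
  have g_int: "(\<integral>\<^sup>+x\<in>A. g x \<partial>M) = \<nu> A" if "A \<in> sets M" for A
    using emeasure_density[OF g that] eN[OF that] by (simp add: gN)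
  \<comment> \<open>Where \<open>g\<close> exceeds \<open>2 * K\<close> the domination would fail, unless that set is null.\<close>
  have AE: "AE x in M. g x \<le> ennreal (2 * K)"
  proof -
    define B where "B = {x \<in> space M. ennreal (2 * K) < g x}"
    have B [measurable]: "B \<in> sets M" unfolding B_def by measurable
    have fin: "(\<integral>\<^sup>+x. ennreal (2 * K) * indicator B x \<partial>M) = ennreal (2 * K * measure M B)"
      using K by (simp add: nn_integral_cmult_indicator emeasure_eq_measure ennreal_mult)
    have "(\<integral>\<^sup>+x. (g x - ennreal (2 * K)) * indicator B x \<partial>M)
        = (\<integral>\<^sup>+x. g x * indicator B x - ennreal (2 * K) * indicator B x \<partial>M)"
      by (intro nn_integral_cong) (simp add: indicator_def)
    also have "\<dots> = (\<integral>\<^sup>+x. g x * indicator B x \<partial>M) - (\<integral>\<^sup>+x. ennreal (2 * K) * indicator B x \<partial>M)"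
    proof (rule nn_integral_diff)
      show "(\<integral>\<^sup>+x. ennreal (2 * K) * indicator B x \<partial>M) \<noteq> \<infinity>" unfolding fin by simp
      show "AE x in M. ennreal (2 * K) * indicator B x \<le> g x * indicator B x"
        by (intro AE_I2) (auto simp: indicator_def B_def less_imp_le)
    qed measurable
    also have "\<dots> = 0"
      unfolding fin g_int[OF B] by (rule diff_eq_0_ennreal[OF _ le[OF B]]) (simp add: \<nu>_def)
    finally have "AE x in M. (g x - ennreal (2 * K)) * indicator B x = 0"
      by (subst (asm) nn_integral_0_iff_AE) auto
    then show ?thesis
      using AE_space by eventually_elim (auto simp: B_def indicator_def diff_eq_0_iff_ennreal not_less split: if_splits)
  qed
  define h where "h x = min (enn2real (g x)) (2 * K) - K" for x
  have h_bound: "\<bar>h x\<bar> \<le> K" for x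
    using K by (auto simp: h_def abs_le_iff min_def)
  have h_meas [measurable]: "h \<in> borel_measurable M" unfolding h_def by measurable
  have h_AE: "AE x in M. g x = ennreal (h x + K)"
    using AE
  proof eventually_elim
    case (elim x)
    then have "g x < top" using ennreal_less_top le_less_trans by blast
    then have "ennreal (enn2real (g x)) = g x" by simp
    moreover from this elim K have "enn2real (g x) \<le> 2 * K" by (metis ennreal_le_iff mult_nonneg_nonneg zero_le_numeral)
    ultimately show ?case by (simp add: h_def min_def)
  qed
  have "\<rho> A = (\<integral>x. indicator A x * h x \<partial>M)" if A [measurable]: "A \<in> sets M" for A
  proof -
    have intI: "integrable M (\<lambda>x. indicator A x * h x)"
      by (rule integrable_const_bound[where B = K])
        (use h_bound K in \<open>auto simp: indicator_def\<close>)
    have "ennreal (\<rho> A + K * measure M A) = (\<integral>\<^sup>+x\<in>A. g x \<partial>M)"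
      using g_int[OF A] by (simp add: \<nu>_def)
    also have "\<dots> = (\<integral>\<^sup>+x. ennreal (indicator A x * h x + K * indicator A x) \<partial>M)"
      using h_AE by (intro nn_integral_cong_AE) (auto simp: indicator_def elim!: eventually_mono)
    also have "\<dots> = ennreal (\<integral>x. indicator A x * h x + K * indicator A x \<partial>M)"
    proof (rule nn_integral_eq_integral)
      show "integrable M (\<lambda>x. indicator A x * h x + K * indicator A x)"
        using intI by (simp add: integrable_indicator_iff emeasure_eq_measure)
      show "AE x in M. 0 \<le> indicator A x * h x + K * indicator A x"
      proof (rule AE_I2)
        fix x show "0 \<le> indicator A x * h x + K * indicator A x"
          using h_bound[of x] by (auto simp: indicator_def abs_le_iff)
      qed
    qed
    also have "(\<integral>x. indicator A x * h x + K * indicator A x \<partial>M)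
        = (\<integral>x. indicator A x * h x \<partial>M) + K * measure M A"
      using intI A by (simp add: integrable_indicator_iff emeasure_eq_measure)
    finally have e: "ennreal (\<rho> A + K * measure M A) = ennreal ((\<integral>x. indicator A x * h x \<partial>M) + K * measure M A)" .
    have "norm (\<integral>x. indicator A x * h x \<partial>M) \<le> (\<integral>x. K * indicator A x \<partial>M)"
    proof (rule norm_integral_le_AE[OF intI])
      show "integrable M (\<lambda>x. K * indicator A x)"
        by (simp add: integrable_indicator_iff emeasure_eq_measure)
      show "AE x in M. norm (indicator A x * h x) \<le> K * indicator A x"
        using h_bound by (intro AE_I2) (simp add: indicator_def)
    qed
    then have "0 \<le> (\<integral>x. indicator A x * h x \<partial>M) + K * measure M A"
      using A by (simp add: abs_le_iff)
    then show ?thesis using e nonneg[OF A] by simp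
  qed
  then show thesis using that[of h] h_meas h_bound by blast
qed

text \<open>
  The real and the imaginary part of \<open>B \<mapsto> \<Lambda> (indicator (D \<inter> B))\<close> are set functions dominated by a
  multiple of the measure restricted to \<open>D\<close>. This explains the factor 2 in the bound.
\<close>

lemma L1_functional_local_density:
  assumes \<Lambda>: "\<Lambda> \<in> vecs (dual_space (L1 \<mu>))"
    and D: "D \<in> sets \<mu>" "emeasure \<mu> D < \<infinity>"
  obtains h where "h \<in> borel_measurable \<mu>" "\<And>x. cmod (h x) \<le> 2 * vnorm (dual_space (L1 \<mu>)) \<Lambda>"
    "\<And>B. B \<in> sets \<mu> \<Longrightarrow> B \<subseteq> D \<Longrightarrow> \<Lambda> (indicator B) = (\<integral>x. indicator B x * h x \<partial>\<mu>)"
proof -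
  interpret cseminormed_space "L1 \<mu>" by (rule cseminormed_space_L1)
  let ?K = "vnorm (dual_space (L1 \<mu>)) \<Lambda>"
  have lin: "linear_functional (L1 \<mu>) \<Lambda>" using \<Lambda> by (simp add: in_dual_space_iff)
  have K: "0 \<le> ?K" by (rule dual_norm_nonneg[OF \<Lambda>])
  define M where "M = density \<mu> (indicator D)"
  have sM: "sets M = sets \<mu>" by (simp add: M_def)
  have eM: "emeasure M A = emeasure \<mu> (D \<inter> A)" if "A \<in> sets \<mu>" for A
    unfolding M_def using that D by (simp add: emeasure_restricted)
  have finM: "finite_measure M"
    using eM[of "space \<mu>"] D sets.sets_into_space[OF D(1)]
    by (intro finite_measureI) (auto simp: M_def Int_absorb2)
  have fin: "emeasure \<mu> (D \<inter> A) < \<infinity>" if "A \<in> sets \<mu>" for A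
    using D emeasure_mono[of "D \<inter> A" D \<mu>] by (auto simp: le_less_trans)
  have mM: "measure M A = measure \<mu> (D \<inter> A)" if "A \<in> sets \<mu>" for A
    using eM[OF that] by (simp add: measure_def)
  have int: "integrable \<mu> (indicator (D \<inter> A) :: _ \<Rightarrow> complex)" if "A \<in> sets \<mu>" for A
    using that D fin[OF that] by (intro integrable_complex_indicator) auto
  have bound: "cmod (\<Lambda> (indicator (D \<inter> A))) \<le> ?K * measure M A" if A: "A \<in> sets \<mu>" for A
  proof -
    have "(\<lambda>x. cmod (indicator (D \<inter> A) x)) = indicator (D \<inter> A)"
      by (auto simp: indicator_def fun_eq_iff)
    then have "(\<integral>x. cmod (indicator (D \<inter> A) x) \<partial>\<mu>) = measure \<mu> (D \<inter> A)"
      using D(1) A by simp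
    then show ?thesis
      using dual_norm_bound[OF \<Lambda>, of "indicator (D \<inter> A)"] int[OF A] mM[OF A] by simp
  qed
  have add: "\<Lambda> (indicator (D \<inter> (A \<union> B))) = \<Lambda> (indicator (D \<inter> A)) + \<Lambda> (indicator (D \<inter> B))"
    if "A \<in> sets \<mu>" "B \<in> sets \<mu>" "A \<inter> B = {}" for A B
  proof -
    have "(indicator (D \<inter> (A \<union> B)) :: _ \<Rightarrow> complex)
        = (\<lambda>x. indicator (D \<inter> A) x + indicator (D \<inter> B) x)"
      using that(3) by (auto simp: indicator_def fun_eq_iff)
    then show ?thesis
      using linear_functional_add[OF lin, of "indicator (D \<inter> A)" "indicator (D \<inter> B)"] int that by simp
  qed
  obtain a where a: "a \<in> borel_measurable M" "\<And>x. \<bar>a x\<bar> \<le> ?K"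
    "\<And>A. A \<in> sets M \<Longrightarrow> Re (\<Lambda> (indicator (D \<inter> A))) = (\<integral>x. indicator A x * a x \<partial>M)"
  proof (rule dominated_set_function_density[OF finM, of "\<lambda>A. Re (\<Lambda> (indicator (D \<inter> A)))" ?K])
    show "\<bar>Re (\<Lambda> (indicator (D \<inter> A)))\<bar> \<le> ?K * measure M A" if "A \<in> sets M" for A
      using bound[of A] that abs_Re_le_cmod order_trans unfolding sM by blast
  qed (auto simp: sM add K)
  obtain b where b: "b \<in> borel_measurable M" "\<And>x. \<bar>b x\<bar> \<le> ?K"
    "\<And>A. A \<in> sets M \<Longrightarrow> Im (\<Lambda> (indicator (D \<inter> A))) = (\<integral>x. indicator A x * b x \<partial>M)"
  proof (rule dominated_set_function_density[OF finM, of "\<lambda>A. Im (\<Lambda> (indicator (D \<inter> A)))" ?K])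
    show "\<bar>Im (\<Lambda> (indicator (D \<inter> A)))\<bar> \<le> ?K * measure M A" if "A \<in> sets M" for A
      using bound[of A] that abs_Im_le_cmod order_trans unfolding sM by blast
  qed (auto simp: sM add K)
  have [measurable]: "a \<in> borel_measurable \<mu>" "b \<in> borel_measurable \<mu>"
    using a(1) b(1) by (simp_all add: M_def)
  define h where "h x = complex_of_real (a x) + \<i> * complex_of_real (b x)" for x
  show thesis
  proof (rule that)
    show h_meas [measurable]: "h \<in> borel_measurable \<mu>" unfolding h_def by measurable
    show h_bound: "cmod (h x) \<le> 2 * ?K" for x
      using norm_triangle_ineq[of "complex_of_real (a x)" "\<i> * complex_of_real (b x)"] a(2)[of x] b(2)[of x]
      by (simp add: h_def norm_mult)
    fix B assume B [measurable]: "B \<in> sets \<mu>" and BD: "B \<subseteq> D"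
    have restr: "(\<integral>x. indicator B x * c x \<partial>M) = (\<integral>x. indicator B x * c x \<partial>\<mu>)"
      if [measurable]: "c \<in> borel_measurable \<mu>" for c :: "_ \<Rightarrow> real"
    proof -
      have "(\<integral>x. indicator B x * c x \<partial>M) = (\<integral>x. indicator D x *\<^sub>R (indicator B x * c x) \<partial>\<mu>)"
        unfolding M_def using D(1) by (subst integral_density[symmetric]) (auto simp: ennreal_indicator)
      also have "\<dots> = (\<integral>x. indicator B x * c x \<partial>\<mu>)"
        using BD by (intro Bochner_Integration.integral_cong) (auto simp: indicator_def)
      finally show ?thesis .
    qed
    have DB: "D \<inter> B = B" using BD by blast
    have i: "integrable \<mu> (\<lambda>x. indicator B x * h x)"
    proof (rule Bochner_Integration.integrable_bound)
      show "integrable \<mu> (\<lambda>x. 2 * ?K * indicator B x)"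
        using fin[OF B] by (simp add: DB integrable_indicator_iff)
      show "AE x in \<mu>. norm (indicator B x * h x) \<le> norm (2 * ?K * indicator B x)"
        using h_bound K by (intro AE_I2) (simp add: indicator_def)
    qed measurable
    have "Re (\<Lambda> (indicator B)) = (\<integral>x. indicator B x * a x \<partial>\<mu>)"
      using a(3)[of B] B by (simp add: sM DB restr)
    moreover have "Im (\<Lambda> (indicator B)) = (\<integral>x. indicator B x * b x \<partial>\<mu>)"
      using b(3)[of B] B by (simp add: sM DB restr)
    moreover have "Re (\<integral>x. indicator B x * h x \<partial>\<mu>) = (\<integral>x. indicator B x * a x \<partial>\<mu>)"
      unfolding integral_Re[OF i, symmetric]
      by (intro Bochner_Integration.integral_cong) (simp_all add: h_def indicator_def)
    moreover have "Im (\<integral>x. indicator B x * h x \<partial>\<mu>) = (\<integral>x. indicator B x * b x \<partial>\<mu>)"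
      unfolding integral_Im[OF i, symmetric]
      by (intro Bochner_Integration.integral_cong) (simp_all add: h_def indicator_def)
    ultimately show "\<Lambda> (indicator B) = (\<integral>x. indicator B x * h x \<partial>\<mu>)"
      by (simp add: complex_eq_iff)
  qed
qed

lemma Linf_functions_simps:
  "\<phi> \<in> vecs (Linf_functions \<mu>) \<longleftrightarrow>
    locally_measurable \<mu> \<phi> \<and> (\<exists>C. locally_AE \<mu> (\<lambda>x. cmod (\<phi> x) \<le> C))"
  "vadd (Linf_functions \<mu>) \<phi> \<psi> = (\<lambda>x. \<phi> x + \<psi> x)"
  "vscale (Linf_functions \<mu>) c \<phi> = (\<lambda>x. c * \<phi> x)"
  by (simp_all add: Linf_functions_def)

lemma locally_AE_mono:
  "locally_AE \<mu> P \<Longrightarrow> (\<And>x. P x \<Longrightarrow> Q x) \<Longrightarrow> locally_AE \<mu> Q"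
  unfolding locally_AE_def by (fast elim: eventually_mono)

lemma locally_AE_conj:
  "locally_AE \<mu> P \<Longrightarrow> locally_AE \<mu> Q \<Longrightarrow> locally_AE \<mu> (\<lambda>x. P x \<and> Q x)"
  unfolding locally_AE_def by (fast elim: eventually_elim2)

lemma cvector_space_Linf_functions: "cvector_space (Linf_functions \<mu>)"
proof
  have "(\<lambda>_. 0) \<in> vecs (Linf_functions \<mu>)"
    by (auto simp: Linf_functions_simps locally_measurable_def locally_AE_def intro!: exI[of _ 0])
  then show "vecs (Linf_functions \<mu>) \<noteq> {}" by blast
  fix \<phi> assume \<phi>: "\<phi> \<in> vecs (Linf_functions \<mu>)"
  then obtain C where C: "locally_AE \<mu> (\<lambda>x. cmod (\<phi> x) \<le> C)" by (auto simp: Linf_functions_simps)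
  have \<phi>m: "locally_measurable \<mu> \<phi>" using \<phi> by (simp add: Linf_functions_simps)
  show "vscale (Linf_functions \<mu>) c \<phi> \<in> vecs (Linf_functions \<mu>)" for c
    unfolding Linf_functions_simps
  proof
    show "locally_measurable \<mu> (\<lambda>x. c * \<phi> x)"
      using \<phi>m unfolding locally_measurable_def
      by (intro ballI impI borel_measurable_times borel_measurable_const) blast
    have "locally_AE \<mu> (\<lambda>x. cmod (c * \<phi> x) \<le> cmod c * C)"
      by (rule locally_AE_mono[OF C]) (simp add: norm_mult mult_left_mono)
    then show "\<exists>C. locally_AE \<mu> (\<lambda>x. cmod (c * \<phi> x) \<le> C)" by blast
  qed
  fix \<psi> assume \<psi>: "\<psi> \<in> vecs (Linf_functions \<mu>)"
  then obtain C' where C': "locally_AE \<mu> (\<lambda>x. cmod (\<psi> x) \<le> C')" by (auto simp: Linf_functions_simps)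
  show "vadd (Linf_functions \<mu>) \<phi> \<psi> \<in> vecs (Linf_functions \<mu>)"
    unfolding Linf_functions_simps
  proof
    show "locally_measurable \<mu> (\<lambda>x. \<phi> x + \<psi> x)"
      using \<phi>m \<psi> unfolding locally_measurable_def Linf_functions_simps
      by (intro ballI impI borel_measurable_add) blast+
    have "locally_AE \<mu> (\<lambda>x. cmod (\<phi> x + \<psi> x) \<le> C + C')"
      by (rule locally_AE_mono[OF locally_AE_conj[OF C C']])
        (use norm_triangle_ineq in \<open>fastforce intro: order_trans add_mono\<close>)
    then show "\<exists>C. locally_AE \<mu> (\<lambda>x. cmod (\<phi> x + \<psi> x) \<le> C)" by blast
  qed
qed (auto simp: Linf_functions_simps algebra_simps)

abbreviation locally_null :: "'g measure \<Rightarrow> ('g \<Rightarrow> complex) set" where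
  "locally_null \<mu> \<equiv> {\<phi> \<in> vecs (Linf_functions \<mu>). locally_AE \<mu> (\<lambda>x. \<phi> x = 0)}"

lemma csubspace_locally_null: "csubspace (Linf_functions \<mu>) (locally_null \<mu>)"
proof -
  interpret cvector_space "Linf_functions \<mu>" by (rule cvector_space_Linf_functions)
  show ?thesis
  proof
    show "locally_null \<mu> \<subseteq> vecs (Linf_functions \<mu>)" by blast
    obtain \<phi> where \<phi>: "\<phi> \<in> vecs (Linf_functions \<mu>)" using nonempty by blast
    have "locally_AE \<mu> (\<lambda>x. vscale (Linf_functions \<mu>) 0 \<phi> x = 0)"
      by (simp add: Linf_functions_simps locally_AE_def)
    then have "vscale (Linf_functions \<mu>) 0 \<phi> \<in> locally_null \<mu>" using \<phi> by simp
    then show "locally_null \<mu> \<noteq> {}" by blast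
    fix \<phi> assume \<phi>: "\<phi> \<in> locally_null \<mu>"
    then show "vscale (Linf_functions \<mu>) c \<phi> \<in> locally_null \<mu>" for c
      using scale_closed[of \<phi> c] by (auto simp: Linf_functions_simps(3) elim: locally_AE_mono)
    fix \<psi> assume \<psi>: "\<psi> \<in> locally_null \<mu>"
    have "locally_AE \<mu> (\<lambda>x. \<phi> x = 0 \<and> \<psi> x = 0)"
      using \<phi> \<psi> by (auto intro: locally_AE_conj)
    then have "locally_AE \<mu> (\<lambda>x. \<phi> x + \<psi> x = 0)" by (rule locally_AE_mono) simp
    then show "vadd (Linf_functions \<mu>) \<phi> \<psi> \<in> locally_null \<mu>"
      using add_closed[of \<phi> \<psi>] \<phi> \<psi> by (simp add: Linf_functions_simps(2))
  qed
qed

text \<open>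
  Integrable functions live on countably many sets of finite measure, which is why local
  measurability and local null sets are the right notions for pairing with them.
\<close>

lemma support_cover:
  assumes f: "integrable \<mu> (f :: 'a \<Rightarrow> complex)"
  obtains F :: "nat \<Rightarrow> 'a set" where "\<And>n. F n \<in> sets \<mu>" "\<And>n. emeasure \<mu> (F n) < \<infinity>"
    "\<And>x. x \<in> space \<mu> \<Longrightarrow> f x \<noteq> 0 \<Longrightarrow> \<exists>n. x \<in> F n"
proof
  let ?F = "\<lambda>n. {x \<in> space \<mu>. inverse (real (Suc n)) \<le> cmod (f x)}"
  have [measurable]: "f \<in> borel_measurable \<mu>" using f by auto
  show "?F n \<in> sets \<mu>" for n by measurable
  show "emeasure \<mu> (?F n) < \<infinity>" for n
    using integral_Markov_inequality[OF integrable_norm[OF f], of "inverse (real (Suc n))"]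
    by (simp add: le_less_trans del: of_nat_Suc)
  show "\<exists>n. x \<in> ?F n" if "x \<in> space \<mu>" "f x \<noteq> 0" for x
    using reals_Archimedean[of "cmod (f x)"] that by (auto intro: less_imp_le)
qed

lemma locally_AE_on_support:
  assumes f: "integrable \<mu> (f :: 'a \<Rightarrow> complex)" and P: "locally_AE \<mu> P"
  shows "AE x in \<mu>. f x \<noteq> 0 \<longrightarrow> P x"
proof -
  obtain F :: "nat \<Rightarrow> 'a set" where F: "\<And>n. F n \<in> sets \<mu>" "\<And>n. emeasure \<mu> (F n) < \<infinity>"
    "\<And>x. x \<in> space \<mu> \<Longrightarrow> f x \<noteq> 0 \<Longrightarrow> \<exists>n. x \<in> F n"
    using support_cover[OF f] by metis
  have "AE x in \<mu>. \<forall>n. x \<in> F n \<longrightarrow> P x"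
    unfolding AE_all_countable using P F(1,2) by (simp add: locally_AE_def)
  then show ?thesis
    using AE_space by eventually_elim (use F(3) in blast)
qed

lemma integrable_mult_Linf:
  fixes \<mu> :: "'a measure"
  assumes f: "integrable \<mu> f" and \<phi>: "\<phi> \<in> vecs (Linf_functions \<mu>)"
  shows "integrable \<mu> (\<lambda>x. f x * \<phi> x)"
proof -
  have [measurable]: "f \<in> borel_measurable \<mu>" using f by auto
  obtain C where C: "locally_AE \<mu> (\<lambda>x. cmod (\<phi> x) \<le> C)" and m: "locally_measurable \<mu> \<phi>"
    using \<phi> by (auto simp: Linf_functions_simps)
  obtain F :: "nat \<Rightarrow> 'a set" where F: "\<And>n. F n \<in> sets \<mu>" "\<And>n. emeasure \<mu> (F n) < \<infinity>"
    "\<And>x. x \<in> space \<mu> \<Longrightarrow> f x \<noteq> 0 \<Longrightarrow> \<exists>n. x \<in> F n"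
    using support_cover[OF f] by metis
  show ?thesis
  proof (rule Bochner_Integration.integrable_bound)
    show "integrable \<mu> (\<lambda>x. C * cmod (f x))" using f by simp
    show "AE x in \<mu>. norm (f x * \<phi> x) \<le> norm (C * cmod (f x))"
      using locally_AE_on_support[OF f C]
    proof eventually_elim
      case (elim x)
      show ?case
      proof (cases "f x = 0")
        case False
        with elim have "cmod (\<phi> x) \<le> \<bar>C\<bar>" by simp
        then show ?thesis by (simp add: norm_mult abs_mult mult.commute[of _ "cmod (f x)"] mult_left_mono)
      qed simp
    qed
    show "(\<lambda>x. f x * \<phi> x) \<in> borel_measurable \<mu>"
    proof (rule measurable_piecewise_restrict)
      let ?Z = "{x \<in> space \<mu>. f x = 0}"
      show "countable (insert ?Z (range F))" by simp
      show "space \<mu> \<subseteq> \<Union> (insert ?Z (range F))" using F(3) by auto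
      fix \<Omega> assume \<Omega>: "\<Omega> \<in> insert ?Z (range F)"
      have Z: "?Z \<in> sets \<mu>" by measurable
      then show "\<Omega> \<inter> space \<mu> \<in> sets \<mu>" using \<Omega> F(1) by auto
      consider "\<Omega> = ?Z" | n where "\<Omega> = F n" using \<Omega> by blast
      then show "(\<lambda>x. f x * \<phi> x) \<in> borel_measurable (restrict_space \<mu> \<Omega>)"
      proof cases
        case 1
        have "(\<lambda>x. 0) \<in> borel_measurable (restrict_space \<mu> \<Omega>)" by simp
        then show ?thesis
          by (rule measurable_cong[THEN iffD2, rotated]) (simp add: 1 space_restrict_space)
      next
        case 2
        have [measurable]: "\<phi> \<in> borel_measurable (restrict_space \<mu> \<Omega>)"
          using m F by (simp add: 2 locally_measurable_def)
        have [measurable]: "f \<in> borel_measurable (restrict_space \<mu> \<Omega>)"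
          by (rule measurable_restrict_space1) measurable
        show ?thesis by measurable
      qed
    qed
  qed
qed

context
  fixes \<mu> :: "'g measure"
begin

interpretation csubspace "Linf_functions \<mu>" "locally_null \<mu>"
  by (rule csubspace_locally_null)

lemma vecs_Linf: "vecs (Linf \<mu>) = coset ` vecs (Linf_functions \<mu>)"
  and cvector_space_Linf: "cvector_space (Linf \<mu>)"
  unfolding Linf_def by (rule vecs_quotient, rule cvector_space_quotient)

lemma Linf_functional_coset:
  assumes \<phi>: "\<phi> \<in> vecs (Linf_functions \<mu>)"
  shows "Linf_functional \<mu> (coset \<phi>) = (\<lambda>f\<in>vecs (L1 \<mu>). \<integral>x. f x * \<phi> x \<partial>\<mu>)"
  unfolding Linf_functional_def
proof (rule restrict_ext)
  fix f assume "f \<in> vecs (L1 \<mu>)"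
  then have f: "integrable \<mu> f" by simp
  have r: "rep (coset \<phi>) \<in> vecs (Linf_functions \<mu>)"
    and "locally_AE \<mu> (\<lambda>x. rep (coset \<phi>) x - \<phi> x = 0)"
    using rep_coset[OF \<phi>] by (auto simp: vdiff_def Linf_functions_simps(2,3))
  from locally_AE_on_support[OF f this(2)]
  have "AE x in \<mu>. f x * rep (coset \<phi>) x = f x * \<phi> x"
    by eventually_elim auto
  then show "(\<integral>x. f x * rep (coset \<phi>) x \<partial>\<mu>) = (\<integral>x. f x * \<phi> x \<partial>\<mu>)"
    using integrable_mult_Linf[OF f r] integrable_mult_Linf[OF f \<phi>]
    by (intro integral_cong_AE) auto
qed

lemma Linf_functional_in_dual:
  assumes \<Phi>: "\<Phi> \<in> vecs (Linf \<mu>)"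
  shows "Linf_functional \<mu> \<Phi> \<in> vecs (dual_space (L1 \<mu>))"
proof -
  obtain \<phi> where \<phi>: "\<phi> \<in> vecs (Linf_functions \<mu>)" "\<Phi> = coset \<phi>"
    using \<Phi> by (auto simp: vecs_Linf)
  obtain C where C: "locally_AE \<mu> (\<lambda>x. cmod (\<phi> x) \<le> C)"
    using \<phi> by (auto simp: Linf_functions_simps)
  have "cmod (\<integral>x. f x * \<phi> x \<partial>\<mu>) \<le> C * (\<integral>x. cmod (f x) \<partial>\<mu>)" if f: "integrable \<mu> f" for f
  proof -
    have "AE x in \<mu>. norm (f x * \<phi> x) \<le> C * cmod (f x)"
      using locally_AE_on_support[OF f C]
    proof eventually_elim
      case (elim x)
      then show ?case
        by (cases "f x = 0") (simp_all add: norm_mult mult.commute[of _ "cmod (f x)"] mult_left_mono)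
    qed
    then have "cmod (\<integral>x. f x * \<phi> x \<partial>\<mu>) \<le> (\<integral>x. C * cmod (f x) \<partial>\<mu>)"
      using f by (intro norm_integral_le_AE integrable_mult_Linf \<phi>) auto
    then show ?thesis by simp
  qed
  moreover have "linear_functional (L1 \<mu>) (Linf_functional \<mu> \<Phi>)"
    unfolding linear_functional_def \<phi>(2) Linf_functional_coset[OF \<phi>(1)]
    using integrable_mult_Linf[OF _ \<phi>(1)] by (auto simp: distrib_right mult.assoc)
  ultimately show ?thesis
    unfolding in_dual_space_iff
    by (auto simp: \<phi>(2) Linf_functional_coset[OF \<phi>(1)] intro!: exI[of _ C])
qed

lemma Linf_functional_add:
  assumes "\<Phi> \<in> vecs (Linf \<mu>)" "\<Psi> \<in> vecs (Linf \<mu>)"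
  shows "Linf_functional \<mu> (vadd (Linf \<mu>) \<Phi> \<Psi>)
    = vadd (dual_space (L1 \<mu>)) (Linf_functional \<mu> \<Phi>) (Linf_functional \<mu> \<Psi>)"
proof -
  obtain \<phi> \<psi> where \<phi>: "\<phi> \<in> vecs (Linf_functions \<mu>)" "\<Phi> = coset \<phi>"
    and \<psi>: "\<psi> \<in> vecs (Linf_functions \<mu>)" "\<Psi> = coset \<psi>"
    using assms by (auto simp: vecs_Linf)
  show ?thesis
    unfolding \<phi>(2) \<psi>(2) Linf_def quotient_add[OF \<phi>(1) \<psi>(1)] Linf_functional_coset[OF \<phi>(1)]
      Linf_functional_coset[OF \<psi>(1)] Linf_functional_coset[OF add_closed[OF \<phi>(1) \<psi>(1)]]
    using integrable_mult_Linf[OF _ \<phi>(1)] integrable_mult_Linf[OF _ \<psi>(1)]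
    by (auto simp: dual_space_def Linf_functions_simps(2) distrib_left restrict_def fun_eq_iff)
qed

lemma Linf_functional_scale:
  assumes "\<Phi> \<in> vecs (Linf \<mu>)"
  shows "Linf_functional \<mu> (vscale (Linf \<mu>) c \<Phi>) = vscale (dual_space (L1 \<mu>)) c (Linf_functional \<mu> \<Phi>)"
proof -
  obtain \<phi> where \<phi>: "\<phi> \<in> vecs (Linf_functions \<mu>)" "\<Phi> = coset \<phi>"
    using assms by (auto simp: vecs_Linf)
  show ?thesis
    unfolding \<phi>(2) Linf_def quotient_scale[OF \<phi>(1)] Linf_functional_coset[OF \<phi>(1)]
      Linf_functional_coset[OF scale_closed[OF \<phi>(1)]]
    by (auto simp: dual_space_def Linf_functions_simps(3) mult.left_commute[of _ c] restrict_def
        fun_eq_iff)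
qed

text \<open>
  If \<open>\<delta>\<close> pairs to zero with every integrable function, then it does so with its own conjugate cut off to
  a set of finite measure, so that \<open>\<bar>\<delta>\<bar>\<^sup>2\<close> has integral zero over this set.
\<close>

lemma inj_on_Linf_functional: "inj_on (Linf_functional \<mu>) (vecs (Linf \<mu>))"
proof (rule inj_onI)
  fix \<Phi> \<Psi> assume "\<Phi> \<in> vecs (Linf \<mu>)" "\<Psi> \<in> vecs (Linf \<mu>)"
    and eq: "Linf_functional \<mu> \<Phi> = Linf_functional \<mu> \<Psi>"
  then obtain \<phi> \<psi> where \<phi>: "\<phi> \<in> vecs (Linf_functions \<mu>)" "\<Phi> = coset \<phi>"
    and \<psi>: "\<psi> \<in> vecs (Linf_functions \<mu>)" "\<Psi> = coset \<psi>"
    by (auto simp: vecs_Linf)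
  define \<delta> where "\<delta> = vdiff (Linf_functions \<mu>) \<phi> \<psi>"
  have \<delta>_eq: "\<delta> x = \<phi> x - \<psi> x" for x
    by (simp add: \<delta>_def vdiff_def Linf_functions_simps)
  have \<delta>: "\<delta> \<in> vecs (Linf_functions \<mu>)" using \<phi> \<psi> by (simp add: \<delta>_def)
  have zero: "(\<integral>x. f x * \<delta> x \<partial>\<mu>) = 0" if f: "integrable \<mu> f" for f
    using fun_cong[OF eq, of f] f integrable_mult_Linf[OF f \<phi>(1)] integrable_mult_Linf[OF f \<psi>(1)]
    by (simp add: \<phi> \<psi> Linf_functional_coset \<delta>_eq right_diff_distrib)
  have "locally_AE \<mu> (\<lambda>x. \<delta> x = 0)"
    unfolding locally_AE_def
  proof (intro ballI impI)
    fix F assume F [measurable]: "F \<in> sets \<mu>" and fin: "emeasure \<mu> F < \<infinity>"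
    obtain C where C: "locally_AE \<mu> (\<lambda>x. cmod (\<delta> x) \<le> C)" and m: "locally_measurable \<mu> \<delta>"
      using \<delta> by (auto simp: Linf_functions_simps)
    \<comment> \<open>Test against the conjugate of \<open>\<delta>\<close>, cut off to \<open>F\<close>.\<close>
    define f where "f x = indicator F x * cnj (\<delta> x)" for x
    have iF: "integrable \<mu> (indicator F :: _ \<Rightarrow> complex)"
      using fin by (intro integrable_complex_indicator) auto
    have "integrable \<mu> (\<lambda>x. indicator F x * \<delta> x)"
      by (rule integrable_mult_Linf[OF iF \<delta>])
    then have "integrable \<mu> (\<lambda>x. cnj (indicator F x * \<delta> x))" by (rule integrable_cnj)
    moreover have "(\<lambda>x. cnj (indicator F x * \<delta> x)) = f"
      by (auto simp: f_def indicator_def fun_eq_iff)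
    ultimately have f: "integrable \<mu> f" by simp
    have sq: "f x * \<delta> x = complex_of_real (indicator F x * (cmod (\<delta> x))\<^sup>2)" for x
      by (cases "x \<in> F") (simp_all add: f_def complex_norm_square mult.commute del: of_real_power)
    have i: "integrable \<mu> (\<lambda>x. indicator F x * (cmod (\<delta> x))\<^sup>2)"
      using integrable_mult_Linf[OF f \<delta>] unfolding sq by (simp only: complex_of_real_integrable_eq)
    have "(\<integral>x. indicator F x * (cmod (\<delta> x))\<^sup>2 \<partial>\<mu>) = 0"
      using zero[OF f] unfolding sq integral_complex_of_real by (simp only: of_real_eq_0_iff)
    then have "AE x in \<mu>. indicator F x * (cmod (\<delta> x))\<^sup>2 = 0"
      using i by (subst (asm) integral_nonneg_eq_0_iff_AE) auto
    then show "AE x in \<mu>. x \<in> F \<longrightarrow> \<delta> x = 0"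
      by eventually_elim (auto simp: indicator_def)
  qed
  with \<delta> have "\<delta> \<in> locally_null \<mu>" by simp
  then show "\<Phi> = \<Psi>"
    using \<phi> \<psi> by (simp add: coset_eq_iff \<delta>_def)
qed

end

text \<open>
  A form of strict localizability. The last clause holds trivially when \<open>\<D>\<close> is
  countable and covers the space, that is, for \<open>\<sigma>\<close>-finite measures.
\<close>

definition decomposition :: "'a measure \<Rightarrow> 'a set set \<Rightarrow> bool" where
  "decomposition M \<D> \<longleftrightarrow> disjoint \<D> \<and> (\<forall>D\<in>\<D>. D \<in> sets M \<and> emeasure M D < \<infinity>) \<and>
    (\<forall>F\<in>sets M. emeasure M F < \<infinity> \<longrightarrow> (\<exists>\<C>\<subseteq>\<D>. countable \<C> \<and> F \<subseteq> \<Union>\<C>))"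

text \<open>
  The local densities on the pieces are glued to one function \<open>\<phi>\<close>. It is locally measurable because a
  set of finite measure involves only countably many pieces. For the same reason \<open>\<Lambda>\<close> and integration
  against \<open>\<phi>\<close> agree on indicators of sets of finite measure, which determine them.
\<close>

theorem Linf_functional_surj:
  assumes dec: "decomposition \<mu> \<D>" and \<Lambda>: "\<Lambda> \<in> vecs (dual_space (L1 \<mu>))"
  obtains \<Phi> where "\<Phi> \<in> vecs (Linf \<mu>)" "Linf_functional \<mu> \<Phi> = \<Lambda>"
proof -
  have disj: "D = D'" if "D \<in> \<D>" "D' \<in> \<D>" "x \<in> D" "x \<in> D'" for D D' x
    using dec that by (auto simp: decomposition_def disjoint_def)
  have D: "D \<in> sets \<mu>" "emeasure \<mu> D < \<infinity>" if "D \<in> \<D>" for D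
    using dec that by (auto simp: decomposition_def)
  let ?K = "2 * vnorm (dual_space (L1 \<mu>)) \<Lambda>"
  have "\<forall>D\<in>\<D>. \<exists>h. h \<in> borel_measurable \<mu> \<and> (\<forall>x. cmod (h x) \<le> ?K) \<and>
      (\<forall>B. B \<in> sets \<mu> \<longrightarrow> B \<subseteq> D \<longrightarrow> \<Lambda> (indicator B) = (\<integral>x. indicator B x * h x \<partial>\<mu>))"
    using L1_functional_local_density[OF \<Lambda> D] by metis
  then obtain h where h: "\<And>D. D \<in> \<D> \<Longrightarrow> h D \<in> borel_measurable \<mu>"
    "\<And>D x. D \<in> \<D> \<Longrightarrow> cmod (h D x) \<le> ?K"
    "\<And>D B. D \<in> \<D> \<Longrightarrow> B \<in> sets \<mu> \<Longrightarrow> B \<subseteq> D \<Longrightarrow> \<Lambda> (indicator B) = (\<integral>x. indicator B x * h D x \<partial>\<mu>)"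
    by metis
  define \<phi> where "\<phi> x = (if x \<in> \<Union>\<D> then h (THE D. D \<in> \<D> \<and> x \<in> D) x else 0)" for x
  have \<phi>: "\<phi> x = h D x" if "D \<in> \<D>" "x \<in> D" for D x
  proof -
    have "(THE D. D \<in> \<D> \<and> x \<in> D) = D"
      using that disj by (intro the_equality) auto
    then show ?thesis using that by (auto simp: \<phi>_def)
  qed
  have K: "0 \<le> ?K"
    using cseminormed_space.dual_norm_nonneg[OF cseminormed_space_L1 \<Lambda>] by simp
  have \<phi>_bound: "cmod (\<phi> x) \<le> ?K" for x
  proof (cases "x \<in> \<Union>\<D>")
    case True
    then obtain D' where "D' \<in> \<D>" "x \<in> D'" by blast
    then show ?thesis using \<phi> h(2) by simp
  next
    case False
    then show ?thesis unfolding \<phi>_def using K by simp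
  qed
  have cover: "\<exists>\<C>\<subseteq>\<D>. countable \<C> \<and> F \<subseteq> \<Union>\<C>" if "F \<in> sets \<mu>" "emeasure \<mu> F < \<infinity>" for F
    using dec that by (auto simp: decomposition_def)
  have \<phi>_meas: "locally_measurable \<mu> \<phi>"
    unfolding locally_measurable_def
  proof (intro ballI impI)
    fix F assume F: "F \<in> sets \<mu>" "emeasure \<mu> F < \<infinity>"
    obtain \<C> where \<C>: "\<C> \<subseteq> \<D>" "countable \<C>" "F \<subseteq> \<Union>\<C>" using cover[OF F] by blast
    show "\<phi> \<in> borel_measurable (restrict_space \<mu> F)"
    proof (rule measurable_piecewise_restrict[OF \<C>(2)])
      show "space (restrict_space \<mu> F) \<subseteq> \<Union>\<C>" using \<C>(3) by (auto simp: space_restrict_space)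
      fix \<Omega> assume \<Omega>: "\<Omega> \<in> \<C>"
      then have \<Omega>D: "\<Omega> \<in> \<D>" using \<C>(1) by blast
      show "\<Omega> \<inter> space (restrict_space \<mu> F) \<in> sets (restrict_space \<mu> F)"
        using D(1)[OF \<Omega>D] F(1) by (simp add: sets_restrict_space_iff space_restrict_space sets.Int_space_eq2 Int_assoc
            sets.Int)
      have "h \<Omega> \<in> borel_measurable (restrict_space (restrict_space \<mu> F) \<Omega>)"
        by (intro measurable_restrict_space1 h(1) \<Omega>D)
      then show "\<phi> \<in> borel_measurable (restrict_space (restrict_space \<mu> F) \<Omega>)"
        by (rule measurable_cong[THEN iffD2, rotated]) (simp add: space_restrict_space \<phi>[OF \<Omega>D])
    qed
  qed
  have \<phi>_in: "\<phi> \<in> vecs (Linf_functions \<mu>)"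
    unfolding Linf_functions_simps using \<phi>_meas \<phi>_bound by (auto simp: locally_AE_def intro!: exI[of _ ?K])
  let ?\<Phi> = "coset_rel (Linf_functions \<mu>) (locally_null \<mu>) `` {\<phi>}"
  let ?T = "Linf_functional \<mu> ?\<Phi>"
  have \<Phi>_in: "?\<Phi> \<in> vecs (Linf \<mu>)" using \<phi>_in by (simp add: vecs_Linf)
  have dual: "?T \<in> vecs (dual_space (L1 \<mu>))"
    by (rule Linf_functional_in_dual[OF \<Phi>_in])
  have T: "?T f = (\<integral>x. f x * \<phi> x \<partial>\<mu>)" if "integrable \<mu> f" for f
    using that by (simp add: Linf_functional_coset[OF \<phi>_in])
  have lin: "linear_functional (L1 \<mu>) \<Lambda>" "linear_functional (L1 \<mu>) (?T)"
    using \<Lambda> dual by (auto simp: in_dual_space_iff)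
  have int: "integrable \<mu> (indicator B :: _ \<Rightarrow> complex)" if "B \<in> sets \<mu>" "emeasure \<mu> B < \<infinity>" for B
    using that by (rule integrable_complex_indicator)
  have "indicator {} = vscale (L1 \<mu>) 0 (\<lambda>_. 0)" by auto
  then have empty: "?T (indicator {}) = \<Lambda> (indicator {})"
    using linear_functional_scale[OF lin(1), of "\<lambda>_. 0" 0] linear_functional_scale[OF lin(2), of "\<lambda>_. 0" 0]
    by simp
  have piece: "?T (indicator B) = \<Lambda> (indicator B)"
    if "B \<in> sets \<mu>" "emeasure \<mu> B < \<infinity>" "D \<in> \<D>" "B \<subseteq> D" for B D
  proof -
    have "(\<integral>x. indicator B x * \<phi> x \<partial>\<mu>) = (\<integral>x. indicator B x * h D x \<partial>\<mu>)"
      using that \<phi> by (intro Bochner_Integration.integral_cong) (auto simp: indicator_def)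
    then show ?thesis using that h(3) by (simp add: T int)
  qed
  have "?T = \<Lambda>"
  proof (rule L1_functional_eqI[OF dual \<Lambda>])
    fix B assume B: "B \<in> sets \<mu>" "emeasure \<mu> B < \<infinity>"
    obtain \<C> where \<C>: "\<C> \<subseteq> \<D>" "countable \<C>" "B \<subseteq> \<Union>\<C>" using cover[OF B] by blast
    have sub: "A \<in> sets \<mu> \<Longrightarrow> A \<subseteq> B \<Longrightarrow> emeasure \<mu> A < \<infinity>" for A
      using B emeasure_mono[of A B \<mu>] by (simp add: le_less_trans)
    show "?T (indicator B) = \<Lambda> (indicator B)"
    proof (cases "\<C> = {}")
      case True
      with \<C>(3) have B_empty: "B = {}" by simp
      show ?thesis unfolding B_empty by (rule empty)
    next
      case False
      then have rng: "range (from_nat_into \<C>) = \<C>" using \<C>(2) by (rule range_from_nat_into)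
      \<comment> \<open>Cut \<open>B\<close> along the pieces; the finite unions \<open>U n\<close> increase to \<open>B\<close>.\<close>
      define E where "E n = B \<inter> disjointed (from_nat_into \<C>) n" for n
      have inD: "from_nat_into \<C> n \<in> \<D>" for n using rng \<C>(1) by blast
      have disj_sets: "disjointed (from_nat_into \<C>) n \<in> sets \<mu>" for n
        using sets.range_disjointed_sets[of "from_nat_into \<C>" \<mu>] D(1) inD by blast
      have E: "E n \<in> sets \<mu>" "E n \<subseteq> B" for n
        using disj_sets B by (auto simp: E_def)
      have E_fin: "emeasure \<mu> (E n) < \<infinity>" for n by (rule sub[OF E])
      have E_D: "E n \<subseteq> from_nat_into \<C> n" for n
        using disjointed_subset[of "from_nat_into \<C>" n] by (auto simp: E_def)
      have E_disj: "E m \<inter> E n = {}" if "m \<noteq> n" for m n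
        using disjoint_family_disjointed[of "from_nat_into \<C>"] that
        by (auto simp: E_def disjoint_family_on_def)
      have E_un: "(\<Union>n. E n) = B"
        using \<C>(3) rng UN_disjointed_eq[of "from_nat_into \<C>"] by (auto simp: E_def)
      define U where "U n = (\<Union>i<n. E i)" for n
      have U: "U n \<in> sets \<mu>" "U n \<subseteq> B" for n using E by (auto simp: U_def)
      have U_eq: "?T (indicator (U n)) = \<Lambda> (indicator (U n))" for n
      proof (induction n)
        case 0
        have "U 0 = {}" by (simp add: U_def)
        then show ?case by (simp only: empty)
      next
        case (Suc n)
        have "E i \<inter> E n = {}" if "i < n" for i using E_disj[of i n] that by simp
        then have "U n \<inter> E n = {}" unfolding U_def by blast
        then have "indicator (U (Suc n)) = vadd (L1 \<mu>) (indicator (U n)) (indicator (E n) :: _ \<Rightarrow> complex)"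
          by (auto simp: U_def lessThan_Suc indicator_def fun_eq_iff)
        then show ?case
          using linear_functional_add[OF lin(1), of "indicator (U n)" "indicator (E n)"]
            linear_functional_add[OF lin(2), of "indicator (U n)" "indicator (E n)"]
            piece[OF E(1) E_fin inD E_D] Suc int[OF U(1) sub[OF U]] int[OF E(1) E_fin] by simp
      qed
      have lim: "(\<lambda>n. indicator (U n) x :: complex) \<longlonglongrightarrow> indicator B x" for x
        unfolding U_def E_un[symmetric] by (rule LIMSEQ_indicator_UN)
      have conv: "(\<lambda>n. M (indicator (U n))) \<longlonglongrightarrow> M (indicator B)" if "M \<in> vecs (dual_space (L1 \<mu>))" for M
      proof (rule L1_functional_tendsto[OF that])
        show "integrable \<mu> (indicator B :: _ \<Rightarrow> real)" using B by (simp add: integrable_indicator_iff)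
        show "norm (indicator (U n) x :: complex) \<le> indicator B x" for n x
          using U(2)[of n] by (auto simp: indicator_def)
      qed (use lim int[OF U(1) sub[OF U]] int[OF B] in auto)
      show ?thesis
        using conv[OF \<Lambda>] conv[OF dual] unfolding U_eq by (rule LIMSEQ_unique[rotated])
    qed
  qed
  with \<Phi>_in show thesis by (rule that)
qed

section \<open>Haar measure is decomposable\<close>

lemma continuous_left_translation: "continuous_on S (\<lambda>x::'g::topological_group_add. a + x)"
  by (intro continuous_intros)

lemma continuous_uminus_group: "continuous_on S (\<lambda>x::'g::topological_group_add. - x)"
  by (simp add: continuous_on_def tendsto_minus)

lemma left_translate_eq: "(\<lambda>x. a + x) ` S = {x::'g::group_add. - a + x \<in> S}"
proof (intro set_eqI iffI)
  fix x assume "x \<in> {x. - a + x \<in> S}"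
  then have "- a + x \<in> S" "x = a + (- a + x)" by (simp_all add: add.assoc[symmetric])
  then show "x \<in> (\<lambda>x. a + x) ` S" by blast
qed (auto simp: add.assoc[symmetric])

lemma open_left_translate:
  fixes S :: "'g::topological_group_add set"
  shows "open S \<Longrightarrow> open ((\<lambda>x. a + x) ` S)"
  unfolding left_translate_eq
  using open_vimage[OF _ continuous_left_translation[of UNIV "- a"], of S] by (simp add: vimage_def)

lemma compact_left_translate:
  fixes S :: "'g::topological_group_add set"
  shows "compact S \<Longrightarrow> compact ((\<lambda>x. a + x) ` S)"
  by (intro compact_continuous_image continuous_left_translation)

lemma borel_left_translate:
  fixes S :: "'g::topological_group_add set"
  assumes "S \<in> sets borel"
  shows "(\<lambda>x. a + x) ` S \<in> sets borel"
proof -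
  have "(\<lambda>x::'g. - a + x) \<in> measurable borel borel"
    by (intro borel_measurable_continuous_onI continuous_left_translation)
  from measurable_sets[OF this assms] show ?thesis
    unfolding left_translate_eq by (simp add: vimage_def)
qed

lemma left_haar_measureD:
  assumes "left_haar_measure \<mu>"
  shows "sets \<mu> = sets borel" and "emeasure \<mu> UNIV \<noteq> 0"
    and "compact K \<Longrightarrow> emeasure \<mu> K < \<infinity>"
    and "A \<in> sets borel \<Longrightarrow> emeasure \<mu> A = (INF U\<in>{U. open U \<and> A \<subseteq> U}. emeasure \<mu> U)"
    and "open U \<Longrightarrow> emeasure \<mu> U = (SUP K\<in>{K. compact K \<and> K \<subseteq> U}. emeasure \<mu> K)"
    and "A \<in> sets borel \<Longrightarrow> emeasure \<mu> ((\<lambda>x. g + x) ` A) = emeasure \<mu> A"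
proof -
  note haar = assms[unfolded left_haar_measure_def]
  show "sets \<mu> = sets borel" "emeasure \<mu> UNIV \<noteq> 0" by (rule haar[THEN conjunct1], rule haar[THEN conjunct2, THEN conjunct1])
  show "compact K \<Longrightarrow> emeasure \<mu> K < \<infinity>"
    by (rule haar[THEN conjunct2, THEN conjunct2, THEN conjunct1, rule_format])
  show "A \<in> sets borel \<Longrightarrow> emeasure \<mu> A = (INF U\<in>{U. open U \<and> A \<subseteq> U}. emeasure \<mu> U)"
    by (rule haar[THEN conjunct2, THEN conjunct2, THEN conjunct2, THEN conjunct1, rule_format])
  show "open U \<Longrightarrow> emeasure \<mu> U = (SUP K\<in>{K. compact K \<and> K \<subseteq> U}. emeasure \<mu> K)"
    by (rule haar[THEN conjunct2, THEN conjunct2, THEN conjunct2, THEN conjunct2, THEN conjunct1,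
          rule_format])
  show "A \<in> sets borel \<Longrightarrow> emeasure \<mu> ((\<lambda>x. g + x) ` A) = emeasure \<mu> A"
    by (rule haar[THEN conjunct2, THEN conjunct2, THEN conjunct2, THEN conjunct2, THEN conjunct2,
          rule_format])
qed

text \<open>
  If \<open>U\<close> were null, then so would be every compact set, since finitely many translates of \<open>U\<close> cover
  it; inner regularity would make the whole measure vanish.
\<close>

lemma haar_open_pos:
  fixes \<mu> :: "'g::{t2_space, topological_group_add} measure"
  assumes haar: "left_haar_measure \<mu>" and U: "open U" "U \<noteq> {}"
  shows "emeasure \<mu> U \<noteq> 0"
proof
  assume zero: "emeasure \<mu> U = 0"
  note sets = left_haar_measureD(1)[OF haar]
  have null: "(\<lambda>x. t + x) ` U \<in> null_sets \<mu>" for t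
    using left_haar_measureD(6)[OF haar, of U t] U(1) zero open_left_translate[OF U(1), of t]
    by (simp add: null_sets_def sets)
  have "emeasure \<mu> K = 0" if K: "compact K" for K
  proof -
    obtain u where u: "u \<in> U" using U(2) by blast
    have "K \<subseteq> (\<Union>t\<in>UNIV. (\<lambda>x. t + x) ` U)"
    proof
      fix x
      have "x = (x - u) + u" by simp
      then show "x \<in> (\<Union>t\<in>UNIV. (\<lambda>x. t + x) ` U)" using u by blast
    qed
    then obtain T where T: "finite T" "K \<subseteq> (\<Union>t\<in>T. (\<lambda>x. t + x) ` U)"
      using compactE_image[OF K, of UNIV "\<lambda>t. (\<lambda>x. t + x) ` U"] open_left_translate[OF U(1)] by metis
    have "(\<Union>t\<in>T. (\<lambda>x. t + x) ` U) \<in> null_sets \<mu>"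
      using T(1) null by (intro null_sets_UN') (auto intro: countable_finite)
    then show ?thesis
      using emeasure_mono[OF T(2), of \<mu>] by (auto simp: null_sets_def)
  qed
  moreover have "emeasure \<mu> UNIV = (SUP K\<in>{K. compact K \<and> K \<subseteq> UNIV}. emeasure \<mu> K)"
    by (rule left_haar_measureD(5)[OF haar open_UNIV])
  ultimately have "emeasure \<mu> UNIV = (SUP K\<in>{K::'g set. compact K}. 0)" by simp
  also have "\<dots> = 0" by (simp add: SUP_constant bot_ennreal)
  finally show False using left_haar_measureD(2)[OF haar] by simp
qed

text \<open>
  The measures of the disjoint sets \<open>A \<inter> U\<close> have bounded finite sums, so only countably many of them
  are nonzero.
\<close>

lemma countable_disjoint_positive:
  assumes fin: "emeasure M U < \<infinity>" and U: "U \<in> sets M"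
    and disj: "disjoint \<A>" and A: "\<And>A. A \<in> \<A> \<Longrightarrow> A \<inter> U \<in> sets M"
    and pos: "\<And>A. A \<in> \<A> \<Longrightarrow> emeasure M (A \<inter> U) \<noteq> 0"
  shows "countable \<A>"
proof -
  let ?f = "\<lambda>A. measure M (A \<inter> U)"
  have finA: "emeasure M (A \<inter> U) < \<infinity>" if "A \<in> \<A>" for A
    using emeasure_mono[of "A \<inter> U" U M] U fin by (simp add: le_less_trans)
  have "sum ?f F \<le> measure M U" if F: "F \<subseteq> \<A>" "finite F" for F
  proof -
    have dF: "disjoint_family_on (\<lambda>A. A \<inter> U) F"
      unfolding disjoint_family_on_def
    proof (intro ballI impI)
      fix A B assume "A \<in> F" "B \<in> F" "A \<noteq> B"
      then have "A \<inter> B = {}" using disj F(1) unfolding disjoint_def by (meson subsetD)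
      then show "A \<inter> U \<inter> (B \<inter> U) = {}" by blast
    qed
    have "sum ?f F = measure M (\<Union>A\<in>F. A \<inter> U)"
      using F A finA by (intro measure_finite_Union[symmetric] dF) (auto simp: less_top_ennreal top.not_eq_extremum)
    also have "\<dots> \<le> measure M U"
    proof (rule measure_mono_fmeasurable)
      show "(\<Union>A\<in>F. A \<inter> U) \<in> sets M" using F A by (intro sets.finite_UN) auto
    qed (use U fin in \<open>auto simp: fmeasurable_def\<close>)
    finally show ?thesis .
  qed
  then have "bdd_above (sum ?f ` {F. F \<subseteq> \<A> \<and> finite F})"
    by (intro bdd_aboveI2[where M = "measure M U"]) auto
  then have "?f summable_on \<A>"
    by (intro nonneg_bdd_above_summable_on) auto
  then have "countable {A \<in> \<A>. ?f A \<noteq> 0}"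
    by (intro abs_summable_countable) simp
  moreover have "?f A \<noteq> 0" if "A \<in> \<A>" for A
    using pos[OF that] finA[OF that] by (simp add: measure_def enn2real_eq_0_iff less_top)
  ultimately show ?thesis by (simp add: Collect_conj_eq Int_absorb2 subset_eq)
qed

text \<open>
  The subgroup generated by a compact symmetric neighbourhood of the neutral element. The set \<open>W n\<close>
  consists of the sums of \<open>n + 1\<close> elements of this neighbourhood.
\<close>

lemma open_sigma_compact_subgroup:
  assumes lc: "locally_compact_space (euclidean :: 'g::{t2_space, topological_group_add} topology)"
  obtains W :: "nat \<Rightarrow> 'g::{t2_space, topological_group_add} set" and H
  where "\<And>n. compact (W n)" "H = (\<Union>n. W n)" "open H" "0 \<in> H"
    "\<And>x y. x \<in> H \<Longrightarrow> y \<in> H \<Longrightarrow> x + y \<in> H" "\<And>x. x \<in> H \<Longrightarrow> - x \<in> H"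
proof -
  obtain U K where U: "open U" "compact K" "(0::'g) \<in> U" "U \<subseteq> K"
    using lc[unfolded locally_compact_space_def, rule_format, of 0] by auto
  define V where "V = K \<union> uminus ` K"
  have V: "compact V" "U \<subseteq> V" "0 \<in> V" "\<And>x. x \<in> V \<Longrightarrow> - x \<in> V"
    using U compact_continuous_image[OF continuous_uminus_group U(2)] by (auto simp: V_def)
  define W where "W = rec_nat V (\<lambda>_ S. (\<lambda>(x, y). x + y) ` (S \<times> V))"
  have W0: "W 0 = V" and WS: "W (Suc n) = (\<lambda>(x, y). x + y) ` (W n \<times> V)" for n
    by (simp_all add: W_def)
  have comp: "compact (W n)" for n
  proof (induction n)
    case (Suc n)
    have "continuous_on (W n \<times> V) (\<lambda>(x, y). x + y)"
      unfolding split_beta by (intro continuous_intros)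
    then show ?case
      unfolding WS by (intro compact_continuous_image compact_Times Suc V(1))
  qed (simp add: W0 V(1))
  define H where "H = (\<Union>n. W n)"
  have add: "x + y \<in> W (Suc (m + n))" if "x \<in> W m" "y \<in> W n" for x y m n
    using that
  proof (induction n arbitrary: y)
    case (Suc n)
    then obtain z v where z: "z \<in> W n" "v \<in> V" "y = z + v" by (auto simp: WS)
    with Suc have "x + z \<in> W (Suc (m + n))" by blast
    then have "(x + z) + v \<in> W (Suc (Suc (m + n)))" using z(2) by (subst WS) auto
    then show ?case by (simp add: z(3) add.assoc)
  qed (auto simp: WS W0)
  have H_add: "x + y \<in> H" if "x \<in> H" "y \<in> H" for x y
    using that add by (fastforce simp: H_def)
  have VH: "V \<subseteq> H" using W0 by (auto simp: H_def)
  have "- x \<in> H" if "x \<in> W n" for x n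
    using that
  proof (induction n arbitrary: x)
    case 0
    then show ?case using V(4) VH by (auto simp: W0)
  next
    case (Suc n)
    then obtain z v where z: "z \<in> W n" "v \<in> V" "x = z + v" by (auto simp: WS)
    then have "- v + - z \<in> H" using Suc V(4) VH by (intro H_add) auto
    then show ?case by (simp add: z(3) minus_add)
  qed
  then have H_minus: "- x \<in> H" if "x \<in> H" for x using that by (auto simp: H_def)
  have "open H"
  proof (rule topological_space_class.openI)
    fix x assume x: "x \<in> H"
    have "(\<lambda>y. x + y) ` U \<subseteq> H" using x U V(2) VH H_add by blast
    moreover have "x \<in> (\<lambda>y. x + y) ` U" using U(3) by (intro image_eqI[of _ _ 0]) simp_all
    ultimately show "\<exists>T. open T \<and> x \<in> T \<and> T \<subseteq> H" using open_left_translate[OF U(1)] by blast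
  qed
  moreover have "0 \<in> H" using V(3) VH by blast
  ultimately show thesis by (rule that[OF comp H_def _ _ H_add H_minus])
qed

text \<open>
  The pieces are translates of the layers of \<open>H\<close> between consecutive compact sets of its exhaustion,
  one family for each coset. By outer regularity a set of finite measure lies in an open set of finite measure, and this meets only
  countably many cosets, since each intersection is open and hence of positive measure.
\<close>

theorem haar_decomposition:
  fixes \<mu> :: "'g::{t2_space, topological_group_add} measure"
  assumes lc: "locally_compact_space (euclidean :: 'g topology)" and haar: "left_haar_measure \<mu>"
  obtains \<D> where "decomposition \<mu> \<D>"
proof -
  note sets = left_haar_measureD(1)[OF haar]
  obtain W :: "nat \<Rightarrow> 'g set" and H where W: "\<And>n. compact (W n)" "H = (\<Union>n. W n)"
    and H: "open H" "0 \<in> H" "\<And>x y. x \<in> H \<Longrightarrow> y \<in> H \<Longrightarrow> x + y \<in> H" "\<And>x. x \<in> H \<Longrightarrow> - x \<in> H"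
    using open_sigma_compact_subgroup[OF lc] by blast
  define C where "C x = (\<lambda>y. x + y) ` H" for x
  have C_iff: "y \<in> C x \<longleftrightarrow> - x + y \<in> H" for x y
    by (simp add: C_def left_translate_eq)
  have C_self: "x \<in> C x" for x using H(2) by (simp add: C_iff)
  have C_eq: "C x = C y" if "y \<in> C x" for x y
  proof -
    have xy: "- x + y \<in> H" and yx: "- y + x \<in> H"
      using that H(4)[of "- x + y"] by (simp_all add: C_iff minus_add)
    have "- x + z \<in> H \<longleftrightarrow> - y + z \<in> H" for z
    proof
      assume "- x + z \<in> H"
      with yx have "(- y + x) + (- x + z) \<in> H" by (rule H(3))
      then show "- y + z \<in> H" by (simp add: add.assoc)
    next
      assume "- y + z \<in> H"
      with xy have "(- x + y) + (- y + z) \<in> H" by (rule H(3))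
      then show "- x + z \<in> H" by (simp add: add.assoc)
    qed
    then show ?thesis by (auto simp: C_iff)
  qed
  have C_open: "open (C x)" for x unfolding C_def by (rule open_left_translate[OF H(1)])
  have C_rep: "C (rep (C x)) = C x" for x
    using C_eq[of "rep (C x)" x] rep_mem[OF C_self] by simp
  define P where "P A n = (\<lambda>y. rep A + y) ` disjointed W n" for A n
  have P_sub: "P (C x) n \<subseteq> C x" for x n
  proof -
    have "P (C x) n \<subseteq> C (rep (C x))"
      using disjointed_subset[of W n] W(2) unfolding P_def C_def by blast
    then show ?thesis by (simp add: C_rep)
  qed
  have W_borel: "W n \<in> sets borel" for n
    by (intro borel_closed compact_imp_closed W(1))
  have P_sets: "P A n \<in> sets \<mu>" for A n
    unfolding P_def sets
    using sets.range_disjointed_sets[of W borel] W_borel by (intro borel_left_translate) auto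
  have P_fin: "emeasure \<mu> (P A n) < \<infinity>" for A n
  proof -
    have "compact ((\<lambda>y. rep A + y) ` W n)" by (intro compact_left_translate W(1))
    then have "emeasure \<mu> ((\<lambda>y. rep A + y) ` W n) < \<infinity>" "(\<lambda>y. rep A + y) ` W n \<in> sets \<mu>"
      using left_haar_measureD(3)[OF haar] by (auto simp: sets borel_closed compact_imp_closed)
    moreover have "P A n \<subseteq> (\<lambda>y. rep A + y) ` W n"
      unfolding P_def using disjointed_subset by (intro image_mono)
    ultimately show ?thesis using emeasure_mono le_less_trans by blast
  qed
  define \<D> where "\<D> = {P (C x) n |x n. True}"
  have "disjoint \<D>"
    unfolding disjoint_def
  proof (intro ballI impI)
    fix D D' assume "D \<in> \<D>" "D' \<in> \<D>" and ne: "D \<noteq> D'"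
    then obtain x m y n where D: "D = P (C x) m" "D' = P (C y) n" by (auto simp: \<D>_def)
    show "D \<inter> D' = {}"
    proof (cases "C x = C y")
      case True
      with ne D have "m \<noteq> n" by auto
      then have "disjointed W m \<inter> disjointed W n = {}"
        using disjoint_family_disjointed[of W] by (simp add: disjoint_family_on_def)
      then show ?thesis unfolding D True P_def by auto
    next
      case False
      have "C x \<inter> C y = {}"
      proof (rule ccontr)
        assume "C x \<inter> C y \<noteq> {}"
        then obtain z where "z \<in> C x" "z \<in> C y" by blast
        then show False using C_eq False by metis
      qed
      then show ?thesis using P_sub[of x m] P_sub[of y n] by (auto simp: D)
    qed
  qed
  moreover have "\<exists>\<C>\<subseteq>\<D>. countable \<C> \<and> F \<subseteq> \<Union>\<C>" if F: "F \<in> sets \<mu>" "emeasure \<mu> F < \<infinity>" for F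
  proof -
    have "emeasure \<mu> F = (INF U\<in>{U. open U \<and> F \<subseteq> U}. emeasure \<mu> U)"
      using left_haar_measureD(4)[OF haar] F(1) by (simp add: sets)
    with F(2) obtain U where U: "open U" "F \<subseteq> U" "emeasure \<mu> U < \<infinity>"
      by (auto simp: INF_less_iff)
    define \<A> where "\<A> = {A \<in> range C. A \<inter> U \<noteq> {}}"
    have "countable \<A>"
    proof (rule countable_disjoint_positive[OF U(3)])
      show "U \<in> sets \<mu>" using U(1) sets by simp
      show "disjoint \<A>"
        unfolding disjoint_def
      proof (intro ballI impI)
        fix A B assume "A \<in> \<A>" "B \<in> \<A>" "A \<noteq> B"
        then obtain x y where "A = C x" "B = C y" "C x \<noteq> C y" by (auto simp: \<A>_def)
        then show "A \<inter> B = {}" using C_eq by blast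
      qed
      fix A assume A: "A \<in> \<A>"
      then have "open (A \<inter> U)" "A \<inter> U \<noteq> {}" using C_open U(1) by (auto simp: \<A>_def)
      then show "A \<inter> U \<in> sets \<mu>" "emeasure \<mu> (A \<inter> U) \<noteq> 0"
        using sets haar_open_pos[OF haar] by auto
    qed
    then have "countable ((\<lambda>(A, n). P A n) ` (\<A> \<times> (UNIV :: nat set)))" by simp
    moreover have "(\<lambda>(A, n). P A n) ` (\<A> \<times> (UNIV :: nat set)) \<subseteq> \<D>"
      by (auto simp: \<A>_def \<D>_def)
    moreover have "F \<subseteq> \<Union> ((\<lambda>(A, n). P A n) ` (\<A> \<times> (UNIV :: nat set)))"
    proof
      fix x assume x: "x \<in> F"
      then have A: "C x \<in> \<A>" using U(2) C_self by (auto simp: \<A>_def)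
      have "x \<in> C (rep (C x))" using C_self C_rep by simp
      then have "- rep (C x) + x \<in> (\<Union>n. disjointed W n)" by (simp add: C_iff W(2) UN_disjointed_eq)
      then obtain n where "- rep (C x) + x \<in> disjointed W n" by blast
      then have "x \<in> P (C x) n" by (simp add: P_def left_translate_eq)
      with A show "x \<in> \<Union> ((\<lambda>(A, n). P A n) ` (\<A> \<times> (UNIV :: nat set)))" by auto
    qed
    ultimately show ?thesis by blast
  qed
  ultimately have "decomposition \<mu> \<D>"
    using P_sets P_fin by (auto simp: decomposition_def \<D>_def)
  then show thesis by (rule that)
qed

section \<open>The dual of a symmetrized completion\<close>

text \<open>
  The maps \<open>a\<close> and \<open>b\<close> send vectors to operators (or to any normed space), and the bound lets the real
  part of \<open>\<psi>\<close> factor through their joint image in the product. There it splits as a real-linear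
  functional, and complexification turns the summands into complex-linear ones with the same bounds.
\<close>

lemma functional_below_maximum_splits:
  fixes a :: "'x \<Rightarrow> 'v::real_normed_vector" and b :: "'x \<Rightarrow> 'w::real_normed_vector"
  assumes X: "cvector_space X"
    and a_add: "\<And>x y. x \<in> vecs X \<Longrightarrow> y \<in> vecs X \<Longrightarrow> a (vadd X x y) = a x + a y"
    and a_scale: "\<And>t x. x \<in> vecs X \<Longrightarrow> a (vscale X (complex_of_real t) x) = t *\<^sub>R a x"
    and a_norm: "\<And>c x. x \<in> vecs X \<Longrightarrow> norm (a (vscale X c x)) = cmod c * norm (a x)"
    and b_add: "\<And>x y. x \<in> vecs X \<Longrightarrow> y \<in> vecs X \<Longrightarrow> b (vadd X x y) = b x + b y"
    and b_scale: "\<And>t x. x \<in> vecs X \<Longrightarrow> b (vscale X (complex_of_real t) x) = t *\<^sub>R b x"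
    and b_norm: "\<And>c x. x \<in> vecs X \<Longrightarrow> norm (b (vscale X c x)) = cmod c * norm (b x)"
    and \<psi>: "linear_functional X \<psi>" and C: "0 \<le> C"
    and bound: "\<And>x. x \<in> vecs X \<Longrightarrow> cmod (\<psi> x) \<le> C * max (norm (a x)) (norm (b x))"
  obtains \<psi>0 \<psi>1 C0 C1 where "linear_functional X \<psi>0" "linear_functional X \<psi>1"
    "\<And>x. x \<in> vecs X \<Longrightarrow> cmod (\<psi>0 x) \<le> C0 * norm (a x)"
    "\<And>x. x \<in> vecs X \<Longrightarrow> cmod (\<psi>1 x) \<le> C1 * norm (b x)"
    "\<And>x. x \<in> vecs X \<Longrightarrow> \<psi> x = \<psi>0 x + \<psi>1 x" "0 \<le> C0" "0 \<le> C1" "C0 + C1 \<le> C"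
proof -
  interpret cvector_space X by (rule X)
  define ab where "ab x = (a x, b x)" for x
  define M where "M = ab ` vecs X"
  define r where "r z = Re (\<psi> (SOME x. x \<in> vecs X \<and> ab x = z))" for z
  have ab_add: "ab (vadd X x y) = ab x + ab y" if "x \<in> vecs X" "y \<in> vecs X" for x y
    using that by (simp add: ab_def a_add b_add)
  have ab_scale: "ab (vscale X (complex_of_real t) x) = t *\<^sub>R ab x" if "x \<in> vecs X" for x t
    using that by (simp add: ab_def a_scale b_scale)
  have ab_diff: "ab (vdiff X x y) = ab x - ab y" if "x \<in> vecs X" "y \<in> vecs X" for x y
    using ab_add[of x "vscale X (- 1) y"] ab_scale[of y "-1"] that by (simp add: vdiff_def)
  \<comment> \<open>\<open>\<psi>\<close> vanishes where both seminorms do, so its real part descends to \<open>M\<close>.\<close>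
  have r: "r (ab x) = Re (\<psi> x)" if x: "x \<in> vecs X" for x
  proof -
    define y where "y = (SOME y. y \<in> vecs X \<and> ab y = ab x)"
    have "y \<in> vecs X \<and> ab y = ab x"
      unfolding y_def by (rule someI[of _ x]) (use x in simp)
    then have y: "y \<in> vecs X" "ab y = ab x" by auto
    then have "ab (vdiff X y x) = 0" using ab_diff x by simp
    then have "a (vdiff X y x) = 0" "b (vdiff X y x) = 0" by (simp_all add: ab_def zero_prod_def)
    then have "\<psi> (vdiff X y x) = 0" using bound[of "vdiff X y x"] y x by simp
    then have "\<psi> y = \<psi> x" using linear_functional_diff[OF \<psi> y(1) x] by simp
    then show ?thesis by (simp add: r_def y_def)
  qed
  have M: "subspace M"
  proof (rule subspaceI)
    obtain x where x: "x \<in> vecs X" using nonempty by blast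
    have "ab (vscale X (complex_of_real 0) x) = 0" using ab_scale[OF x, of 0] by simp
    then show "0 \<in> M" unfolding M_def using x by (metis imageI scale_closed)
    show "z + w \<in> M" if "z \<in> M" "w \<in> M" for z w
      using that unfolding M_def by (force simp: ab_add[symmetric])
    show "t *\<^sub>R z \<in> M" if "z \<in> M" for t z
      using that unfolding M_def by (force simp: ab_scale[symmetric])
  qed
  obtain R0 R1 C0 C1 where R: "linear R0" "linear R1" "0 \<le> C0" "0 \<le> C1" "C0 + C1 \<le> C"
    and R0: "\<And>v. \<bar>R0 v\<bar> \<le> C0 * norm v" and R1: "\<And>w. \<bar>R1 w\<bar> \<le> C1 * norm w"
    and sum: "\<And>v w. (v, w) \<in> M \<Longrightarrow> r (v, w) = R0 v + R1 w"
  proof (rule functional_on_sup_sum_splits[OF M, of r C])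
    show "r (z + w) = r z + r w" if "z \<in> M" "w \<in> M" for z w
      using that unfolding M_def
      by (auto simp: ab_add[symmetric] r linear_functional_add[OF \<psi>])
    show "r (t *\<^sub>R z) = t * r z" if "z \<in> M" for t z
      using that unfolding M_def
      by (auto simp: ab_scale[symmetric] r linear_functional_scale[OF \<psi>])
    show "\<bar>r (v, w)\<bar> \<le> C * max (norm v) (norm w)" if "(v, w) \<in> M" for v w
    proof -
      obtain x where x: "x \<in> vecs X" "ab x = (v, w)" using \<open>(v, w) \<in> M\<close> by (auto simp: M_def)
      then have "r (v, w) = Re (\<psi> x)" "v = a x" "w = b x" using r[OF x(1)] by (auto simp: ab_def)
      then show ?thesis using bound[OF x(1)] abs_Re_le_cmod[of "\<psi> x"] by simp
    qed
  qed (use C in auto)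
  have add: "R0 (a (vadd X x y)) = R0 (a x) + R0 (a y)" "R1 (b (vadd X x y)) = R1 (b x) + R1 (b y)"
    if "x \<in> vecs X" "y \<in> vecs X" for x y
    using that by (simp_all add: a_add b_add linear_add[OF R(1)] linear_add[OF R(2)])
  have scale: "R0 (a (vscale X (complex_of_real t) x)) = t * R0 (a x)"
    "R1 (b (vscale X (complex_of_real t) x)) = t * R1 (b x)" if "x \<in> vecs X" for t x
    using that by (simp_all add: a_scale b_scale linear_scale[OF R(1)] linear_scale[OF R(2)])
  show thesis
  proof (rule that)
    show "linear_functional X (complexify X (\<lambda>x. R0 (a x)))"
      "linear_functional X (complexify X (\<lambda>x. R1 (b x)))"
      by (rule linear_functional_complexify; simp add: add scale)+
    show "cmod (complexify X (\<lambda>x. R0 (a x)) x) \<le> C0 * norm (a x)" if "x \<in> vecs X" for x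
      using that R0 by (intro cmod_complexify_le add scale) (auto simp: a_norm)
    show "cmod (complexify X (\<lambda>x. R1 (b x)) x) \<le> C1 * norm (b x)" if "x \<in> vecs X" for x
      using that R1 by (intro cmod_complexify_le add scale) (auto simp: b_norm)
    show "\<psi> x = complexify X (\<lambda>x. R0 (a x)) x + complexify X (\<lambda>x. R1 (b x)) x"
      if x: "x \<in> vecs X" for x
    proof -
      have re: "Re (\<psi> y) = R0 (a y) + R1 (b y)" if "y \<in> vecs X" for y
        using r[OF that] sum[of "a y" "b y"] that by (auto simp: M_def ab_def)
      show ?thesis
        using re[OF x] re[of "vscale X \<i> x"] x
        by (simp add: complexify_def complex_eq_iff linear_functional_scale[OF \<psi>])
    qed
  qed (use R in auto)
qed

context null_subspace
begin

abbreviation (input) Q where "Q \<equiv> quotient_space X N"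

abbreviation (input) F where "F \<equiv> completion Q"

definition restrict_completion_functional where
  "restrict_completion_functional \<Lambda> =
    (\<lambda>x\<in>vecs X. \<Lambda> (completion_embed Q (coset x)))"

lemma restrict_completion_functional:
  assumes \<Lambda>: "\<Lambda> \<in> vecs (dual_space F)"
  shows "linear_functional X (restrict_completion_functional \<Lambda>)"
    and "x \<in> vecs X \<Longrightarrow> cmod (restrict_completion_functional \<Lambda> x)
      \<le> vnorm (dual_space F) \<Lambda> * vnorm X x"
proof -
  interpret Q: cseminormed_space Q by (rule cseminormed_space_quotient)
  interpret F: cseminormed_space F
    by (rule Q.cseminormed_space_completion)
  have co: "coset x \<in> vecs Q" if "x \<in> vecs X" for x
    using that by (simp add: vecs_quotient)
  have lin: "linear_functional F \<Lambda>"
    using \<Lambda> by (simp add: in_dual_space_iff)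
  show "linear_functional X (restrict_completion_functional \<Lambda>)"
    unfolding linear_functional_def
  proof (intro conjI ballI allI)
    fix x y c assume x: "x \<in> vecs X" and y: "y \<in> vecs X"
    show "restrict_completion_functional \<Lambda> (vadd X x y)
        = restrict_completion_functional \<Lambda> x + restrict_completion_functional \<Lambda> y"
      using x y co by (simp add: restrict_completion_functional_def quotient_add[symmetric] Q.embed_add
          linear_functional_add[OF lin] Q.embed_in)
  next
    fix x c assume x: "x \<in> vecs X"
    show "restrict_completion_functional \<Lambda> (vscale X c x) = c * restrict_completion_functional \<Lambda> x"
      using x co by (simp add: restrict_completion_functional_def quotient_scale[symmetric] Q.embed_scale
          linear_functional_scale[OF lin] Q.embed_in)
  qed
  show "cmod (restrict_completion_functional \<Lambda> x)
      \<le> vnorm (dual_space F) \<Lambda> * vnorm X x" if x: "x \<in> vecs X"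
    using F.dual_norm_bound[OF \<Lambda> Q.embed_in[OF co[OF x]]] x
    by (simp add: restrict_completion_functional_def Q.embed_norm co quotient_norm)
qed

text \<open>
  Together with the next two lemmas: restriction identifies the dual of the completed quotient,
  isometrically, with the linear functionals on \<open>X\<close> that are bounded for its seminorm.
\<close>

lemma inj_on_restrict_completion_functional:
  "inj_on restrict_completion_functional (vecs (dual_space F))"
proof (rule inj_onI)
  interpret Q: cseminormed_space Q by (rule cseminormed_space_quotient)
  fix \<Lambda> \<Lambda>'
  assume \<Lambda>: "\<Lambda> \<in> vecs (dual_space F)"
    "\<Lambda>' \<in> vecs (dual_space F)"
    and eq: "restrict_completion_functional \<Lambda> = restrict_completion_functional \<Lambda>'"
  show "\<Lambda> = \<Lambda>'"
  proof (rule Q.completion_dual_eqI[OF \<Lambda>])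
    fix A assume "A \<in> vecs Q"
    then obtain x where x: "x \<in> vecs X" "A = coset x" by (auto simp: vecs_quotient)
    show "\<Lambda> (completion_embed Q A) = \<Lambda>' (completion_embed Q A)"
      using fun_cong[OF eq, of x] x by (simp add: restrict_completion_functional_def)
  qed
qed

lemma dual_norm_restrict_least:
  assumes \<Lambda>: "\<Lambda> \<in> vecs (dual_space F)" and C: "0 \<le> C"
    and bound: "\<And>x. x \<in> vecs X \<Longrightarrow> cmod (restrict_completion_functional \<Lambda> x) \<le> C * vnorm X x"
  shows "vnorm (dual_space F) \<Lambda> \<le> C"
proof -
  interpret Q: cseminormed_space Q by (rule cseminormed_space_quotient)
  show ?thesis
  proof (rule Q.completion_dual_norm_least[OF \<Lambda> C])
    fix A assume "A \<in> vecs Q"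
    then obtain x where x: "x \<in> vecs X" "A = coset x" by (auto simp: vecs_quotient)
    show "cmod (\<Lambda> (completion_embed Q A)) \<le> C * vnorm Q A"
      using bound[OF x(1)] x by (simp add: restrict_completion_functional_def quotient_norm)
  qed
qed

lemma extend_to_completion:
  assumes lin: "linear_functional X \<psi>" and ext: "\<psi> \<in> extensional (vecs X)"
    and bound: "\<And>x. x \<in> vecs X \<Longrightarrow> cmod (\<psi> x) \<le> C * vnorm X x"
  obtains \<Lambda> where "\<Lambda> \<in> vecs (dual_space F)"
    "restrict_completion_functional \<Lambda> = \<psi>"
proof -
  interpret Q: cseminormed_space Q by (rule cseminormed_space_quotient)
  have \<psi>_rep: "\<psi> (rep (coset x)) = \<psi> x" if x: "x \<in> vecs X" for x
  proof -
    have "cmod (\<psi> (vdiff X (rep (coset x)) x)) \<le> 0"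
      using bound[of "vdiff X (rep (coset x)) x"] null[OF rep_coset_diff[OF x]] rep_coset_in[OF x] x by simp
    then show ?thesis
      using linear_functional_diff[OF lin rep_coset_in[OF x] x] by simp
  qed
  have "linear_functional Q (\<lambda>A. \<psi> (rep A))"
    unfolding linear_functional_def vecs_quotient
    by (auto simp del: Image_singleton_iff simp add: quotient_add quotient_scale \<psi>_rep
        linear_functional_add[OF lin] linear_functional_scale[OF lin])
  moreover have "cmod (\<psi> (rep A)) \<le> C * vnorm Q A"
    if "A \<in> vecs Q" for A
    using that bound by (auto simp: vecs_quotient \<psi>_rep quotient_norm)
  ultimately obtain \<Lambda> where \<Lambda>: "\<Lambda> \<in> vecs (dual_space F)"
    "\<And>A. A \<in> vecs Q \<Longrightarrow>
      \<Lambda> (completion_embed Q A) = \<psi> (rep A)"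
    using Q.completion_dual_extend by blast
  have "restrict_completion_functional \<Lambda> = \<psi>"
  proof (rule extensionalityI[OF _ ext])
    show "restrict_completion_functional \<Lambda> \<in> extensional (vecs X)"
      by (simp add: restrict_completion_functional_def)
    fix x assume "x \<in> vecs X"
    then show "restrict_completion_functional \<Lambda> x = \<psi> x"
      using \<Lambda>(2) \<psi>_rep by (simp add: restrict_completion_functional_def vecs_quotient)
  qed
  with \<Lambda>(1) show thesis by (rule that)
qed

end

section \<open>Symmetrized pseudofunctions\<close>

definition max_seminorm where
  "max_seminorm \<mu> \<pi> f = max (onorm (integrated_form \<mu> \<pi> f)) (onorm (integrated_form \<mu> (dual_rep \<pi>) f))"

abbreviation L1_max where
  "L1_max \<mu> \<pi> \<equiv> (L1 \<mu>)\<lparr>vnorm := max_seminorm \<mu> \<pi>\<rparr>"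

abbreviation joint_kernel where
  "joint_kernel \<mu> \<pi> \<equiv> rep_kernel \<mu> \<pi> \<inter> rep_kernel \<mu> (dual_rep \<pi>)"

lemma linear_functional_L1_max: "linear_functional (L1_max \<mu> \<pi>) \<psi> \<longleftrightarrow> linear_functional (L1 \<mu>) \<psi>"
  by (simp add: linear_functional_def)

lemma null_subspace_L1_max:
  assumes "weak_rep \<mu> \<pi>" "weak_rep \<mu> (dual_rep \<pi>)"
  shows "null_subspace (L1_max \<mu> \<pi>) (joint_kernel \<mu> \<pi>)"
proof -
  interpret P: weak_rep \<mu> \<pi> by fact
  interpret P': weak_rep \<mu> "dual_rep \<pi>" by fact
  interpret L: cvector_space "L1 \<mu>" by (rule cvector_space_L1)
  have ker: "f \<in> joint_kernel \<mu> \<pi> \<longleftrightarrow> integrable \<mu> f \<and> max_seminorm \<mu> \<pi> f = 0" for f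
    using P.operator_norm_eq_0_iff[of f] P'.operator_norm_eq_0_iff[of f]
      onorm_pos_le[OF P.bounded_linear_integrated_form, of f]
      onorm_pos_le[OF P'.bounded_linear_integrated_form, of f]
    by (auto simp: rep_kernel_def max_seminorm_def max_def)
  have vs: "cvector_space (L1_max \<mu> \<pi>)"
    using L.nonempty by unfold_locales (auto simp: algebra_simps)
  interpret X: cseminormed_space "L1_max \<mu> \<pi>"
  proof (intro cseminormed_space.intro vs cseminormed_space_axioms.intro)
    fix f g assume "f \<in> vecs (L1_max \<mu> \<pi>)" "g \<in> vecs (L1_max \<mu> \<pi>)"
    then have "integrable \<mu> f" "integrable \<mu> g" by simp_all
    from P.operator_norm_triangle[OF this] P'.operator_norm_triangle[OF this]
    show "vnorm (L1_max \<mu> \<pi>) (vadd (L1_max \<mu> \<pi>) f g) \<le> vnorm (L1_max \<mu> \<pi>) f + vnorm (L1_max \<mu> \<pi>) g"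
      by (auto simp: max_seminorm_def)
  next
    fix f c assume "f \<in> vecs (L1_max \<mu> \<pi>)"
    then show "vnorm (L1_max \<mu> \<pi>) (vscale (L1_max \<mu> \<pi>) c f) = cmod c * vnorm (L1_max \<mu> \<pi>) f"
      by (simp add: max_seminorm_def P.operator_norm_scale P'.operator_norm_scale max_mult_distrib_left)
  qed
  show ?thesis
  proof (intro null_subspace.intro csubspace.intro csubspace_axioms.intro null_subspace_axioms.intro
      X.cseminormed_space_axioms vs)
    show "joint_kernel \<mu> \<pi> \<subseteq> vecs (L1_max \<mu> \<pi>)" using ker by fastforce
    obtain f where f: "f \<in> vecs (L1_max \<mu> \<pi>)" using X.nonempty by blast
    then have "vscale (L1_max \<mu> \<pi>) 0 f \<in> joint_kernel \<mu> \<pi>"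
      unfolding ker using X.norm_scale[OF f, of 0] by simp
    then show "joint_kernel \<mu> \<pi> \<noteq> {}" by blast
    fix f assume f: "f \<in> joint_kernel \<mu> \<pi>"
    then have fX: "f \<in> vecs (L1_max \<mu> \<pi>)" "vnorm (L1_max \<mu> \<pi>) f = 0" unfolding ker by simp_all
    show "vnorm (L1_max \<mu> \<pi>) f = 0" by (rule fX)
    show "vscale (L1_max \<mu> \<pi>) c f \<in> joint_kernel \<mu> \<pi>" for c
      unfolding ker using X.norm_scale[OF fX(1), of c] X.scale_closed[OF fX(1), of c] fX by simp
    fix g assume "g \<in> joint_kernel \<mu> \<pi>"
    then have gX: "g \<in> vecs (L1_max \<mu> \<pi>)" "vnorm (L1_max \<mu> \<pi>) g = 0" unfolding ker by simp_all
    show "vadd (L1_max \<mu> \<pi>) f g \<in> joint_kernel \<mu> \<pi>"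
      unfolding ker
      using X.norm_triangle[OF fX(1) gX(1)] X.norm_nonneg[OF X.add_closed[OF fX(1) gX(1)]]
        X.add_closed[OF fX(1) gX(1)] fX gX by simp
  qed
qed

text \<open>
  The bounds in \<open>FS_bounds\<close> are strictly positive, so a functional with bound 0 only has bounds \<open>e > 0\<close>;
  the slack \<open>e\<close> disappears in the infimum.
\<close>

lemma FS_boundsI:
  assumes "0 \<le> C" "0 < e"
    and "\<And>f. integrable \<mu> f \<Longrightarrow> cmod (Linf_functional \<mu> \<Phi> f) \<le> C * onorm (integrated_form \<mu> \<pi> f)"
    and nonneg: "\<And>f. integrable \<mu> f \<Longrightarrow> 0 \<le> onorm (integrated_form \<mu> \<pi> f)"
  shows "C + e \<in> FS_bounds \<mu> \<pi> \<Phi>"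
  unfolding FS_bounds_def
proof (intro CollectI conjI ballI)
  show "0 < C + e" using assms by simp
  fix f assume "f \<in> vecs (L1 \<mu>)"
  then have f: "integrable \<mu> f" by simp
  have "0 \<le> e * onorm (integrated_form \<mu> \<pi> f)" using nonneg[OF f] assms(2) by simp
  then show "cmod (Linf_functional \<mu> \<Phi> f) \<le> (C + e) * onorm (integrated_form \<mu> \<pi> f)"
    using assms(3)[OF f] by (simp add: distrib_right)
qed

lemma Inf_FS_bounds_le:
  assumes "C \<in> FS_bounds \<mu> \<pi> \<Phi>" shows "Inf (FS_bounds \<mu> \<pi> \<Phi>) \<le> C"
  using assms by (intro cInf_lower bdd_belowI[where m = 0]) (auto simp: FS_bounds_def)

lemma Inf_FS_bounds_nonneg:
  assumes "FS_bounds \<mu> \<pi> \<Phi> \<noteq> {}" shows "0 \<le> Inf (FS_bounds \<mu> \<pi> \<Phi>)"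
  using assms by (intro cInf_greatest) (auto simp: FS_bounds_def)

theorem theorem3:
  fixes \<mu> :: "'g::{t2_space, topological_group_add} measure"
    and \<pi> :: "'g \<Rightarrow> 'e::cbanach \<Rightarrow> 'e"
  assumes "locally_compact_space (euclidean :: 'g topology)"
    and "left_haar_measure \<mu>"
    and "isometric_rep \<pi>"
    and "reflexive_space TYPE('e)"
  shows "inj_on (restrict_to_L1 \<mu> \<pi>) (vecs (dual_space (sym_pseudofunctions \<mu> \<pi>))) \<and>
    isometric_isomorphism (FS_sum_space \<mu> \<pi>) (pseudofunction_dual \<mu> \<pi>) (Linf_functional \<mu>)"
proof -
  have sets: "sets \<mu> = sets borel" using assms(2) by (simp add: left_haar_measure_def)
  have reps: "weak_rep \<mu> \<pi>" "weak_rep \<mu> (dual_rep \<pi>)"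
    using weak_rep_isometric[OF sets assms(3,4)] weak_rep_dual[OF sets assms(3,4)] by auto
  interpret P: weak_rep \<mu> \<pi> by (rule reps)
  interpret P': weak_rep \<mu> "dual_rep \<pi>" by (rule reps)
  interpret X: null_subspace "L1_max \<mu> \<pi>" "joint_kernel \<mu> \<pi>"
    by (rule null_subspace_L1_max[OF reps])
  interpret L: cvector_space "L1 \<mu>" by (rule cvector_space_L1)
  interpret LI: cvector_space "Linf \<mu>" by (rule cvector_space_Linf)
  obtain \<D> where \<D>: "decomposition \<mu> \<D>" using haar_decomposition[OF assms(1,2)] by blast
  let ?D = "dual_space (sym_pseudofunctions \<mu> \<pi>)" and ?R = "restrict_to_L1 \<mu> \<pi>"
  let ?FB = "FS_bounds \<mu> \<pi>" and ?FB' = "FS_bounds \<mu> (dual_rep \<pi>)"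
  let ?Y = "vecs (FS_space \<mu> \<pi>)" and ?Y' = "vecs (FS_space \<mu> (dual_rep \<pi>))"
  let ?FS = "FS_sum_space \<mu> \<pi>"
  let ?T = "Linf_functional \<mu>" and ?pd = "pseudofunction_dual \<mu> \<pi>"
  define P0 where "P0 f = onorm (integrated_form \<mu> \<pi> f)" for f
  define P1 where "P1 f = onorm (integrated_form \<mu> (dual_rep \<pi>) f)" for f
  have P_nonneg: "0 \<le> P0 f" "0 \<le> P1 f" if "integrable \<mu> f" for f
    using that onorm_pos_le P.bounded_linear_integrated_form P'.bounded_linear_integrated_form
    by (auto simp: P0_def P1_def)
  have max_eq: "(\<lambda>f. max (onorm (integrated_form \<mu> \<pi> f)) (onorm (integrated_form \<mu> (dual_rep \<pi>) f)))
      = max_seminorm \<mu> \<pi>"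
    by (simp add: max_seminorm_def[abs_def])
  have D_eq: "?D = dual_space (completion (quotient_space (L1_max \<mu> \<pi>) (joint_kernel \<mu> \<pi>)))"
    by (simp add: sym_pseudofunctions_def pre_pseudofunctions_def max_eq)
  have coset_eq: "coset_rel (L1 \<mu>) N = coset_rel (L1_max \<mu> \<pi>) N" for N
    by (simp add: coset_rel_def vdiff_def)
  have R_eq: "?R = X.restrict_completion_functional"
    by (intro ext) (simp add: restrict_to_L1_def X.restrict_completion_functional_def
        L1_to_pseudofunctions_def pre_pseudofunctions_def max_eq coset_eq)
  have inj_R: "inj_on ?R (vecs ?D)"
    unfolding D_eq R_eq by (rule X.inj_on_restrict_completion_functional)

  have R_lin: "linear_functional (L1 \<mu>) (?R \<Lambda>)" if "\<Lambda> \<in> vecs ?D" for \<Lambda>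
    using X.restrict_completion_functional(1)[OF that[unfolded D_eq]]
    by (simp add: R_eq linear_functional_L1_max)
  have R_bound: "cmod (?R \<Lambda> f) \<le> vnorm ?D \<Lambda> * max (P0 f) (P1 f)"
    if "\<Lambda> \<in> vecs ?D" "integrable \<mu> f" for \<Lambda> f
    using X.restrict_completion_functional(2)[OF that(1)[unfolded D_eq], of f] that(2)
    by (simp add: R_eq D_eq[symmetric] max_seminorm_def P0_def P1_def)
  have R_norm_le: "vnorm ?D \<Lambda> \<le> C"
    if "\<Lambda> \<in> vecs ?D" "0 \<le> C" "\<And>f. integrable \<mu> f \<Longrightarrow> cmod (?R \<Lambda> f) \<le> C * max (P0 f) (P1 f)" for \<Lambda> C
    using X.dual_norm_restrict_least[OF that(1)[unfolded D_eq] that(2)] that(3)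
    by (simp add: R_eq D_eq[symmetric] max_seminorm_def P0_def P1_def)
  have R_norm_nonneg: "0 \<le> vnorm ?D \<Lambda>" if "\<Lambda> \<in> vecs ?D" for \<Lambda>
    using cseminormed_space.dual_norm_nonneg[OF cseminormed_space.cseminormed_space_completion[OF
        X.cseminormed_space_quotient] that[unfolded D_eq]]
    by (simp add: D_eq)
  have R_surj: "\<exists>\<Lambda>\<in>vecs ?D. ?R \<Lambda> = \<psi>"
    if "linear_functional (L1 \<mu>) \<psi>" "\<psi> \<in> extensional (vecs (L1 \<mu>))"
      "\<And>f. integrable \<mu> f \<Longrightarrow> cmod (\<psi> f) \<le> C * max (P0 f) (P1 f)" for \<psi> C
  proof -
    have "linear_functional (L1_max \<mu> \<pi>) \<psi>" "\<psi> \<in> extensional (vecs (L1_max \<mu> \<pi>))"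
      "\<And>f. f \<in> vecs (L1_max \<mu> \<pi>) \<Longrightarrow> cmod (\<psi> f) \<le> C * vnorm (L1_max \<mu> \<pi>) f"
      using that by (simp_all add: linear_functional_L1_max max_seminorm_def P0_def P1_def)
    from X.extend_to_completion[OF this] show ?thesis unfolding D_eq R_eq by blast
  qed

  have pd_vecs: "vecs ?pd = ?R ` vecs ?D" and pd_add: "vadd ?pd = vadd (dual_space (L1 \<mu>))"
    and pd_scale: "vscale ?pd = vscale (dual_space (L1 \<mu>))"
    by (simp_all add: pseudofunction_dual_def Let_def)
  have pd_norm: "vnorm ?pd (?R \<Lambda>) = vnorm ?D \<Lambda>" if "\<Lambda> \<in> vecs ?D" for \<Lambda>
    using that inj_R by (simp add: pseudofunction_dual_def Let_def)

  have T_add: "?T (vadd (Linf \<mu>) \<Phi> \<Psi>) f = ?T \<Phi> f + ?T \<Psi> f"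
    if "\<Phi> \<in> vecs (Linf \<mu>)" "\<Psi> \<in> vecs (Linf \<mu>)" "integrable \<mu> f" for \<Phi> \<Psi> f
    using that by (simp add: Linf_functional_add) (simp add: dual_space_def)
  have T_ext: "?T \<Phi> \<in> extensional (vecs (L1 \<mu>))" for \<Phi> by (simp add: Linf_functional_def)

  have FS_in: "\<Phi> \<in> vecs (FS_space \<mu> \<sigma>) \<longleftrightarrow> \<Phi> \<in> vecs (Linf \<mu>) \<and> FS_bounds \<mu> \<sigma> \<Phi> \<noteq> {}"
    and FS_norm: "vnorm (FS_space \<mu> \<sigma>) \<Phi> = Inf (FS_bounds \<mu> \<sigma> \<Phi>)"
    for \<Phi> and \<sigma> :: "'g \<Rightarrow> 'x::complex_normed_vector \<Rightarrow> 'x"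
    by (simp_all add: FS_space_def)
  have sum_vecs: "vecs ?FS = {vadd (Linf \<mu>) \<Phi>0 \<Phi>1 |\<Phi>0 \<Phi>1.
      \<Phi>0 \<in> ?Y \<and> \<Phi>1 \<in> ?Y'}"
    and sum_add: "vadd ?FS = vadd (Linf \<mu>)"
    and sum_scale: "vscale ?FS = vscale (Linf \<mu>)"
    and sum_norm: "vnorm ?FS \<Phi> = Inf {Inf (?FB \<Phi>0)
      + Inf (?FB' \<Phi>1) |\<Phi>0 \<Phi>1. \<Phi>0 \<in> ?Y \<and>
        \<Phi>1 \<in> ?Y' \<and> \<Phi> = vadd (Linf \<mu>) \<Phi>0 \<Phi>1}" for \<Phi>
    by (simp_all add: FS_sum_space_def sum_space_def FS_norm)
  have sum_Linf: "vecs ?FS \<subseteq> vecs (Linf \<mu>)"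
    by (auto simp: sum_vecs FS_in)

  \<comment> \<open>Bounds for the summands add up to a bound for the maximum of the two norms.\<close>
  have easy: "\<exists>\<Lambda>\<in>vecs ?D. ?R \<Lambda> = ?T (vadd (Linf \<mu>) \<Phi>0 \<Phi>1) \<and>
      vnorm ?D \<Lambda> \<le> Inf (?FB \<Phi>0) + Inf (?FB' \<Phi>1)"
    if \<Phi>: "\<Phi>0 \<in> ?Y" "\<Phi>1 \<in> ?Y'" for \<Phi>0 \<Phi>1
  proof -
    let ?\<Phi> = "vadd (Linf \<mu>) \<Phi>0 \<Phi>1"
    let ?B0 = "?FB \<Phi>0" and ?B1 = "?FB' \<Phi>1"
    have Linf: "\<Phi>0 \<in> vecs (Linf \<mu>)" "\<Phi>1 \<in> vecs (Linf \<mu>)" and ne: "?B0 \<noteq> {}" "?B1 \<noteq> {}"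
      using \<Phi> by (auto simp: FS_in)
    have bound: "cmod (?T ?\<Phi> f) \<le> (C0 + C1) * max (P0 f) (P1 f)"
      if C: "C0 \<in> ?B0" "C1 \<in> ?B1" and f: "integrable \<mu> f" for C0 C1 f
    proof -
      have "cmod (?T ?\<Phi> f) \<le> cmod (?T \<Phi>0 f) + cmod (?T \<Phi>1 f)"
        using T_add[OF Linf f] norm_triangle_ineq by simp
      also have "\<dots> \<le> C0 * P0 f + C1 * P1 f"
        using C f by (intro add_mono) (auto simp: FS_bounds_def P0_def P1_def)
      also have "\<dots> \<le> C0 * max (P0 f) (P1 f) + C1 * max (P0 f) (P1 f)"
        using C by (intro add_mono mult_left_mono) (auto simp: FS_bounds_def)
      finally show ?thesis by (simp add: distrib_right)
    qed
    have "linear_functional (L1 \<mu>) (?T ?\<Phi>)"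
      using Linf_functional_in_dual[OF LI.add_closed[OF Linf]] by (simp add: in_dual_space_iff)
    moreover obtain C0 C1 where "C0 \<in> ?B0" "C1 \<in> ?B1" using ne by blast
    ultimately obtain \<Lambda> where \<Lambda>: "\<Lambda> \<in> vecs ?D" "?R \<Lambda> = ?T ?\<Phi>"
      using R_surj[OF _ T_ext bound] by blast
    have le: "vnorm ?D \<Lambda> \<le> C0 + C1" if "C0 \<in> ?B0" "C1 \<in> ?B1" for C0 C1
      using that bound[OF that] by (intro R_norm_le \<Lambda>) (auto simp: \<Lambda>(2) FS_bounds_def)
    have "vnorm ?D \<Lambda> - C1 \<le> Inf ?B0" if "C1 \<in> ?B1" for C1
      using le[OF _ that] by (intro cInf_greatest ne) (simp add: algebra_simps)
    then have "vnorm ?D \<Lambda> - Inf ?B0 \<le> Inf ?B1"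
      by (intro cInf_greatest ne) (simp add: algebra_simps)
    then show ?thesis using \<Lambda> by (intro bexI[of _ \<Lambda>]) auto
  qed

  \<comment> \<open>Hahn--Banach splits a functional on the diagonal \<open>{(\<pi>(f), \<pi>'(f))}\<close>, and the summands are
    represented by functions because both operator norms are at most the \<open>L\<^sup>1\<close> norm.\<close>
  have split: "\<exists>\<Phi>0\<in>?Y. \<exists>\<Phi>1\<in>?Y'.
      ?R \<Lambda> = ?T (vadd (Linf \<mu>) \<Phi>0 \<Phi>1) \<and>
      Inf (?FB \<Phi>0) + Inf (?FB' \<Phi>1) \<le> vnorm ?D \<Lambda>"
    if \<Lambda>: "\<Lambda> \<in> vecs ?D" for \<Lambda>
  proof -
    define a where "a f = Blinfun (integrated_form \<mu> \<pi> f)" for f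
    define b where "b f = Blinfun (integrated_form \<mu> (dual_rep \<pi>) f)" for f
    have a: "blinfun_apply (a f) = integrated_form \<mu> \<pi> f" if "integrable \<mu> f" for f
      unfolding a_def using that by (intro bounded_linear_Blinfun_apply P.bounded_linear_integrated_form)
    have b: "blinfun_apply (b f) = integrated_form \<mu> (dual_rep \<pi>) f" if "integrable \<mu> f" for f
      unfolding b_def using that by (intro bounded_linear_Blinfun_apply P'.bounded_linear_integrated_form)
    have na: "norm (a f) = P0 f" and nb: "norm (b f) = P1 f" if "integrable \<mu> f" for f
      using that by (simp_all add: norm_blinfun.rep_eq a b P0_def P1_def)
    obtain \<psi>0 \<psi>1 C0 C1 where lin: "linear_functional (L1 \<mu>) \<psi>0" "linear_functional (L1 \<mu>) \<psi>1"
      and b0: "\<And>f. f \<in> vecs (L1 \<mu>) \<Longrightarrow> cmod (\<psi>0 f) \<le> C0 * norm (a f)"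
      and b1: "\<And>f. f \<in> vecs (L1 \<mu>) \<Longrightarrow> cmod (\<psi>1 f) \<le> C1 * norm (b f)"
      and sum: "\<And>f. f \<in> vecs (L1 \<mu>) \<Longrightarrow> ?R \<Lambda> f = \<psi>0 f + \<psi>1 f"
      and C: "0 \<le> C0" "0 \<le> C1" "C0 + C1 \<le> vnorm ?D \<Lambda>"
    proof (rule functional_below_maximum_splits[OF cvector_space_L1, of \<mu> a b "?R \<Lambda>" "vnorm ?D \<Lambda>"])
      show "a (vadd (L1 \<mu>) f g) = a f + a g" "b (vadd (L1 \<mu>) f g) = b f + b g"
        if "f \<in> vecs (L1 \<mu>)" "g \<in> vecs (L1 \<mu>)" for f g
        using that
        by (auto intro!: blinfun_eqI simp: a b plus_blinfun.rep_eq P.integrated_form_add P'.integrated_form_add)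
      show "a (vscale (L1 \<mu>) (complex_of_real t) f) = t *\<^sub>R a f"
        "b (vscale (L1 \<mu>) (complex_of_real t) f) = t *\<^sub>R b f" if "f \<in> vecs (L1 \<mu>)" for t f
        using that
        by (auto intro!: blinfun_eqI simp: a b scaleR_blinfun.rep_eq P.integrated_form_scale
            P'.integrated_form_scale scaleR_scaleC)
      show "norm (a (vscale (L1 \<mu>) c f)) = cmod c * norm (a f)"
        "norm (b (vscale (L1 \<mu>) c f)) = cmod c * norm (b f)" if "f \<in> vecs (L1 \<mu>)" for c f
        using that by (simp_all add: na nb P0_def P1_def P.operator_norm_scale P'.operator_norm_scale)
      show "cmod (?R \<Lambda> f) \<le> vnorm ?D \<Lambda> * max (norm (a f)) (norm (b f))" if "f \<in> vecs (L1 \<mu>)" for f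
        using R_bound[OF \<Lambda>, of f] that by (simp add: na nb)
    qed (use R_lin[OF \<Lambda>] R_norm_nonneg[OF \<Lambda>] in auto)
    have represent: "\<exists>\<Phi>\<in>vecs (Linf \<mu>). \<forall>f. integrable \<mu> f \<longrightarrow> ?T \<Phi> f = \<psi> f"
      if \<psi>: "linear_functional (L1 \<mu>) \<psi>" "\<And>f. integrable \<mu> f \<Longrightarrow> cmod (\<psi> f) \<le> K * p f" "0 \<le> K"
        "\<And>f. integrable \<mu> f \<Longrightarrow> p f \<le> (\<integral>x. cmod (f x) \<partial>\<mu>)" for \<psi> K p
    proof -
      have "cmod (\<psi> f) \<le> K * (\<integral>x. cmod (f x) \<partial>\<mu>)" if "integrable \<mu> f" for f
        using \<psi>(2)[OF that] mult_left_mono[OF \<psi>(4)[OF that] \<psi>(3)] by linarith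
      then have "restrict \<psi> (vecs (L1 \<mu>)) \<in> vecs (dual_space (L1 \<mu>))"
        using \<psi>(1) by (auto simp: in_dual_space_iff linear_functional_def intro!: exI[of _ K])
      from Linf_functional_surj[OF \<D> this] obtain \<Phi>
        where "\<Phi> \<in> vecs (Linf \<mu>)" "?T \<Phi> = restrict \<psi> (vecs (L1 \<mu>))" by blast
      then show ?thesis by (intro bexI[of _ \<Phi>]) auto
    qed
    obtain \<Phi>0 where \<Phi>0: "\<Phi>0 \<in> vecs (Linf \<mu>)" "\<And>f. integrable \<mu> f \<Longrightarrow> ?T \<Phi>0 f = \<psi>0 f"
      using represent[OF lin(1), of C0 P0] b0 C P.operator_norm_le by (auto simp: na P0_def)
    obtain \<Phi>1 where \<Phi>1: "\<Phi>1 \<in> vecs (Linf \<mu>)" "\<And>f. integrable \<mu> f \<Longrightarrow> ?T \<Phi>1 f = \<psi>1 f"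
      using represent[OF lin(2), of C1 P1] b1 C P'.operator_norm_le by (auto simp: nb P1_def)
    have B0: "C0 + e \<in> ?FB \<Phi>0" if "0 < e" for e
      using b0 P_nonneg by (intro FS_boundsI C that) (auto simp: \<Phi>0(2) na P0_def)
    have B1: "C1 + e \<in> ?FB' \<Phi>1" if "0 < e" for e
      using b1 P_nonneg by (intro FS_boundsI C that) (auto simp: \<Phi>1(2) nb P1_def)
    have "Inf (?FB \<Phi>0) \<le> C0"
      by (rule field_le_epsilon) (rule Inf_FS_bounds_le[OF B0])
    moreover have "Inf (?FB' \<Phi>1) \<le> C1"
      by (rule field_le_epsilon) (rule Inf_FS_bounds_le[OF B1])
    moreover have "?R \<Lambda> = ?T (vadd (Linf \<mu>) \<Phi>0 \<Phi>1)"
    proof (rule extensionalityI)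
      show "?R \<Lambda> \<in> extensional (vecs (L1 \<mu>))" by (simp add: restrict_to_L1_def)
      show "?T (vadd (Linf \<mu>) \<Phi>0 \<Phi>1) \<in> extensional (vecs (L1 \<mu>))" by (rule T_ext)
      show "?R \<Lambda> f = ?T (vadd (Linf \<mu>) \<Phi>0 \<Phi>1) f" if "f \<in> vecs (L1 \<mu>)" for f
        using that sum[OF that] by (simp add: T_add \<Phi>0 \<Phi>1)
    qed
    moreover have "\<Phi>0 \<in> ?Y" "\<Phi>1 \<in> ?Y'"
      using \<Phi>0(1) \<Phi>1(1) B0[of 1] B1[of 1] by (auto simp: FS_in)
    ultimately show ?thesis using C(3) by (intro bexI[of _ \<Phi>0] bexI[of _ \<Phi>1]) auto
  qed

  have norm_eq: "vnorm ?pd (?T \<Phi>) = vnorm ?FS \<Phi>"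
    and T_in: "?T \<Phi> \<in> vecs ?pd" if \<Phi>: "\<Phi> \<in> vecs ?FS" for \<Phi>
  proof -
    let ?S = "{Inf (?FB \<Phi>0) + Inf (?FB' \<Phi>1) |\<Phi>0 \<Phi>1.
      \<Phi>0 \<in> ?Y \<and> \<Phi>1 \<in> ?Y' \<and> \<Phi> = vadd (Linf \<mu>) \<Phi>0 \<Phi>1}"
    have ne: "?S \<noteq> {}" using \<Phi> by (auto simp: sum_vecs)
    obtain \<Lambda> where \<Lambda>: "\<Lambda> \<in> vecs ?D" "?R \<Lambda> = ?T \<Phi>"
      using \<Phi> easy by (force simp: sum_vecs)
    show "?T \<Phi> \<in> vecs ?pd"
      using \<Lambda>(1) unfolding pd_vecs \<Lambda>(2)[symmetric] by (rule imageI)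
    have "vnorm ?D \<Lambda> \<le> Inf ?S"
    proof (rule cInf_greatest[OF ne])
      fix s assume "s \<in> ?S"
      then obtain \<Phi>0 \<Phi>1 where s: "s = Inf (?FB \<Phi>0) + Inf (?FB' \<Phi>1)"
        "\<Phi>0 \<in> ?Y" "\<Phi>1 \<in> ?Y'" "\<Phi> = vadd (Linf \<mu>) \<Phi>0 \<Phi>1"
        by blast
      obtain \<Lambda>' where "\<Lambda>' \<in> vecs ?D" "?R \<Lambda>' = ?T \<Phi>" "vnorm ?D \<Lambda>' \<le> s"
        using easy[OF s(2,3)] s(1,4) by auto
      moreover from this have "\<Lambda>' = \<Lambda>"
        using \<Lambda> by (intro inj_onD[OF inj_R]) simp_all
      ultimately show "vnorm ?D \<Lambda> \<le> s" by simp
    qed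
    moreover have "Inf ?S \<le> vnorm ?D \<Lambda>"
    proof -
      obtain \<Phi>0 \<Phi>1 where s: "\<Phi>0 \<in> ?Y" "\<Phi>1 \<in> ?Y'"
        "?R \<Lambda> = ?T (vadd (Linf \<mu>) \<Phi>0 \<Phi>1)"
        "Inf (?FB \<Phi>0) + Inf (?FB' \<Phi>1) \<le> vnorm ?D \<Lambda>"
        using split[OF \<Lambda>(1)] by blast
      have "\<Phi> = vadd (Linf \<mu>) \<Phi>0 \<Phi>1"
        using s \<Lambda>(2) sum_Linf \<Phi> by (intro inj_onD[OF inj_on_Linf_functional]) (auto simp: FS_in)
      then have "Inf (?FB \<Phi>0) + Inf (?FB' \<Phi>1) \<in> ?S"
        using s by blast
      moreover have "bdd_below ?S"
        by (rule bdd_belowI[where m = 0]) (auto simp: FS_in intro!: add_nonneg_nonneg Inf_FS_bounds_nonneg)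
      ultimately have "Inf ?S \<le> Inf (?FB \<Phi>0) + Inf (?FB' \<Phi>1)"
        by (rule cInf_lower)
      then show ?thesis using s(4) by linarith
    qed
    ultimately show "vnorm ?pd (?T \<Phi>) = vnorm ?FS \<Phi>"
      using pd_norm[OF \<Lambda>(1)] by (simp add: sum_norm \<Lambda>(2))
  qed
  have T_surj: "\<psi> \<in> ?T ` vecs ?FS" if \<psi>: "\<psi> \<in> vecs ?pd" for \<psi>
  proof -
    obtain \<Lambda> where \<Lambda>: "\<Lambda> \<in> vecs ?D" "\<psi> = ?R \<Lambda>" using \<psi> unfolding pd_vecs by blast
    obtain \<Phi>0 \<Phi>1 where "\<Phi>0 \<in> ?Y" "\<Phi>1 \<in> ?Y'"
      "\<psi> = ?T (vadd (Linf \<mu>) \<Phi>0 \<Phi>1)"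
      using split[OF \<Lambda>(1)] \<Lambda>(2) by blast
    then show ?thesis by (auto simp: sum_vecs)
  qed
  have "bij_betw ?T (vecs ?FS) (vecs ?pd)"
    unfolding bij_betw_def
    using inj_on_subset[OF inj_on_Linf_functional sum_Linf] T_in T_surj by blast
  moreover have "?T (vadd ?FS \<Phi> \<Psi>) = vadd ?pd (?T \<Phi>) (?T \<Psi>)"
    if "\<Phi> \<in> vecs ?FS" "\<Psi> \<in> vecs ?FS" for \<Phi> \<Psi>
    using that sum_Linf unfolding sum_add pd_add by (intro Linf_functional_add) auto
  moreover have "?T (vscale ?FS c \<Phi>) = vscale ?pd c (?T \<Phi>)"
    if "\<Phi> \<in> vecs ?FS" for c \<Phi>
    using that sum_Linf unfolding sum_scale pd_scale by (intro Linf_functional_scale) auto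
  ultimately have "isometric_isomorphism ?FS ?pd ?T"
    using norm_eq by (simp add: isometric_isomorphism_def)
  with inj_R show ?thesis by blast
qed

end
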